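(* Let $(M,g_0)$ be a closed surface with positive Gauss curvature and $u\in\Gamma_1^+$. Given $\phi,\psi\in T_u\Gamma_1^+\cong C^\infty(M)$, the sectional curvature of the plane in $T_u\Gamma_1^+$ spanned by $\phi,\psi$ is given by $$K(\phi,\psi)=\int_M\frac1{K_u}\Big\{-|\nabla\phi|_u^2|\nabla\psi|_u^2+g_u(\nabla\phi,\nabla\psi)^2\Big\}dA_u=-\int_M\frac1{K_u}\,|d\phi\wedge d\psi|_u^2\,dA_u\le0.$$
   Context: For $u\in C^\infty(M)$, $g_u=e^{2u}g_0$ has Gauss curvature $K_u$ and area form $dA_u$; subscripts $u$ refer to $g_u$, and gradients are taken with respect to $g_u$. $\Gamma_1^+=\{u\in C^\infty(M):K_u>0\}$, with tangent space $T_u\Gamma_1^+\cong C^\infty(M)$ and formal Riemannian metric $\langle\langle\alpha,\beta\rangle\rangle_u=\int_M\alpha\beta K_u\,dA_u$. For a vector field $\alpha=\alpha(\cdot,t)$ along a path $u=u(\cdot,t)$ in $\Gamma_1^+$, the connection is $$\frac{D}{\partial t}\alpha=\frac{\partial\alpha}{\partial t}+\frac1{K_u}\Big\langle\nabla_u\alpha,\nabla_u\frac{\partial u}{\partial t}\Big\rangle_u.$$ The (unnormalized) sectional curvature is $K(\phi,\psi)=\big\langle\big\langle\big(\frac{D}{\partial s}\frac{D}{\partial t}-\frac{D}{\partial t}\frac{D}{\partial s}\big)\frac{\partial u}{\partial t},\frac{\partial u}{\partial s}\big\rangle\big\rangle_u$, evaluated at $(0,0)$ for a smooth two-parameter family $u(s,t)\in\Gamma_1^+$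 with $u(0,0)=u$, $\frac{\partial u}{\partial s}(0,0)=\phi$, $\frac{\partial u}{\partial t}(0,0)=\psi$. The norm on 2-forms is such that $|d\phi\wedge d\psi|_u^2=|\nabla\phi|_u^2|\nabla\psi|_u^2-g_u(\nabla\phi,\nabla\psi)^2$. *)

theory Defs
  imports "HOL-Analysis.Analysis"
begin

section \<open>Smooth maps\<close>

text \<open>These notions are meant for open sets in finite-dimensional spaces, where continuity of
  all directional derivatives is the usual continuous differentiability.\<close>

primrec Ck_on ::
  "nat \<Rightarrow> ('v::real_normed_vector \<Rightarrow> 'w::real_normed_vector) \<Rightarrow> 'v set \<Rightarrow> bool" where
  "Ck_on 0 f S \<longleftrightarrow> continuous_on S f"
| "Ck_on (Suc k) f S \<longleftrightarrow> (\<forall>x\<in>S. f differentiable (at x)) \<and>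
     (\<forall>v. Ck_on k (\<lambda>x. frechet_derivative f (at x) v) S)"

definition smooth_on ::
  "('v::real_normed_vector \<Rightarrow> 'w::real_normed_vector) \<Rightarrow> 'v set \<Rightarrow> bool" where
  "smooth_on f S \<longleftrightarrow> (\<forall>k. Ck_on k f S)"


section \<open>Closed surfaces\<close>

text \<open>A chart consists of its domain and its coordinate map.\<close>

type_synonym 'p chart = "'p set \<times> ('p \<Rightarrow> real^2)"

abbreviation dom_of :: "'p chart \<Rightarrow> 'p set" where
  "dom_of c \<equiv> fst c"

abbreviation coord :: "'p chart \<Rightarrow> 'p \<Rightarrow> real^2" where
  "coord c \<equiv> snd c"

definition param :: "'p chart \<Rightarrow> real^2 \<Rightarrow> 'p" where
  "param c = inv_into (dom_of c) (coord c)"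

definition range_of :: "'p chart \<Rightarrow> (real^2) set" where
  "range_of c = coord c ` dom_of c"

text \<open>The point set carries the subspace topology of the ambient Hausdorff space. The smooth
  structure is the one generated by the (not necessarily maximal) atlas. Connectedness and
  orientability are not required.\<close>

definition closed_surface :: "'p::t2_space set \<Rightarrow> 'p chart set \<Rightarrow> bool" where
  "closed_surface M A \<longleftrightarrow>
     compact M \<and>
     (\<Union>c\<in>A. dom_of c) = M \<and>
     (\<forall>c\<in>A. openin (top_of_set M) (dom_of c) \<and> open (range_of c) \<and>
        homeomorphism (dom_of c) (range_of c) (coord c) (param c)) \<and>
     (\<forall>c\<in>A. \<forall>d\<in>A. smooth_on (coord d \<circ> param c) (coord c ` (dom_of c \<inter> dom_of d)))"

definition smooth_functions :: "'p chart set \<Rightarrow> ('p \<Rightarrow> real) set" where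
  "smooth_functions A = {f. \<forall>c\<in>A. smooth_on (f \<circ> param c) (range_of c)}"

definition chart_at :: "'p chart set \<Rightarrow> 'p \<Rightarrow> 'p chart" where
  "chart_at A p = (SOME c. c \<in> A \<and> p \<in> dom_of c)"

definition partial :: "'p chart \<Rightarrow> 2 \<Rightarrow> ('p \<Rightarrow> real) \<Rightarrow> 'p \<Rightarrow> real" where
  "partial c i f p = frechet_derivative (f \<circ> param c) (at (coord c p)) (axis i 1)"

definition differential :: "'p chart \<Rightarrow> ('p \<Rightarrow> real) \<Rightarrow> 'p \<Rightarrow> real^2" where
  "differential c f p = (\<chi> i. partial c i f p)"


section \<open>Riemannian metrics\<close>

text \<open>A 2-tensor field is given by its matrix of components in each chart. For a metric the
  components are related by the transformation law of a covariant 2-tensor.\<close>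

type_synonym 'p metric = "'p chart \<Rightarrow> 'p \<Rightarrow> real^2^2"

definition riemannian_metric :: "'p chart set \<Rightarrow> 'p metric \<Rightarrow> bool" where
  "riemannian_metric A g \<longleftrightarrow>
     (\<forall>c\<in>A. smooth_on (g c \<circ> param c) (range_of c) \<and>
        (\<forall>p\<in>dom_of c. transpose (g c p) = g c p \<and> (\<forall>v. v \<noteq> 0 \<longrightarrow> v \<bullet> (g c p *v v) > 0))) \<and>
     (\<forall>c\<in>A. \<forall>d\<in>A. \<forall>p\<in>dom_of c \<inter> dom_of d.
        let J = matrix (frechet_derivative (coord d \<circ> param c) (at (coord c p)))
        in g c p = transpose J ** g d p ** J)"

text \<open>\<open>conformal g u\<close> is the metric \<open>e\<^sup>2\<^sup>u g\<close>.\<close>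

definition conformal :: "'p metric \<Rightarrow> ('p \<Rightarrow> real) \<Rightarrow> 'p metric" where
  "conformal g u = (\<lambda>c p. exp (2 * u p) *\<^sub>R g c p)"

text \<open>\<open>christoffel g c k i j\<close> is \<open>\<Gamma>\<^sup>k\<^sub>i\<^sub>j\<close>.\<close>

definition christoffel :: "'p metric \<Rightarrow> 'p chart \<Rightarrow> 2 \<Rightarrow> 2 \<Rightarrow> 2 \<Rightarrow> 'p \<Rightarrow> real" where
  "christoffel g c k i j p =
     (\<Sum>l\<in>UNIV. matrix_inv (g c p) $ k $ l *
        (partial c i (\<lambda>q. g c q $ j $ l) p + partial c j (\<lambda>q. g c q $ i $ l) p
         - partial c l (\<lambda>q. g c q $ i $ j) p)) / 2"

text \<open>\<open>riemann g c l k i j\<close> is the \<open>\<partial>\<^sub>l\<close>-component of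
  \<open>R(\<partial>\<^sub>i, \<partial>\<^sub>j) \<partial>\<^sub>k\<close>, where \<open>R(X,Y) = \<nabla>\<^sub>X \<nabla>\<^sub>Y - \<nabla>\<^sub>Y \<nabla>\<^sub>X - \<nabla>\<^bsub>[X,Y]\<^esub>\<close>.\<close>

definition riemann :: "'p metric \<Rightarrow> 'p chart \<Rightarrow> 2 \<Rightarrow> 2 \<Rightarrow> 2 \<Rightarrow> 2 \<Rightarrow> 'p \<Rightarrow> real" where
  "riemann g c l k i j p =
     partial c i (christoffel g c l j k) p - partial c j (christoffel g c l i k) p
     + (\<Sum>m\<in>UNIV. christoffel g c l i m p * christoffel g c m j k p
                 - christoffel g c l j m p * christoffel g c m i k p)"

text \<open>\<open>K = g(R(\<partial>\<^sub>1, \<partial>\<^sub>2) \<partial>\<^sub>2, \<partial>\<^sub>1) / det g\<close>. The value is the same in every chart around the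
  point, so an arbitrary one is chosen; likewise for the other scalars below.\<close>

definition gauss_curvature :: "'p chart set \<Rightarrow> 'p metric \<Rightarrow> 'p \<Rightarrow> real" where
  "gauss_curvature A g p =
     (let c = chart_at A p
      in (\<Sum>l\<in>UNIV. g c p $ 1 $ l * riemann g c l 2 1 2 p) / det (g c p))"

definition gradient :: "'p metric \<Rightarrow> 'p chart \<Rightarrow> ('p \<Rightarrow> real) \<Rightarrow> 'p \<Rightarrow> real^2" where
  "gradient g c f p = matrix_inv (g c p) *v differential c f p"

text \<open>\<open>grad_inner A g f h p\<close> is \<open>g(\<nabla>f, \<nabla>h)\<close> at \<open>p\<close>.\<close>

definition grad_inner ::
  "'p chart set \<Rightarrow> 'p metric \<Rightarrow> ('p \<Rightarrow> real) \<Rightarrow> ('p \<Rightarrow> real) \<Rightarrow> 'p \<Rightarrow> real" where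
  "grad_inner A g f h p =
     (let c = chart_at A p in gradient g c f p \<bullet> (g c p *v gradient g c h p))"

definition wedge :: "real^2 \<Rightarrow> real^2 \<Rightarrow> real^2^2" where
  "wedge a b = (\<chi> i j. a $ i * b $ j - a $ j * b $ i)"

text \<open>The squared norm of a 2-form is taken over \<open>i < j\<close>, hence the factor 1/2 in the full
  contraction; then \<open>\<bar>a \<and> b\<bar>\<^sup>2 = \<bar>a\<bar>\<^sup>2\<bar>b\<bar>\<^sup>2 - \<langle>a,b\<rangle>\<^sup>2\<close>.\<close>

definition two_form_norm2 :: "real^2^2 \<Rightarrow> real^2^2 \<Rightarrow> real" where
  "two_form_norm2 G \<omega> =
     (\<Sum>i\<in>UNIV. \<Sum>j\<in>UNIV. \<Sum>k\<in>UNIV. \<Sum>l\<in>UNIV.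
        matrix_inv G $ i $ k * matrix_inv G $ j $ l * \<omega> $ i $ j * \<omega> $ k $ l) / 2"

text \<open>\<open>wedge_norm2 A g f h p\<close> is \<open>\<bar>df \<and> dh\<bar>\<^sup>2\<close> at \<open>p\<close>.\<close>

definition wedge_norm2 ::
  "'p chart set \<Rightarrow> 'p metric \<Rightarrow> ('p \<Rightarrow> real) \<Rightarrow> ('p \<Rightarrow> real) \<Rightarrow> 'p \<Rightarrow> real" where
  "wedge_norm2 A g f h p =
     (let c = chart_at A p
      in two_form_norm2 (g c p) (wedge (differential c f p) (differential c h p)))"

text \<open>The Riemannian area is the unique Borel measure that is \<open>\<surd>(det g) dx\<^sub>1 dx\<^sub>2\<close> in every
  chart.\<close>

definition area_measure ::
  "'p::t2_space set \<Rightarrow> 'p chart set \<Rightarrow> 'p metric \<Rightarrow> 'p measure" where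
  "area_measure M A g =
     (THE \<mu>. sets \<mu> = sets (restrict_space borel M) \<and>
        (\<forall>c\<in>A. \<forall>E\<in>sets \<mu>. E \<subseteq> dom_of c \<longrightarrow>
           emeasure \<mu> E =
             (\<integral>\<^sup>+z. ennreal (sqrt (det (g c (param c z)))) * indicator (coord c ` E) z \<partial>lborel)))"


section \<open>The space of conformal factors\<close>

definition Gamma1_plus :: "'p set \<Rightarrow> 'p chart set \<Rightarrow> 'p metric \<Rightarrow> ('p \<Rightarrow> real) set" where
  "Gamma1_plus M A g0 =
     {u \<in> smooth_functions A. \<forall>p\<in>M. gauss_curvature A (conformal g0 u) p > 0}"

definition formal_metric ::
  "'p::t2_space set \<Rightarrow> 'p chart set \<Rightarrow> 'p metric \<Rightarrow> ('p \<Rightarrow> real) \<Rightarrow>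
   ('p \<Rightarrow> real) \<Rightarrow> ('p \<Rightarrow> real) \<Rightarrow> real" where
  "formal_metric M A g0 u \<alpha> \<beta> =
     (LINT p|area_measure M A (conformal g0 u).
        \<alpha> p * \<beta> p * gauss_curvature A (conformal g0 u) p)"

text \<open>\<open>cov_deriv A g0 u \<alpha> t\<close> is \<open>D\<alpha>/\<partial>t\<close> at time \<open>t\<close>, for a vector field \<open>\<alpha>\<close> along
  the path \<open>u\<close>.\<close>

definition cov_deriv ::
  "'p chart set \<Rightarrow> 'p metric \<Rightarrow> (real \<Rightarrow> 'p \<Rightarrow> real) \<Rightarrow> (real \<Rightarrow> 'p \<Rightarrow> real) \<Rightarrow>
   real \<Rightarrow> 'p \<Rightarrow> real" where
  "cov_deriv A g0 u \<alpha> t p =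
     deriv (\<lambda>\<tau>. \<alpha> \<tau> p) t +
     1 / gauss_curvature A (conformal g0 (u t)) p *
       grad_inner A (conformal g0 (u t)) (\<alpha> t) (\<lambda>q. deriv (\<lambda>\<tau>. u \<tau> q) t) p"

text \<open>For two-parameter families \<open>w s t\<close>, the subscripts s and t mark the parameter with
  respect to which one differentiates.\<close>

definition d_s :: "(real \<Rightarrow> real \<Rightarrow> 'p \<Rightarrow> real) \<Rightarrow> real \<Rightarrow> real \<Rightarrow> 'p \<Rightarrow> real" where
  "d_s w s t p = deriv (\<lambda>\<sigma>. w \<sigma> t p) s"

definition d_t :: "(real \<Rightarrow> real \<Rightarrow> 'p \<Rightarrow> real) \<Rightarrow> real \<Rightarrow> real \<Rightarrow> 'p \<Rightarrow> real" where
  "d_t w s t p = deriv (\<lambda>\<tau>. w s \<tau> p) t"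

definition cov_s ::
  "'p chart set \<Rightarrow> 'p metric \<Rightarrow> (real \<Rightarrow> real \<Rightarrow> 'p \<Rightarrow> real) \<Rightarrow>
   (real \<Rightarrow> real \<Rightarrow> 'p \<Rightarrow> real) \<Rightarrow> real \<Rightarrow> real \<Rightarrow> 'p \<Rightarrow> real" where
  "cov_s A g0 w \<alpha> s t = cov_deriv A g0 (\<lambda>\<sigma>. w \<sigma> t) (\<lambda>\<sigma>. \<alpha> \<sigma> t) s"

definition cov_t ::
  "'p chart set \<Rightarrow> 'p metric \<Rightarrow> (real \<Rightarrow> real \<Rightarrow> 'p \<Rightarrow> real) \<Rightarrow>
   (real \<Rightarrow> real \<Rightarrow> 'p \<Rightarrow> real) \<Rightarrow> real \<Rightarrow> real \<Rightarrow> 'p \<Rightarrow> real" where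
  "cov_t A g0 w \<alpha> s t = cov_deriv A g0 (\<lambda>\<tau>. w s \<tau>) (\<lambda>\<tau>. \<alpha> s \<tau>) t"

text \<open>Families are only required to be defined for parameters near \<open>(0,0)\<close>.\<close>

definition family_through ::
  "'p set \<Rightarrow> 'p chart set \<Rightarrow> 'p metric \<Rightarrow> ('p \<Rightarrow> real) \<Rightarrow> ('p \<Rightarrow> real) \<Rightarrow>
   ('p \<Rightarrow> real) \<Rightarrow> (real \<Rightarrow> real \<Rightarrow> 'p \<Rightarrow> real) \<Rightarrow> bool" where
  "family_through M A g0 u \<phi> \<psi> w \<longleftrightarrow>
     (\<exists>\<epsilon>>0.
        (\<forall>c\<in>A. smooth_on (\<lambda>(s, t, z). w s t (param c z))
                  ({-\<epsilon><..<\<epsilon>} \<times> {-\<epsilon><..<\<epsilon>} \<times> range_of c)) \<and>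
        (\<forall>s\<in>{-\<epsilon><..<\<epsilon>}. \<forall>t\<in>{-\<epsilon><..<\<epsilon>}. w s t \<in> Gamma1_plus M A g0)) \<and>
     (\<forall>p\<in>M. w 0 0 p = u p \<and> d_s w 0 0 p = \<phi> p \<and> d_t w 0 0 p = \<psi> p)"

definition family_curvature ::
  "'p::t2_space set \<Rightarrow> 'p chart set \<Rightarrow> 'p metric \<Rightarrow>
   (real \<Rightarrow> real \<Rightarrow> 'p \<Rightarrow> real) \<Rightarrow> real" where
  "family_curvature M A g0 w =
     formal_metric M A g0 (w 0 0)
       (\<lambda>p. cov_s A g0 w (cov_t A g0 w (d_t w)) 0 0 p
           - cov_t A g0 w (cov_s A g0 w (d_t w)) 0 0 p)
       (d_s w 0 0)"

text \<open>The common value of \<open>family_curvature\<close> over all families through \<open>u\<close> with velocities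
  \<open>\<phi>\<close> and \<open>\<psi>\<close>.\<close>

definition sectional_curvature ::
  "'p::t2_space set \<Rightarrow> 'p chart set \<Rightarrow> 'p metric \<Rightarrow> ('p \<Rightarrow> real) \<Rightarrow>
   ('p \<Rightarrow> real) \<Rightarrow> ('p \<Rightarrow> real) \<Rightarrow> real" where
  "sectional_curvature M A g0 u \<phi> \<psi> =
     (THE k. \<exists>w. family_through M A g0 u \<phi> \<psi> w \<and> family_curvature M A g0 w = k)"

end

(* With respect to the base metric g = e^(2u) g0, a conformal metric e^(2v) g satisfies
   e^(2v) K(e^(2v) g) = Phi := K - Delta v, so the connection reads
   D alpha/dt = alpha_t + <grad alpha, grad w_t> / Phi with the inner product of g. In the commutator of
   the two covariant derivatives of w_t all derivatives of w of order two and more in the parameters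
   cancel, and at the base point there remains
     (|grad psi|^2 Delta phi - <grad psi, grad phi> Delta psi) / K^2
     + (<grad (|grad psi|^2 / K), grad phi> - <grad (<grad psi, grad phi> / K), grad psi>) / K.
   Multiplied by phi K this is phi div X with
     X = (|grad psi|^2 / K) grad phi - (<grad psi, grad phi> / K) grad psi,
   and integration by parts gives the formula. Everything is computed in charts; what makes this
   legitimate is that the curvature, defined from Christoffel symbols, does not depend on the chart,
   and that the chart densities sqrt(det g) dx glue to a measure by the change of variables formula. *)

theory Submission
  imports Defs
begin

section \<open>Calculus of \<open>C\<^sup>k\<close> maps\<close>

text \<open>\<open>sectional_curvature\<close> is a definite description, so two things are owed
  beyond the computation: all families through \<open>u\<close> must give the same value, and at
  least one family must exist. The second is met by \<open>u + s * \<phi> + t * \<psi>\<close>,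
  which stays in the positive cone for small parameters because Phi is affine in the conformal
  exponent and \<open>M\<close> is compact. Taking the metric at the base point as reference has the
  further effect that gradients and Laplacian no longer depend on the parameters, so parameter
  derivatives pass through them. The Laplacian is not introduced as a divergence. It is read off
  from the curvature of \<open>conformal g a\<close>, which makes it chart independent as soon as
  the curvature is; its divergence form is used only inside one chart. Integration by parts is
  localised with cut-off functions built from the square of a positive part, which are only of class
  C^1. Therefore Green's identity has a C^1 first argument and a smooth second one, and the calculus
  is developed for \<open>Ck_on\<close> and not just for \<open>smooth_on\<close>.\<close>

definition dderiv :: "'v \<Rightarrow> ('v::real_normed_vector \<Rightarrow> 'w::real_normed_vector) \<Rightarrow> 'v \<Rightarrow> 'w" where
  "dderiv v f x = frechet_derivative f (at x) v"

lemma Ck_on_Suc: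
  "Ck_on (Suc k) f S \<longleftrightarrow> (\<forall>x\<in>S. f differentiable (at x)) \<and> (\<forall>v. Ck_on k (dderiv v f) S)"
  by (simp add: dderiv_def[abs_def])

lemma dderiv_eq: "(f has_derivative f') (at x) \<Longrightarrow> dderiv v f x = f' v"
  unfolding dderiv_def by (metis frechet_derivative_at)

lemma dderiv_works: "f differentiable (at x) \<Longrightarrow> (f has_derivative (\<lambda>v. dderiv v f x)) (at x)"
  unfolding dderiv_def by (simp add: frechet_derivative_works)

text \<open>Both functions have the same derivatives at \<open>x\<close>, so the choice behind
  \<open>frechet_derivative\<close> returns the same map even where they are not differentiable.
  This is how an identity valid on an open set is substituted under a derivative throughout.\<close>

lemma dderiv_cong_open:
  assumes "open S" "x \<in> S" "\<And>y. y \<in> S \<Longrightarrow> f y = g y"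
  shows "dderiv v f x = dderiv v g x"
proof -
  have "(f has_derivative f') (at x) \<longleftrightarrow> (g has_derivative f') (at x)" for f'
    using has_derivative_transform_within_open[of f f' x UNIV S g]
      has_derivative_transform_within_open[of g f' x UNIV S f] assms by auto
  then show ?thesis by (simp add: dderiv_def frechet_derivative_def)
qed

lemma differentiable_cong_open:
  assumes "open S" "x \<in> S" "\<And>y. y \<in> S \<Longrightarrow> f y = g y"
  shows "f differentiable (at x) \<longleftrightarrow> g differentiable (at x)"
  using has_derivative_transform_within_open[of f _ x UNIV S g]
    has_derivative_transform_within_open[of g _ x UNIV S f] assms
  unfolding differentiable_def by auto

lemma Ck_on_cong:
  assumes "open S" "\<And>x. x \<in> S \<Longrightarrow> f x = g x"
  shows "Ck_on k f S \<longleftrightarrow> Ck_on k g S"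
  using assms(2)
proof (induction k arbitrary: f g)
  case 0
  then show ?case by (auto intro: continuous_on_cong)
next
  case (Suc k)
  have "Ck_on k (dderiv v f) S \<longleftrightarrow> Ck_on k (dderiv v g) S" for v
    by (rule Suc.IH) (use dderiv_cong_open[OF assms(1)] Suc.prems in blast)
  then show ?case
    unfolding Ck_on_Suc using differentiable_cong_open[OF assms(1)] Suc.prems by blast
qed

text \<open>Lets an induction on \<open>k\<close> work with an explicit formula for the derivative
  in place of the chosen \<open>frechet_derivative\<close>.\<close>

lemma Ck_on_SucI:
  assumes "open S" "\<And>x. x \<in> S \<Longrightarrow> (f has_derivative (\<lambda>v. f' v x)) (at x)" "\<And>v. Ck_on k (f' v) S"
  shows "Ck_on (Suc k) f S"
proof -
  have "Ck_on k (dderiv v f) S \<longleftrightarrow> Ck_on k (f' v) S" for v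
    by (rule Ck_on_cong[OF assms(1)]) (use dderiv_eq[OF assms(2)] in auto)
  then show ?thesis unfolding Ck_on_Suc using assms(2,3) by (auto simp: differentiable_def)
qed

lemma Ck_on_differentiable: "Ck_on (Suc k) f S \<Longrightarrow> x \<in> S \<Longrightarrow> f differentiable (at x)"
  by simp

lemma Ck_on_dderiv: "Ck_on (Suc k) f S \<Longrightarrow> Ck_on k (dderiv v f) S"
  unfolding Ck_on_Suc by blast

lemma Ck_on_SucD: "Ck_on (Suc k) f S \<Longrightarrow> Ck_on k f S"
proof (induction k arbitrary: f)
  case 0
  then show ?case
    by (auto intro!: continuous_at_imp_continuous_on differentiable_imp_continuous_within)
next
  case (Suc k)
  then show ?case by (metis Ck_on_Suc)
qed

lemma Ck_on_mono:
  assumes "Ck_on n f S" "k \<le> n" shows "Ck_on k f S"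
  using assms(2,1) by (induction rule: dec_induct) (auto dest: Ck_on_SucD simp del: Ck_on.simps)

lemma Ck_on_continuous: "Ck_on k f S \<Longrightarrow> continuous_on S f"
  using Ck_on_mono[of k f S 0] by simp

lemma Ck_on_subset: "Ck_on k f S \<Longrightarrow> T \<subseteq> S \<Longrightarrow> Ck_on k f T"
  by (induction k arbitrary: f) (auto intro: continuous_on_subset)

text \<open>Differentiability is pointwise, so openness matters only for continuity at order 0. The
  lemma glues a function with compact support to its extension by zero.\<close>

lemma Ck_on_open_Un:
  assumes "open S" "open T" "Ck_on k f S" "Ck_on k f T"
  shows "Ck_on k f (S \<union> T)"
  using assms(3,4)
proof (induction k arbitrary: f)
  case 0
  then show ?case by (simp add: continuous_on_open_Un assms(1,2))
next
  case (Suc k)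
  then show ?case unfolding Ck_on_Suc by blast
qed

lemma Ck_on_const: "Ck_on k (\<lambda>x. c) S"
proof (induction k arbitrary: c)
  case (Suc k)
  have "dderiv v (\<lambda>x. c) = (\<lambda>x. 0)" for v :: 'a by (simp add: dderiv_def[abs_def])
  then show ?case unfolding Ck_on_Suc using Suc by simp
qed simp

lemma Ck_on_bounded_linear:
  assumes "bounded_linear f" "open S" shows "Ck_on k f S"
proof (cases k)
  case 0
  then show ?thesis using assms by (simp add: linear_continuous_on)
next
  case (Suc n)
  show ?thesis unfolding Suc
    by (rule Ck_on_SucI[where f'="\<lambda>v x. f v"])
      (auto intro: assms bounded_linear_imp_has_derivative Ck_on_const)
qed

lemma Ck_on_add:
  assumes "open S" "Ck_on k f S" "Ck_on k g S" shows "Ck_on k (\<lambda>x. f x + g x) S"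
  using assms(2,3)
proof (induction k arbitrary: f g)
  case 0
  then show ?case by (auto intro: continuous_on_add)
next
  case (Suc k)
  show ?case
    by (rule Ck_on_SucI[where f'="\<lambda>v x. dderiv v f x + dderiv v g x", OF assms(1)])
      (intro has_derivative_add dderiv_works Suc.IH Ck_on_dderiv Ck_on_differentiable, (rule Suc.prems | assumption)+)+
qed

lemma Ck_on_sum:
  assumes "open S" "\<And>i. i \<in> I \<Longrightarrow> Ck_on k (f i) S" shows "Ck_on k (\<lambda>x. \<Sum>i\<in>I. f i x) S"
  using assms(2)
  by (induction I rule: infinite_finite_induct) (auto simp: Ck_on_const intro!: Ck_on_add[OF assms(1)])

text \<open>By the product rule each derivative is again a sum of products of the same bilinear
  kind, one order lower. Multiplication, scaling and inner products are all instances.\<close>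

lemma (in bounded_bilinear) Ck_on_prod:
  assumes "open S" "Ck_on k f S" "Ck_on k g S" shows "Ck_on k (\<lambda>x. prod (f x) (g x)) S"
  using assms(2,3)
proof (induction k arbitrary: f g)
  case 0
  then show ?case by (auto intro: continuous_on)
next
  case (Suc k)
  show ?case
  proof (rule Ck_on_SucI[where f'="\<lambda>v x. prod (f x) (dderiv v g x) + prod (dderiv v f x) (g x)", OF assms(1)])
    show "((\<lambda>x. prod (f x) (g x)) has_derivative
       (\<lambda>v. prod (f x) (dderiv v g x) + prod (dderiv v f x) (g x))) (at x)" if "x \<in> S" for x
      by (rule FDERIV) (intro dderiv_works Ck_on_differentiable[OF _ that], fact+)+
    show "Ck_on k (\<lambda>x. prod (f x) (dderiv v g x) + prod (dderiv v f x) (g x)) S" for v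
      by (intro Ck_on_add[OF assms(1)] Suc.IH) (use Suc.prems Ck_on_dderiv Ck_on_SucD in blast)+
  qed
qed

lemmas Ck_on_mult = bounded_bilinear.Ck_on_prod[OF bounded_bilinear_mult]
lemmas Ck_on_scaleR = bounded_bilinear.Ck_on_prod[OF bounded_bilinear_scaleR]

lemma Ck_on_minus:
  assumes "open S" "Ck_on k f S" shows "Ck_on k (\<lambda>x. - f x) S"
  using Ck_on_scaleR[OF assms(1) Ck_on_const[of k "-1"] assms(2)] by simp

lemma Ck_on_diff:
  assumes "open S" "Ck_on k f S" "Ck_on k g S" shows "Ck_on k (\<lambda>x. f x - g x) S"
  using Ck_on_add[OF assms(1,2) Ck_on_minus[OF assms(1,3)]] by simp

lemma Ck_on_power:
  fixes f :: "'a::real_normed_vector \<Rightarrow> real"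
  assumes "open S" "Ck_on k f S" shows "Ck_on k (\<lambda>x. f x ^ n) S"
  by (induction n) (auto intro!: Ck_on_const Ck_on_mult assms)

text \<open>By the chain rule the derivative of \<open>g\<close> is taken in the direction
  \<open>dderiv v f x\<close>, which moves with \<open>x\<close>, whereas \<open>Ck_on\<close>
  controls fixed directions only. Expanding the direction in \<open>Basis\<close> cures this, hence
  the Euclidean middle space.\<close>

lemma Ck_on_compose:
  fixes f :: "'a::real_normed_vector \<Rightarrow> 'b::euclidean_space" and g :: "'b \<Rightarrow> 'c::real_normed_vector"
  assumes "open S" "open T" "f ` S \<subseteq> T" "Ck_on k f S" "Ck_on k g T"
  shows "Ck_on k (\<lambda>x. g (f x)) S"
  using assms(4,5)
proof (induction k arbitrary: g)
  case 0
  then show ?case using assms(3) by (auto intro: continuous_on_compose2)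
next
  case (Suc k)
  have gf: "((\<lambda>x. g (f x)) has_derivative (\<lambda>v. dderiv (dderiv v f x) g (f x))) (at x)" if "x \<in> S" for x
    using diff_chain_at[OF dderiv_works dderiv_works, of f x g] that assms(3) Suc.prems
    by (auto simp: comp_def)
  have eq: "dderiv (dderiv v f x) g (f x) = (\<Sum>b\<in>Basis. (dderiv v f x \<bullet> b) *\<^sub>R dderiv b g (f x))"
    if "x \<in> S" for v x
  proof -
    have "g differentiable (at (f x))"
      using that assms(3) Suc.prems(2) by auto
    then have "linear (\<lambda>v. dderiv v g (f x))"
      using dderiv_works has_derivative_linear by blast
    then have "(\<Sum>b\<in>Basis. (dderiv v f x \<bullet> b) *\<^sub>R dderiv b g (f x))
        = dderiv (\<Sum>b\<in>Basis. (dderiv v f x \<bullet> b) *\<^sub>R b) g (f x)"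
      by (subst linear_sum[of "\<lambda>v. dderiv v g (f x)"]) (auto simp: linear_scale[of "\<lambda>v. dderiv v g (f x)"])
    then show ?thesis by (simp add: euclidean_representation)
  qed
  show ?case
  proof (rule Ck_on_SucI[where f'="\<lambda>v x. \<Sum>b\<in>Basis. (dderiv v f x \<bullet> b) *\<^sub>R dderiv b g (f x)", OF assms(1)])
    show "((\<lambda>x. g (f x)) has_derivative
        (\<lambda>v. \<Sum>b\<in>Basis. (dderiv v f x \<bullet> b) *\<^sub>R dderiv b g (f x))) (at x)" if "x \<in> S" for x
      using gf[OF that] eq[OF that] by simp
    show "Ck_on k (\<lambda>x. \<Sum>b\<in>Basis. (dderiv v f x \<bullet> b) *\<^sub>R dderiv b g (f x)) S" for v
    proof (intro Ck_on_sum Ck_on_scaleR assms(1) Suc.IH)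
      fix b :: 'b
      show "Ck_on k (\<lambda>x. dderiv v f x \<bullet> b) S"
        by (rule bounded_bilinear.Ck_on_prod[OF bounded_bilinear_inner assms(1)])
          (auto intro: Ck_on_const Ck_on_dderiv Suc.prems)
      show "Ck_on k f S" "Ck_on k (dderiv b g) T"
        using Suc.prems Ck_on_SucD Ck_on_dderiv by blast+
    qed
  qed
qed

text \<open>The derivative of \<open>inverse\<close> is a product of copies of
  \<open>inverse\<close> itself, so the induction closes; \<open>exp\<close> and \<open>sqrt\<close>
  below follow the same pattern.\<close>

lemma Ck_on_real_inverse: "Ck_on k (inverse :: real \<Rightarrow> real) (- {0})"
proof (induction k)
  case 0
  then show ?case by (auto intro!: continuous_intros)
next
  case (Suc k)
  show ?case
    by (rule Ck_on_SucI[where f'="\<lambda>v x. - (inverse x * v * inverse x)"])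
      (auto intro!: has_derivative_inverse' Ck_on_minus Ck_on_mult Suc Ck_on_const)
qed

lemma Ck_on_inverse:
  fixes f :: "'a::real_normed_vector \<Rightarrow> real"
  assumes "open S" "Ck_on k f S" "\<And>x. x \<in> S \<Longrightarrow> f x \<noteq> 0"
  shows "Ck_on k (\<lambda>x. inverse (f x)) S"
  by (rule Ck_on_compose[OF assms(1) _ _ assms(2) Ck_on_real_inverse]) (use assms(3) in auto)

lemma Ck_on_divide:
  fixes f :: "'a::real_normed_vector \<Rightarrow> real"
  assumes "open S" "Ck_on k f S" "Ck_on k g S" "\<And>x. x \<in> S \<Longrightarrow> g x \<noteq> 0"
  shows "Ck_on k (\<lambda>x. f x / g x) S"
  unfolding divide_inverse using assms by (intro Ck_on_mult Ck_on_inverse)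

lemma Ck_on_exp:
  fixes f :: "'a::real_normed_vector \<Rightarrow> real"
  assumes "open S" "Ck_on k f S"
  shows "Ck_on k (\<lambda>x. exp (f x)) S"
proof -
  have "Ck_on k (exp :: real \<Rightarrow> real) UNIV"
  proof (induction k)
    case (Suc k)
    show ?case
    proof (rule Ck_on_SucI[where f'="\<lambda>v x. exp x * v"])
      show "(exp has_derivative (\<lambda>v. exp x * v)) (at x)" for x :: real
        using has_derivative_exp[OF has_derivative_ident, of x UNIV] by (simp add: mult.commute)
      show "Ck_on k (\<lambda>x. exp x * v) UNIV" for v :: real
        by (intro Ck_on_mult Suc Ck_on_const) auto
    qed auto
  qed (simp add: continuous_on_exp)
  then show ?thesis using Ck_on_compose[OF assms(1) open_UNIV subset_UNIV assms(2)] by blast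
qed

lemma Ck_on_sqrt:
  assumes "open S" "Ck_on k f S" "\<And>x. x \<in> S \<Longrightarrow> f x > 0"
  shows "Ck_on k (\<lambda>x. sqrt (f x)) S"
proof -
  have "Ck_on k sqrt {0<..}"
  proof (induction k)
    case 0
    then show ?case by (auto intro!: continuous_intros)
  next
    case (Suc k)
    show ?case
    proof (rule Ck_on_SucI[where f'="\<lambda>v x. v * inverse (sqrt x * 2)"])
      show "(sqrt has_derivative (\<lambda>v. v * inverse (sqrt x * 2))) (at x)" if "x \<in> {0<..}" for x :: real
      proof -
        have "(*) (inverse (sqrt x) / 2) = (\<lambda>v. v * inverse (sqrt x * 2))"
          by (auto simp: field_simps)
        then show ?thesis using DERIV_real_sqrt[of x] that by (simp add: has_field_derivative_def)
      qed
      show "Ck_on k (\<lambda>x. v * inverse (sqrt x * 2)) {0<..}" for v :: real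
        by (intro Ck_on_mult Suc Ck_on_const Ck_on_inverse) auto
    qed auto
  qed
  then show ?thesis using Ck_on_compose[OF assms(1) open_greaterThan _ assms(2)] assms(3) by blast
qed

section \<open>Closure properties of smooth maps\<close>

lemma smooth_on_Ck_on: "smooth_on f S \<Longrightarrow> Ck_on k f S"
  by (simp add: smooth_on_def)

lemma smooth_on_cong:
  assumes "open S" "\<And>x. x \<in> S \<Longrightarrow> f x = g x"
  shows "smooth_on f S \<longleftrightarrow> smooth_on g S"
  using Ck_on_cong[of S f g] assms by (auto simp: smooth_on_def)

lemma smooth_on_subset: "smooth_on f S \<Longrightarrow> T \<subseteq> S \<Longrightarrow> smooth_on f T"
  unfolding smooth_on_def using Ck_on_subset by blast

lemma smooth_on_dderiv: "smooth_on f S \<Longrightarrow> smooth_on (dderiv v f) S"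
  unfolding smooth_on_def using Ck_on_dderiv by blast

lemma smooth_on_const: "smooth_on (\<lambda>x. c) S"
  unfolding smooth_on_def by (simp add: Ck_on_const)

lemma smooth_on_bounded_linear: "bounded_linear f \<Longrightarrow> open S \<Longrightarrow> smooth_on f S"
  unfolding smooth_on_def by (simp add: Ck_on_bounded_linear)

lemma smooth_on_add: "open S \<Longrightarrow> smooth_on f S \<Longrightarrow> smooth_on g S \<Longrightarrow> smooth_on (\<lambda>x. f x + g x) S"
  unfolding smooth_on_def by (simp add: Ck_on_add)

lemma smooth_on_minus: "open S \<Longrightarrow> smooth_on f S \<Longrightarrow> smooth_on (\<lambda>x. - f x) S"
  unfolding smooth_on_def by (simp add: Ck_on_minus)

lemma smooth_on_diff: "open S \<Longrightarrow> smooth_on f S \<Longrightarrow> smooth_on g S \<Longrightarrow> smooth_on (\<lambda>x. f x - g x) S"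
  unfolding smooth_on_def by (simp add: Ck_on_diff)

lemma smooth_on_mult:
  fixes f g :: "'a::real_normed_vector \<Rightarrow> real"
  shows "open S \<Longrightarrow> smooth_on f S \<Longrightarrow> smooth_on g S \<Longrightarrow> smooth_on (\<lambda>x. f x * g x) S"
  unfolding smooth_on_def by (simp add: Ck_on_mult)

lemma smooth_on_power:
  fixes f :: "'a::real_normed_vector \<Rightarrow> real"
  shows "open S \<Longrightarrow> smooth_on f S \<Longrightarrow> smooth_on (\<lambda>x. f x ^ n) S"
  unfolding smooth_on_def by (simp add: Ck_on_power)

lemma smooth_on_divide:
  fixes f :: "'a::real_normed_vector \<Rightarrow> real"
  assumes "open S" "smooth_on f S" "smooth_on g S" "\<And>x. x \<in> S \<Longrightarrow> g x \<noteq> 0"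
  shows "smooth_on (\<lambda>x. f x / g x) S"
  using assms unfolding smooth_on_def by (simp add: Ck_on_divide)

lemma smooth_on_exp:
  fixes f :: "'a::real_normed_vector \<Rightarrow> real"
  shows "open S \<Longrightarrow> smooth_on f S \<Longrightarrow> smooth_on (\<lambda>x. exp (f x)) S"
  unfolding smooth_on_def by (simp add: Ck_on_exp)

lemma smooth_on_compose:
  fixes f :: "'a::real_normed_vector \<Rightarrow> 'b::euclidean_space" and g :: "'b \<Rightarrow> 'c::real_normed_vector"
  assumes "open S" "open T" "f ` S \<subseteq> T" "smooth_on f S" "smooth_on g T"
  shows "smooth_on (\<lambda>x. g (f x)) S"
  using assms unfolding smooth_on_def by (simp add: Ck_on_compose)

lemmas smooth_on_intros = smooth_on_dderiv smooth_on_const smooth_on_add smooth_on_minus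
  smooth_on_diff smooth_on_mult smooth_on_power smooth_on_divide smooth_on_exp

lemma smooth_on_differentiable: "smooth_on f S \<Longrightarrow> x \<in> S \<Longrightarrow> f differentiable (at x)"
  using smooth_on_Ck_on[of f S 1] by simp

lemma smooth_on_continuous: "smooth_on f S \<Longrightarrow> continuous_on S f"
  using smooth_on_Ck_on[of f S 0] by simp

section \<open>Restriction to lines and symmetry of second derivatives\<close>

lemma has_real_derivative_line:
  fixes f :: "'v::real_normed_vector \<Rightarrow> real"
  assumes "f differentiable (at (x + a *\<^sub>R v))"
  shows "((\<lambda>a. f (x + a *\<^sub>R v)) has_real_derivative dderiv v f (x + a *\<^sub>R v)) (at a)"
proof -
  have "((\<lambda>a. x + a *\<^sub>R v) has_derivative (\<lambda>h. h *\<^sub>R v)) (at a)"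
    by (auto intro!: derivative_eq_intros)
  from diff_chain_at[OF this dderiv_works[OF assms]]
  have "((\<lambda>a. f (x + a *\<^sub>R v)) has_derivative (\<lambda>h. dderiv (h *\<^sub>R v) f (x + a *\<^sub>R v))) (at a)"
    by (simp add: comp_def)
  moreover have "dderiv (h *\<^sub>R v) f (x + a *\<^sub>R v) = dderiv v f (x + a *\<^sub>R v) * h" for h
    using linear_scale[OF has_derivative_linear[OF dderiv_works[OF assms]], of h v] by simp
  ultimately show ?thesis by (simp add: has_field_derivative_def)
qed

text \<open>The second difference quotient equals a mixed second derivative at an intermediate point, by
  two applications of the mean value theorem; being symmetric in \<open>v\<close> and \<open>w\<close>, it also equals the
  mixed derivative taken in the other order.\<close>

lemma second_difference_eq:
  fixes f :: "'v::real_normed_vector \<Rightarrow> real"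
  assumes f: "Ck_on 2 f S" and S: "\<And>a b. 0 \<le> a \<Longrightarrow> a \<le> h \<Longrightarrow> 0 \<le> b \<Longrightarrow> b \<le> h \<Longrightarrow> x + a *\<^sub>R v + b *\<^sub>R w \<in> S"
    and h: "h > 0"
  obtains a b where "0 < a" "a < h" "0 < b" "b < h"
    "f (x + h *\<^sub>R v + h *\<^sub>R w) - f (x + h *\<^sub>R v) - f (x + h *\<^sub>R w) + f x
      = h * h * dderiv w (dderiv v f) (x + a *\<^sub>R v + b *\<^sub>R w)"
proof -
  have f2: "Ck_on (Suc (Suc 0)) f S" using f by (simp only: numeral_2_eq_2)
  have d1: "f differentiable (at y)" and d2: "dderiv v f differentiable (at y)" if "y \<in> S" for y
    using f2 that by (simp_all add: dderiv_def[abs_def])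
  define G where "G a = f (x + h *\<^sub>R w + a *\<^sub>R v) - f (x + a *\<^sub>R v)" for a
  have dG: "(G has_real_derivative (dderiv v f (x + h *\<^sub>R w + a *\<^sub>R v) - dderiv v f (x + a *\<^sub>R v))) (at a)"
    if "0 \<le> a" "a \<le> h" for a
    unfolding G_def using S[of a h] S[of a 0] that h
    by (intro DERIV_diff has_real_derivative_line d1) (auto simp: algebra_simps)
  from MVT2[OF h dG] obtain a where a: "0 < a" "a < h"
    and Ga: "G h - G 0 = h * (dderiv v f (x + h *\<^sub>R w + a *\<^sub>R v) - dderiv v f (x + a *\<^sub>R v))" by auto
  have dL: "((\<lambda>b. dderiv v f (x + a *\<^sub>R v + b *\<^sub>R w)) has_real_derivative
      dderiv w (dderiv v f) (x + a *\<^sub>R v + b *\<^sub>R w)) (at b)" if "0 \<le> b" "b \<le> h" for b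
    using S[of a b] that a by (intro has_real_derivative_line d2) auto
  from MVT2[OF h dL] obtain b where b: "0 < b" "b < h"
    and "dderiv v f (x + a *\<^sub>R v + h *\<^sub>R w) - dderiv v f (x + a *\<^sub>R v)
      = h * dderiv w (dderiv v f) (x + a *\<^sub>R v + b *\<^sub>R w)" by auto
  with Ga have "G h - G 0 = h * h * dderiv w (dderiv v f) (x + a *\<^sub>R v + b *\<^sub>R w)"
    by (simp add: algebra_simps)
  then show thesis using that[OF a b] by (simp add: G_def algebra_simps)
qed

lemma dderiv_commute_Ck:
  fixes f :: "'v::real_normed_vector \<Rightarrow> real"
  assumes f: "Ck_on 2 f S" and S: "open S" "x \<in> S"
  shows "dderiv w (dderiv v f) x = dderiv v (dderiv w f) x"
proof -
  have f2: "Ck_on (Suc (Suc 0)) f S" using f by (simp only: numeral_2_eq_2)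
  have c: "isCont (dderiv w (dderiv v f)) x" for v w
    using Ck_on_dderiv[OF Ck_on_dderiv[OF f2]] S by (simp add: continuous_on_eq_continuous_at)
  have le: "\<bar>dderiv w (dderiv v f) x - dderiv v (dderiv w f) x\<bar> \<le> e" if e: "e > 0" for e
  proof -
    obtain r1 where r1: "r1 > 0" "\<And>y. dist y x < r1 \<Longrightarrow> dist (dderiv w (dderiv v f) y) (dderiv w (dderiv v f) x) < e/2"
      using c[of w v, unfolded continuous_at_eps_delta, rule_format, of "e/2"] e by auto
    obtain r2 where r2: "r2 > 0" "\<And>y. dist y x < r2 \<Longrightarrow> dist (dderiv v (dderiv w f) y) (dderiv v (dderiv w f) x) < e/2"
      using c[of v w, unfolded continuous_at_eps_delta, rule_format, of "e/2"] e by auto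
    obtain r3 where r3: "r3 > 0" "ball x r3 \<subseteq> S" using S open_contains_ball by blast
    define r where "r = min r1 (min r2 r3)"
    have r: "r > 0" using r1 r2 r3 by (simp add: r_def)
    \<comment> \<open>This size keeps the whole parallelogram with sides
      \<open>h *\<^sub>R v\<close> and \<open>h *\<^sub>R w\<close> inside the ball of radius
      \<open>r\<close>; the summand 1 makes the bound strict and covers
      \<open>v = w = 0\<close>.\<close>
    define h where "h = r / (norm v + norm w + 1)"
    have n: "norm v + norm w + 1 > 0" by (simp add: add_nonneg_pos)
    have h: "h > 0" using r n by (simp add: h_def)
    have near: "dist (x + a *\<^sub>R v + b *\<^sub>R w) x < r" if "0 \<le> a" "a \<le> h" "0 \<le> b" "b \<le> h" for a b
    proof -
      have "dist (x + a *\<^sub>R v + b *\<^sub>R w) x = norm (a *\<^sub>R v + b *\<^sub>R w)" by (simp add: dist_norm)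
      also have "\<dots> \<le> a * norm v + b * norm w" using norm_triangle_ineq[of "a *\<^sub>R v" "b *\<^sub>R w"] that by simp
      also have "\<dots> \<le> h * norm v + h * norm w" using that by (intro add_mono mult_right_mono) auto
      also have "\<dots> < h * (norm v + norm w + 1)" using h by (simp add: algebra_simps)
      also have "\<dots> = r" using n by (simp add: h_def)
      finally show ?thesis .
    qed
    have in_S: "x + a *\<^sub>R v + b *\<^sub>R w \<in> S" if "0 \<le> a" "a \<le> h" "0 \<le> b" "b \<le> h" for a b
      using near[OF that] r3 by (auto simp: r_def dist_commute)
    obtain a b where ab: "0 < a" "a < h" "0 < b" "b < h" and
      1: "f (x + h *\<^sub>R v + h *\<^sub>R w) - f (x + h *\<^sub>R v) - f (x + h *\<^sub>R w) + f x
      = h * h * dderiv w (dderiv v f) (x + a *\<^sub>R v + b *\<^sub>R w)"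
      by (rule second_difference_eq[OF f _ h, of x v w]) (use in_S in auto)
    have in_S': "x + b *\<^sub>R w + a *\<^sub>R v \<in> S" if "0 \<le> b" "b \<le> h" "0 \<le> a" "a \<le> h" for a b
      using in_S[OF that(3,4,1,2)] by (simp add: algebra_simps)
    obtain a' b' where ab': "0 < a'" "a' < h" "0 < b'" "b' < h" and
      2: "f (x + h *\<^sub>R w + h *\<^sub>R v) - f (x + h *\<^sub>R w) - f (x + h *\<^sub>R v) + f x
      = h * h * dderiv v (dderiv w f) (x + b' *\<^sub>R w + a' *\<^sub>R v)"
      by (rule second_difference_eq[OF f _ h, of x w v]) (use in_S' in auto)
    have "h * h * dderiv w (dderiv v f) (x + a *\<^sub>R v + b *\<^sub>R w)
        = h * h * dderiv v (dderiv w f) (x + a' *\<^sub>R v + b' *\<^sub>R w)"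
      using 1 2 by (simp add: algebra_simps)
    then have "dderiv w (dderiv v f) (x + a *\<^sub>R v + b *\<^sub>R w) = dderiv v (dderiv w f) (x + a' *\<^sub>R v + b' *\<^sub>R w)"
      using h by simp
    moreover have "dist (x + a *\<^sub>R v + b *\<^sub>R w) x < r1" "dist (x + a' *\<^sub>R v + b' *\<^sub>R w) x < r2"
      using near[of a b] near[of a' b'] ab ab' by (auto simp: r_def)
    ultimately show ?thesis using r1(2)[of "x + a *\<^sub>R v + b *\<^sub>R w"] r2(2)[of "x + a' *\<^sub>R v + b' *\<^sub>R w"]
      unfolding dist_real_def by linarith
  qed
  have "\<bar>dderiv w (dderiv v f) x - dderiv v (dderiv w f) x\<bar> \<le> 0"
    by (rule field_le_epsilon) (simp only: add_0_left le)
  then show ?thesis by simp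
qed

lemma dderiv_commute:
  fixes f :: "'v::real_normed_vector \<Rightarrow> real"
  assumes "open S" "smooth_on f S" "x \<in> S"
  shows "dderiv w (dderiv v f) x = dderiv v (dderiv w f) x"
  by (rule dderiv_commute_Ck[OF smooth_on_Ck_on]) (fact assms)+

section \<open>Rules for directional derivatives\<close>

lemma dderiv_const: "dderiv v (\<lambda>x. c) x = 0"
  by (simp add: dderiv_def)

lemma dderiv_add:
  "f differentiable (at x) \<Longrightarrow> g differentiable (at x) \<Longrightarrow>
   dderiv v (\<lambda>x. f x + g x) x = dderiv v f x + dderiv v g x"
  by (rule dderiv_eq[OF has_derivative_add[OF dderiv_works dderiv_works]])

lemma dderiv_diff:
  "f differentiable (at x) \<Longrightarrow> g differentiable (at x) \<Longrightarrow>
   dderiv v (\<lambda>x. f x - g x) x = dderiv v f x - dderiv v g x"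
  by (rule dderiv_eq[OF has_derivative_diff[OF dderiv_works dderiv_works]])

lemma dderiv_mult:
  fixes f g :: "'v::real_normed_vector \<Rightarrow> real"
  shows "f differentiable (at x) \<Longrightarrow> g differentiable (at x) \<Longrightarrow>
   dderiv v (\<lambda>x. f x * g x) x = dderiv v f x * g x + f x * dderiv v g x"
  using dderiv_eq[OF has_derivative_mult[OF dderiv_works dderiv_works], of f x g v] by simp

lemma dderiv_divide:
  fixes f g :: "'v::real_normed_vector \<Rightarrow> real"
  assumes "f differentiable (at x)" "g differentiable (at x)" "g x \<noteq> 0"
  shows "dderiv v (\<lambda>x. f x / g x) x = (dderiv v f x * g x - f x * dderiv v g x) / (g x)\<^sup>2"
  using dderiv_eq[OF has_derivative_divide'[OF dderiv_works dderiv_works], of f x g v] assms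
  by (simp add: power2_eq_square)

lemma dderiv_exp:
  fixes f :: "'v::real_normed_vector \<Rightarrow> real"
  assumes "f differentiable (at x)"
  shows "dderiv v (\<lambda>x. exp (f x)) x = exp (f x) * dderiv v f x"
  using dderiv_eq[OF has_derivative_exp[OF dderiv_works], of f x v] assms by simp

section \<open>Curvature of a metric in the plane\<close>

lemma matrix_inv_eqI:
  fixes A B :: "'a::semiring_1^'n^'n"
  assumes "A ** B = mat 1" "B ** A = mat 1"
  shows "matrix_inv A = B"
proof -
  have "A ** matrix_inv A = mat 1"
    unfolding matrix_inv_def by (rule someI2[of _ B]) (use assms in auto)
  then have "B ** (A ** matrix_inv A) = B" by simp
  then show ?thesis by (simp add: matrix_mul_assoc assms)
qed

lemma matrix_inv_2:
  fixes A :: "real^2^2"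
  assumes "det A \<noteq> 0"
  shows "matrix_inv A $ 1 $ 1 = A$2$2 / det A" "matrix_inv A $ 1 $ 2 = - A$1$2 / det A"
    "matrix_inv A $ 2 $ 1 = - A$2$1 / det A" "matrix_inv A $ 2 $ 2 = A$1$1 / det A"
proof -
  define B :: "real^2^2" where "B = vector [vector [A$2$2 / det A, - A$1$2 / det A],
    vector [- A$2$1 / det A, A$1$1 / det A]]"
  have d: "A $ 1 $ 1 * A $ 2 $ 2 = det A + A $ 1 $ 2 * A $ 2 $ 1" by (simp add: det_2)
  have "matrix_inv A = B"
    using assms by (intro matrix_inv_eqI)
      (auto simp: B_def vec_eq_iff forall_2 matrix_matrix_mult_def sum_2 mat_def field_simps d)
  then show "matrix_inv A $ 1 $ 1 = A$2$2 / det A" "matrix_inv A $ 1 $ 2 = - A$1$2 / det A"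
    "matrix_inv A $ 2 $ 1 = - A$2$1 / det A" "matrix_inv A $ 2 $ 2 = A$1$1 / det A"
    by (simp_all add: B_def)
qed

section \<open>Christoffel symbols, curvature and Laplacian in coordinates\<close>

abbreviation pd :: "2 \<Rightarrow> (real^2 \<Rightarrow> real) \<Rightarrow> real^2 \<Rightarrow> real" where
  "pd i \<equiv> dderiv (axis i 1)"

text \<open>\<open>chr1 G k i j\<close> is \<open>[ij, k]\<close> and \<open>chr G k i j\<close> is \<open>\<Gamma>\<^sup>k\<^sub>i\<^sub>j\<close>; \<open>riem G l k\<close> is the
  \<open>\<partial>\<^sub>l\<close>-component of \<open>R(\<partial>\<^sub>1, \<partial>\<^sub>2) \<partial>\<^sub>k\<close>.\<close>

definition chr1 :: "(real^2 \<Rightarrow> real^2^2) \<Rightarrow> 2 \<Rightarrow> 2 \<Rightarrow> 2 \<Rightarrow> real^2 \<Rightarrow> real" where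
  "chr1 G k i j z = (pd i (\<lambda>z. G z $ j $ k) z + pd j (\<lambda>z. G z $ i $ k) z - pd k (\<lambda>z. G z $ i $ j) z) / 2"

definition chr :: "(real^2 \<Rightarrow> real^2^2) \<Rightarrow> 2 \<Rightarrow> 2 \<Rightarrow> 2 \<Rightarrow> real^2 \<Rightarrow> real" where
  "chr G k i j z = (\<Sum>l\<in>UNIV. matrix_inv (G z) $ k $ l * chr1 G l i j z)"

definition riem :: "(real^2 \<Rightarrow> real^2^2) \<Rightarrow> 2 \<Rightarrow> 2 \<Rightarrow> real^2 \<Rightarrow> real" where
  "riem G l k z = pd 1 (chr G l 2 k) z - pd 2 (chr G l 1 k) z +
     (\<Sum>m\<in>UNIV. chr G l 1 m z * chr G m 2 k z - chr G l 2 m z * chr G m 1 k z)"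

definition curv :: "(real^2 \<Rightarrow> real^2^2) \<Rightarrow> real^2 \<Rightarrow> real" where
  "curv G z = (\<Sum>l\<in>UNIV. G z $ 1 $ l * riem G l 2 z) / det (G z)"

text \<open>The Laplace--Beltrami operator \<open>(det G)\<^sup>-\<^sup>1\<^sup>/\<^sup>2 \<partial>\<^sub>i ((det G)\<^sup>1\<^sup>/\<^sup>2 G\<^sup>i\<^sup>j \<partial>\<^sub>j a)\<close>, expanded
  so that it is polynomial in derivatives up to division by powers of \<open>det G\<close>.\<close>

definition plap :: "(real^2 \<Rightarrow> real^2^2) \<Rightarrow> (real^2 \<Rightarrow> real) \<Rightarrow> real^2 \<Rightarrow> real" where
  "plap G a z =
    (G z$2$2 * pd 1 (pd 1 a) z - 2 * G z$1$2 * pd 1 (pd 2 a) z + G z$1$1 * pd 2 (pd 2 a) z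
     + (pd 1 (\<lambda>z. G z$2$2) z - pd 2 (\<lambda>z. G z$1$2) z) * pd 1 a z
     + (pd 2 (\<lambda>z. G z$1$1) z - pd 1 (\<lambda>z. G z$1$2) z) * pd 2 a z) / det (G z)
    - (pd 1 (\<lambda>z. det (G z)) z * (G z$2$2 * pd 1 a z - G z$1$2 * pd 2 a z)
      + pd 2 (\<lambda>z. det (G z)) z * (G z$1$1 * pd 2 a z - G z$1$2 * pd 1 a z)) / (2 * (det (G z))\<^sup>2)"

text \<open>The numerator of Brioschi's formula for the Gauss curvature of \<open>E dx\<^sup>2 + 2 F dx dy + H dy\<^sup>2\<close>.\<close>

definition brioschi :: "real \<Rightarrow> real \<Rightarrow> real \<Rightarrow> real \<Rightarrow> real \<Rightarrow> real \<Rightarrow> real \<Rightarrow> real \<Rightarrow> real \<Rightarrow> real \<Rightarrow> real \<Rightarrow> real \<Rightarrow> real" where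
  "brioschi E F H E1 E2 F1 F2 H1 H2 F12 H11 E22 =
    (F12 - H11 / 2 - E22 / 2) * (E * H - F\<^sup>2)
     - H * (E1 / 2 * (F2 - H1 / 2) - (E2 / 2)\<^sup>2)
     + F * (E1 / 2 * (H2 / 2) + (F1 - E2 / 2) * (F2 - H1 / 2) - 2 * (E2 / 2) * (H1 / 2))
     - E * ((F1 - E2 / 2) * (H2 / 2) - (H1 / 2)\<^sup>2)"

text \<open>The variables stand for values at one point: \<open>E\<close>, \<open>F\<close>,
  \<open>H\<close> and their derivatives for the metric, \<open>m\<close> for
  \<open>exp (2 * w)\<close>, and \<open>m1\<close>, \<open>m2\<close>, \<open>m11\<close>,
  \<open>m12\<close>, \<open>m22\<close> for derivatives of \<open>w\<close>. The arguments on the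
  left are then the derivatives of the conformal metric, and the bracket subtracted on the right is
  \<open>plap\<close>. The content is that all terms quadratic in \<open>m1\<close>,
  \<open>m2\<close> cancel.\<close>

lemma brioschi_conformal:
  assumes m: "m \<noteq> 0" and D: "E * H - F\<^sup>2 \<noteq> 0"
  shows "m * (brioschi (m * E) (m * F) (m * H)
      (m * (E1 + 2 * m1 * E)) (m * (E2 + 2 * m2 * E)) (m * (F1 + 2 * m1 * F)) (m * (F2 + 2 * m2 * F))
      (m * (H1 + 2 * m1 * H)) (m * (H2 + 2 * m2 * H))
      (m * (F12 + 2 * m12 * F + 2 * m2 * F1 + 2 * m1 * F2 + 4 * m2 * m1 * F))
      (m * (H11 + 2 * m11 * H + 2 * m1 * H1 + 2 * m1 * H1 + 4 * m1 * m1 * H))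
      (m * (E22 + 2 * m22 * E + 2 * m2 * E2 + 2 * m2 * E2 + 4 * m2 * m2 * E))
        / (m * E * (m * H) - (m * F)\<^sup>2)\<^sup>2)
    = brioschi E F H E1 E2 F1 F2 H1 H2 F12 H11 E22 / (E * H - F\<^sup>2)\<^sup>2
      - ((H * m11 - 2 * F * m12 + E * m22 + (H1 - F2) * m1 + (E2 - F1) * m2) / (E * H - F\<^sup>2)
        - ((E1 * H + E * H1 - 2 * F * F1) * (H * m1 - F * m2)
          + (E2 * H + E * H2 - 2 * F * F2) * (E * m2 - F * m1)) / (2 * (E * H - F\<^sup>2)\<^sup>2))"
    (is "m * (?N / ?D) = ?B / _ - (?P / _ - ?Q / _)")
proof -
  \<comment> \<open>Brioschi's numerator is homogeneous of degree three in the metric and its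
    derivatives, which explains the power of \<open>m\<close>; the squared determinant contributes
    \<open>m ^ 4\<close>.\<close>
  have N: "?N = m ^ 3 * (?B - ?P * (E * H - F\<^sup>2) + ?Q / 2)"
    unfolding brioschi_def by (simp add: field_simps power2_eq_square power3_eq_cube)
  have "?D = m ^ 4 * (E * H - F\<^sup>2)\<^sup>2" by (simp add: algebra_simps power2_eq_square power4_eq_xxxx)
  then have "m * (?N / ?D) = m ^ 4 * (?B - ?P * (E * H - F\<^sup>2) + ?Q / 2) / (m ^ 4 * (E * H - F\<^sup>2)\<^sup>2)"
    unfolding N by (simp add: power3_eq_cube power4_eq_xxxx)
  also have "\<dots> = (?B - ?P * (E * H - F\<^sup>2) + ?Q / 2) / (E * H - F\<^sup>2)\<^sup>2" using m by simp
  also have "\<dots> = ?B / (E * H - F\<^sup>2)\<^sup>2 - (?P / (E * H - F\<^sup>2) - ?Q / (2 * (E * H - F\<^sup>2)\<^sup>2))"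
    using D by (simp add: divide_simps power2_eq_square[of "E * H - F\<^sup>2"]) (simp add: algebra_simps)
  finally show ?thesis .
qed

text \<open>Components are assumed smooth one by one because all formulas are written in components.
  Positivity enters as a positive determinant, which is what keeps every division
  legitimate.\<close>

locale plane_metric =
  fixes G :: "real^2 \<Rightarrow> real^2^2" and S :: "(real^2) set"
  assumes S: "open S"
    and smooth_G: "\<And>i j. smooth_on (\<lambda>z. G z $ i $ j) S"
    and sym_G: "\<And>z i j. z \<in> S \<Longrightarrow> G z $ i $ j = G z $ j $ i"
    and det_G: "\<And>z. z \<in> S \<Longrightarrow> det (G z) > 0"
begin

lemma diff_G: "z \<in> S \<Longrightarrow> (\<lambda>z. G z $ i $ j) differentiable (at z)"
  using smooth_G smooth_on_differentiable by blast

lemma pd_sym_G: "z \<in> S \<Longrightarrow> pd k (\<lambda>z. G z $ i $ j) z = pd k (\<lambda>z. G z $ j $ i) z"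
  by (rule dderiv_cong_open[OF S]) (auto simp: sym_G)

lemma pd_pd_sym_G: "z \<in> S \<Longrightarrow> pd l (pd k (\<lambda>z. G z $ i $ j)) z = pd l (pd k (\<lambda>z. G z $ j $ i)) z"
  by (rule dderiv_cong_open[OF S]) (auto simp: pd_sym_G)

lemma smooth_chr1: "smooth_on (chr1 G k i j) S"
  unfolding chr1_def[abs_def] by (intro smooth_on_intros S smooth_G) auto

lemma smooth_det: "smooth_on (\<lambda>z. det (G z)) S"
  unfolding det_2 by (intro smooth_on_intros S smooth_G)

lemma smooth_inv: "smooth_on (\<lambda>z. matrix_inv (G z) $ i $ j) S"
proof -
  have *: "smooth_on (\<lambda>z. G z $ k $ l / det (G z)) S" "smooth_on (\<lambda>z. - G z $ k $ l / det (G z)) S" for k l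
    using det_G by (intro smooth_on_intros S smooth_G smooth_det; force)+
  have "smooth_on (\<lambda>z. matrix_inv (G z) $ 1 $ 1) S" "smooth_on (\<lambda>z. matrix_inv (G z) $ 1 $ 2) S"
    "smooth_on (\<lambda>z. matrix_inv (G z) $ 2 $ 1) S" "smooth_on (\<lambda>z. matrix_inv (G z) $ 2 $ 2) S"
    using *[of 2 2] *[of 1 2] *[of 2 1] *[of 1 1] det_G
    by (subst smooth_on_cong[OF S]; force simp: matrix_inv_2)+
  then show ?thesis using exhaust_2[of i] exhaust_2[of j] by auto
qed

lemma smooth_chr: "smooth_on (chr G k i j) S"
  unfolding chr_def[abs_def] sum_2 by (intro smooth_on_intros S smooth_inv smooth_chr1)

text \<open>Lowering the index cancels the inverse matrix. Identities for the second-kind symbols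
  are proved in this lowered form, where they are free of denominators.\<close>

lemma lower_chr:
  assumes "z \<in> S" shows "(\<Sum>l\<in>UNIV. G z $ k $ l * chr G l i j z) = chr1 G k i j z"
proof -
  have d: "det (G z) \<noteq> 0" using det_G[OF assms] by simp
  then have "G z $ k $ 1 * chr G 1 i j z + G z $ k $ 2 * chr G 2 i j z = chr1 G k i j z * det (G z) / det (G z)"
    using exhaust_2[of k]
    by (auto simp: chr_def sum_2 matrix_inv_2 field_simps) (auto simp: det_2 sym_G[OF assms, of 2 1] algebra_simps)
  then show ?thesis using d by (simp add: sum_2)
qed

lemma chr1_sym: "z \<in> S \<Longrightarrow> chr1 G k i j z = chr1 G k j i z"
  unfolding chr1_def using pd_sym_G[of z k i j] by simp

lemma chr_sym: "z \<in> S \<Longrightarrow> chr G k i j z = chr G k j i z"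
  unfolding chr_def using chr1_sym by simp

text \<open>Compatibility of the connection with the metric, in index form.\<close>

lemma pd_G: "z \<in> S \<Longrightarrow> pd i (\<lambda>z. G z $ j $ k) z = chr1 G k i j z + chr1 G j i k z"
  unfolding chr1_def using pd_sym_G[of z i j k] pd_sym_G[of z j i k] pd_sym_G[of z k i j] by (simp add: field_simps)

lemma pd_chr1:
  assumes "z \<in> S"
  shows "pd l (chr1 G k i j) z = (pd l (pd i (\<lambda>z. G z $ j $ k)) z + pd l (pd j (\<lambda>z. G z $ i $ k)) z
    - pd l (pd k (\<lambda>z. G z $ i $ j)) z) / 2"
proof -
  have d: "pd i (\<lambda>z. G z $ j $ k) differentiable (at z)" for i j k
    using smooth_on_differentiable[OF smooth_on_dderiv[OF smooth_G]] assms by blast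
  show ?thesis unfolding chr1_def[abs_def]
    by (subst dderiv_divide) (auto simp: dderiv_const dderiv_add dderiv_diff d power2_eq_square)
qed

lemma lower_pd_chr:
  assumes "z \<in> S"
  shows "(\<Sum>l\<in>UNIV. G z $ b $ l * pd m (chr G l i j) z) =
    pd m (chr1 G b i j) z - (\<Sum>l\<in>UNIV. (chr1 G b m l z + chr1 G l m b z) * chr G l i j z)"
proof -
  have d: "chr G l i j differentiable (at z)" for l
    using smooth_on_differentiable[OF smooth_chr assms] .
  have "pd m (chr1 G b i j) z = pd m (\<lambda>z. \<Sum>l\<in>UNIV. G z $ b $ l * chr G l i j z) z"
    by (rule dderiv_cong_open[OF S assms]) (simp add: lower_chr)
  also have "\<dots> = (\<Sum>l\<in>UNIV. (chr1 G b m l z + chr1 G l m b z) * chr G l i j z + G z $ b $ l * pd m (chr G l i j) z)"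
    using pd_sym_G[OF assms, of m b] pd_G[OF assms, of m _ b]
    by (simp add: sum_2 dderiv_add dderiv_mult diff_G[OF assms] d add.commute)
  finally show ?thesis by (simp add: sum_2)
qed

text \<open>Pulling the metric under the derivative of the symbols produces quadratic terms by
  metric compatibility; they absorb those of the Riemann tensor and leave one pair with reversed
  sign.\<close>

lemma lower_riem:
  assumes "z \<in> S"
  shows "(\<Sum>l\<in>UNIV. G z $ b $ l * riem G l k z) =
    pd 1 (chr1 G b 2 k) z - pd 2 (chr1 G b 1 k) z
    - (\<Sum>l\<in>UNIV. chr1 G l 1 b z * chr G l 2 k z - chr1 G l 2 b z * chr G l 1 k z)"
proof -
  have "(\<Sum>l\<in>UNIV. G z $ b $ l * riem G l k z) =
     (\<Sum>l\<in>UNIV. G z $ b $ l * pd 1 (chr G l 2 k) z) - (\<Sum>l\<in>UNIV. G z $ b $ l * pd 2 (chr G l 1 k) z) +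
     (\<Sum>m\<in>UNIV. (\<Sum>l\<in>UNIV. G z $ b $ l * chr G l 1 m z) * chr G m 2 k z
        - (\<Sum>l\<in>UNIV. G z $ b $ l * chr G l 2 m z) * chr G m 1 k z)"
    by (simp add: sum_2 riem_def algebra_simps)
  then show ?thesis
    unfolding lower_pd_chr[OF assms] lower_chr[OF assms] by (simp add: sum_2 algebra_simps)
qed

text \<open>The second derivatives of \<open>G\<close> are antisymmetric once mixed partials
  commute, and the quadratic terms are antisymmetric because they are inner products of symbols
  under the symmetric \<open>G\<close>. In dimension two this leaves a single independent component
  of the curvature.\<close>

lemma lower_riem_antisym:
  assumes "z \<in> S"
  shows "(\<Sum>l\<in>UNIV. G z $ b $ l * riem G l k z) = - (\<Sum>l\<in>UNIV. G z $ k $ l * riem G l b z)"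
proof -
  have c: "pd l (pd m (\<lambda>z. G z $ i $ j)) z = pd m (pd l (\<lambda>z. G z $ i $ j)) z" for l m i j
    by (rule dderiv_commute[OF S smooth_G assms])
  have "pd 1 (chr1 G b 2 k) z - pd 2 (chr1 G b 1 k) z = - (pd 1 (chr1 G k 2 b) z - pd 2 (chr1 G k 1 b) z)"
    unfolding pd_chr1[OF assms] using pd_pd_sym_G[OF assms, of _ _ k b] c[of 1 2] by (simp add: field_simps)
  moreover have "(\<Sum>l\<in>UNIV. chr1 G l 1 b z * chr G l 2 k z - chr1 G l 2 b z * chr G l 1 k z)
      = - (\<Sum>l\<in>UNIV. chr1 G l 1 k z * chr G l 2 b z - chr1 G l 2 k z * chr G l 1 b z)"
    unfolding lower_chr[OF assms, symmetric] by (simp add: sum_2 sym_G[OF assms, of 2 1] algebra_simps)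
  ultimately show ?thesis unfolding lower_riem[OF assms] by simp
qed

text \<open>Brioschi's formula: only the components and their derivatives up to second order remain,
  so that a conformal change becomes a substitution.\<close>

lemma curv_eq:
  fixes z
  defines "E \<equiv> \<lambda>z. G z $ 1 $ 1" and "F \<equiv> \<lambda>z. G z $ 1 $ 2" and "H \<equiv> \<lambda>z. G z $ 2 $ 2"
  assumes z: "z \<in> S"
  shows "curv G z = brioschi (E z) (F z) (H z) (pd 1 E z) (pd 2 E z) (pd 1 F z) (pd 2 F z) (pd 1 H z) (pd 2 H z)
      (pd 1 (pd 2 F) z) (pd 1 (pd 1 H) z) (pd 2 (pd 2 E) z) / (E z * H z - (F z)\<^sup>2)\<^sup>2"
proof -
  have F': "(\<lambda>z. G z $ 1 $ 2) = F" by (simp add: F_def)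
  have F21: "G z $ 2 $ 1 = F z" using sym_G[OF z, of 2 1] by (simp add: F_def)
  have p1: "pd k (\<lambda>z. G z $ 2 $ 1) z = pd k F z" for k
    using pd_sym_G[OF z, of k 2 1] by (simp add: F_def)
  have p2: "pd l (pd k (\<lambda>z. G z $ 2 $ 1)) z = pd l (pd k F) z" for k l
    using pd_pd_sym_G[OF z, of l k 2 1] by (simp add: F_def)
  have c1: "chr1 G 1 1 1 z = pd 1 E z / 2" "chr1 G 2 1 1 z = pd 1 F z - pd 2 E z / 2"
    "chr1 G 1 1 2 z = pd 2 E z / 2" "chr1 G 2 1 2 z = pd 1 H z / 2" "chr1 G 1 2 1 z = pd 2 E z / 2" "chr1 G 2 2 1 z = pd 1 H z / 2"
    "chr1 G 1 2 2 z = pd 2 F z - pd 1 H z / 2" "chr1 G 2 2 2 z = pd 2 H z / 2"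
    by (simp_all add: chr1_def p1 F' E_def[symmetric] H_def[symmetric] field_simps)
  have d: "det (G z) = E z * H z - (F z)\<^sup>2"
    by (simp add: det_2 F21) (simp add: E_def F_def H_def power2_eq_square)
  have d0: "E z * H z - (F z)\<^sup>2 \<noteq> 0" using det_G[OF z] d by simp
  have i: "matrix_inv (G z) $ 1 $ 1 = H z / (E z * H z - (F z)\<^sup>2)"
     "matrix_inv (G z) $ 1 $ 2 = - F z / (E z * H z - (F z)\<^sup>2)"
     "matrix_inv (G z) $ 2 $ 1 = - F z / (E z * H z - (F z)\<^sup>2)"
     "matrix_inv (G z) $ 2 $ 2 = E z / (E z * H z - (F z)\<^sup>2)"
    using matrix_inv_2[of "G z"] d0 F21 d by (auto simp: E_def F_def H_def)
  have c: "pd 2 (pd 1 F) z = pd 1 (pd 2 F) z"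
    unfolding F_def by (rule dderiv_commute[OF S smooth_G z])
  have "pd 1 (chr1 G 1 2 2) z - pd 2 (chr1 G 1 1 2) z = pd 1 (pd 2 F) z - pd 1 (pd 1 H) z / 2 - pd 2 (pd 2 E) z / 2"
    unfolding pd_chr1[OF z] by (simp add: p2 F' c E_def[symmetric] H_def[symmetric] field_simps)
  then have "curv G z = (pd 1 (pd 2 F) z - pd 1 (pd 1 H) z / 2 - pd 2 (pd 2 E) z / 2
     - (\<Sum>l\<in>UNIV. chr1 G l 1 1 z * chr G l 2 2 z - chr1 G l 2 1 z * chr G l 1 2 z)) / (E z * H z - (F z)\<^sup>2)"
    unfolding curv_def lower_riem[OF z] d by simp
  \<comment> \<open>Each second-kind symbol is paired with one factor of the determinant, which
    clears its denominator and makes the numerator polynomial.\<close>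
  also have "\<dots> = ((pd 1 (pd 2 F) z - pd 1 (pd 1 H) z / 2 - pd 2 (pd 2 E) z / 2) * (E z * H z - (F z)\<^sup>2)
     - (\<Sum>l\<in>UNIV. chr1 G l 1 1 z * (chr G l 2 2 z * (E z * H z - (F z)\<^sup>2))
        - chr1 G l 2 1 z * (chr G l 1 2 z * (E z * H z - (F z)\<^sup>2)))) / (E z * H z - (F z)\<^sup>2)\<^sup>2"
    using d0 by (simp add: sum_2 divide_simps power2_eq_square[of "E z * H z - (F z)\<^sup>2"]) (simp add: algebra_simps)
  finally have curv: "curv G z = \<dots>" .
  have "chr G 1 2 2 z * (E z * H z - (F z)\<^sup>2) = H z * chr1 G 1 2 2 z - F z * chr1 G 2 2 2 z"
    "chr G 2 2 2 z * (E z * H z - (F z)\<^sup>2) = E z * chr1 G 2 2 2 z - F z * chr1 G 1 2 2 z"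
    "chr G 1 1 2 z * (E z * H z - (F z)\<^sup>2) = H z * chr1 G 1 1 2 z - F z * chr1 G 2 1 2 z"
    "chr G 2 1 2 z * (E z * H z - (F z)\<^sup>2) = E z * chr1 G 2 1 2 z - F z * chr1 G 1 1 2 z"
    unfolding chr_def sum_2 i using d0 by (simp_all add: divide_simps)
  note chrs = this
  show ?thesis
    unfolding curv sum_2 chrs c1 brioschi_def by (simp add: power2_eq_square algebra_simps)
qed

lemma conformal_plane_metric:
  assumes "smooth_on w S"
  shows "plane_metric (\<lambda>z. exp (2 * w z) *\<^sub>R G z) S"
proof
  show "smooth_on (\<lambda>z. (exp (2 * w z) *\<^sub>R G z) $ i $ j) S" for i j
    by simp (intro smooth_on_intros S smooth_G assms)
  show "(exp (2 * w z) *\<^sub>R G z) $ i $ j = (exp (2 * w z) *\<^sub>R G z) $ j $ i" if "z \<in> S" for z i j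
    using sym_G[OF that, of i j] by simp
  show "det (exp (2 * w z) *\<^sub>R G z) > 0" if "z \<in> S" for z
  proof -
    have "det (exp (2 * w z) *\<^sub>R G z) = (exp (2 * w z))\<^sup>2 * det (G z)"
      by (simp add: det_2 power2_eq_square algebra_simps)
    then show ?thesis using det_G[OF that] by simp
  qed
qed (fact S)

text \<open>The exponential stays an outer factor, so that first and second derivatives take exactly
  the shape of the arguments in \<open>brioschi_conformal\<close>.\<close>

lemma pd_conformal:
  assumes "smooth_on w S" "smooth_on f S" "z \<in> S"
  shows "pd i (\<lambda>z. exp (2 * w z) * f z) z = exp (2 * w z) * (pd i f z + 2 * pd i w z * f z)"
proof -
  have "w differentiable (at z)" "f differentiable (at z)"
    using assms smooth_on_differentiable by blast+
  moreover from this have "(\<lambda>z. 2 * w z) differentiable (at z)" "(\<lambda>z. exp (2 * w z)) differentiable (at z)"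
    using smooth_on_differentiable[OF smooth_on_exp[OF S smooth_on_mult[OF S smooth_on_const assms(1)]] assms(3)]
    by simp_all
  ultimately show ?thesis
    by (simp add: dderiv_mult dderiv_exp dderiv_const algebra_simps)
qed

lemma pd_pd_conformal:
  assumes "smooth_on w S" "smooth_on f S" "z \<in> S"
  shows "pd j (pd i (\<lambda>z. exp (2 * w z) * f z)) z =
    exp (2 * w z) * (pd j (pd i f) z + 2 * pd j (pd i w) z * f z + 2 * pd i w z * pd j f z
      + 2 * pd j w z * pd i f z + 4 * pd i w z * pd j w z * f z)"
proof -
  have sm: "smooth_on (\<lambda>z. pd i f z + 2 * pd i w z * f z) S"
    by (intro smooth_on_intros S assms(1,2))
  have d: "w differentiable (at z)" "f differentiable (at z)" "pd i f differentiable (at z)" "pd i w differentiable (at z)"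
    using assms smooth_on_differentiable smooth_on_dderiv by blast+
  have "pd j (pd i (\<lambda>z. exp (2 * w z) * f z)) z = pd j (\<lambda>z. exp (2 * w z) * (pd i f z + 2 * pd i w z * f z)) z"
    by (rule dderiv_cong_open[OF S assms(3)]) (rule pd_conformal[OF assms(1,2)])
  also have "\<dots> = exp (2 * w z) * (pd j (\<lambda>z. pd i f z + 2 * pd i w z * f z) z + 2 * pd j w z * (pd i f z + 2 * pd i w z * f z))"
    by (rule pd_conformal[OF assms(1) sm assms(3)])
  also have "pd j (\<lambda>z. pd i f z + 2 * pd i w z * f z) z = pd j (pd i f) z + 2 * pd j (pd i w) z * f z + 2 * pd i w z * pd j f z"
    using d by (simp add: dderiv_add dderiv_mult dderiv_const)
  finally show ?thesis by (simp add: algebra_simps)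
qed

text \<open>After Brioschi's formula for both metrics and the product rule for the components, the
  claim is \<open>brioschi_conformal\<close> with \<open>exp (2 * w z)\<close> for
  \<open>m\<close>.\<close>

lemma curv_conformal:
  assumes w: "smooth_on w S" and z: "z \<in> S"
  shows "exp (2 * w z) * curv (\<lambda>z. exp (2 * w z) *\<^sub>R G z) z = curv G z - plap G w z"
proof -
  interpret C: plane_metric "\<lambda>z. exp (2 * w z) *\<^sub>R G z" S
    by (rule conformal_plane_metric[OF w])
  define E F H where "E = (\<lambda>z. G z $ 1 $ 1)" and "F = (\<lambda>z. G z $ 1 $ 2)" and "H = (\<lambda>z. G z $ 2 $ 2)"
  have sm: "smooth_on E S" "smooth_on F S" "smooth_on H S"
    unfolding E_def F_def H_def by (rule smooth_G)+
  note p = pd_conformal[OF w _ z] pd_pd_conformal[OF w _ z]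
  have d: "E differentiable (at z)" "F differentiable (at z)" "H differentiable (at z)"
    using sm z smooth_on_differentiable by blast+
  have det: "det (G y) = E y * H y - (F y)\<^sup>2" if "y \<in> S" for y
    using sym_G[OF that, of 2 1] by (simp add: det_2 E_def F_def H_def power2_eq_square)
  have pdet: "pd i (\<lambda>z. det (G z)) z = pd i E z * H z + E z * pd i H z - 2 * F z * pd i F z" for i
  proof -
    have "pd i (\<lambda>z. det (G z)) z = pd i (\<lambda>y. E y * H y - F y * F y) z"
      by (rule dderiv_cong_open[OF S z]) (simp add: det power2_eq_square)
    then show ?thesis using d by (simp add: dderiv_diff dderiv_mult)
  qed
  have c: "pd 2 (pd 1 w) z = pd 1 (pd 2 w) z"
    by (rule dderiv_commute[OF S w z])
  have "E z * H z - (F z)\<^sup>2 \<noteq> 0" using det_G[OF z] det[OF z] by simp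
  note id = brioschi_conformal[OF exp_not_eq_zero this]
  have G21: "G z $ 2 $ 1 = F z" using sym_G[OF z, of 2 1] by (simp add: F_def)
  have e: "G y $ 1 $ 1 = E y" "G y $ 1 $ 2 = F y" "G y $ 2 $ 2 = H y" for y
    by (simp_all add: E_def F_def H_def)
  show ?thesis
    unfolding curv_eq[OF z] C.curv_eq[OF z] plap_def
    unfolding det[OF z] pdet
    by (simp only: vector_scaleR_component real_scaleR_def e p sm c id)
qed

end


section \<open>Behaviour under a change of coordinates\<close>

lemma dderiv_eq_sum_pd:
  fixes f :: "real^2 \<Rightarrow> real"
  assumes "f differentiable (at x)"
  shows "dderiv v f x = (\<Sum>e\<in>UNIV. v $ e * pd e f x)"
proof -
  have l: "linear (\<lambda>v. dderiv v f x)"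
    using dderiv_works[OF assms] has_derivative_linear by blast
  have "dderiv v f x = dderiv (\<Sum>e\<in>UNIV. v $ e *\<^sub>R axis e 1) f x"
    by (simp add: basis_expansion[of v, unfolded scalar_mult_eq_scaleR])
  also have "\<dots> = (\<Sum>e\<in>UNIV. v $ e * pd e f x)"
    by (simp add: linear_sum[OF l] linear_scale[OF l])
  finally show ?thesis .
qed

lemma dderiv_vec_nth:
  assumes "f differentiable (at x)"
  shows "dderiv v (\<lambda>x. f x $ a) x = dderiv v f x $ a"
  by (rule dderiv_eq) (intro bounded_linear.has_derivative[OF bounded_linear_vec_nth] dderiv_works assms)

lemma smooth_on_vec_nth:
  fixes f :: "'v::real_normed_vector \<Rightarrow> 'w::euclidean_space^'n"
  assumes "open S" "smooth_on f S" shows "smooth_on (\<lambda>x. f x $ a) S"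
  by (rule smooth_on_compose[OF assms(1) open_UNIV subset_UNIV assms(2) smooth_on_bounded_linear])
    (auto intro: bounded_linear_vec_nth)

lemma pd_chain:
  assumes "f differentiable (at (\<Theta> z))" "\<Theta> differentiable (at z)"
  shows "pd k (\<lambda>z. f (\<Theta> z)) z = (\<Sum>e\<in>UNIV. pd k (\<lambda>z. \<Theta> z $ e) z * pd e f (\<Theta> z))"
proof -
  have "pd k (\<lambda>z. f (\<Theta> z)) z = dderiv (dderiv (axis k 1) \<Theta> z) f (\<Theta> z)"
    using dderiv_eq[OF diff_chain_at[OF dderiv_works dderiv_works, OF assms(2,1)]] by (simp add: comp_def)
  then show ?thesis
    by (simp only: dderiv_eq_sum_pd[OF assms(1), of "dderiv (axis k 1) \<Theta> z"] dderiv_vec_nth[OF assms(2)])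
qed

text \<open>Abstracts a transition map between charts. The Jacobian of \<open>\<Theta>\<close> is
  invertible as a consequence, since the determinants of both metrics are positive.\<close>

locale metric_pullback = G: plane_metric G S + H: plane_metric H T for G S H T +
  fixes \<Theta> :: "real^2 \<Rightarrow> real^2"
  assumes smooth: "smooth_on \<Theta> S" and maps: "\<Theta> ` S \<subseteq> T"
    and pullback: "\<And>z i j. z \<in> S \<Longrightarrow> G z $ i $ j =
      (\<Sum>a\<in>UNIV. \<Sum>b\<in>UNIV. pd i (\<lambda>z. \<Theta> z $ a) z * H (\<Theta> z) $ a $ b * pd j (\<lambda>z. \<Theta> z $ b) z)"
begin

definition J :: "2 \<Rightarrow> 2 \<Rightarrow> real^2 \<Rightarrow> real" where
  "J a i z = pd i (\<lambda>z. \<Theta> z $ a) z"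

lemma smooth_J: "smooth_on (J a i) S"
  unfolding J_def[abs_def] by (intro smooth_on_dderiv smooth_on_vec_nth G.S smooth)

lemma pd_J_sym: "z \<in> S \<Longrightarrow> pd i (J a j) z = pd j (J a i) z"
  unfolding J_def[abs_def] by (intro dderiv_commute[OF G.S] smooth_on_vec_nth G.S smooth)

lemma pd_chain_J:
  assumes "z \<in> S" "smooth_on f T"
  shows "pd k (\<lambda>z. f (\<Theta> z)) z = (\<Sum>e\<in>UNIV. J e k z * pd e f (\<Theta> z))"
proof -
  have "\<Theta> z \<in> T" using assms(1) maps by blast
  then show ?thesis unfolding J_def
    by (intro pd_chain smooth_on_differentiable[OF assms(2)] smooth_on_differentiable[OF smooth assms(1)])
qed

lemma diff_comp:
  assumes "z \<in> S" "smooth_on f T"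
  shows "(\<lambda>z. f (\<Theta> z)) differentiable (at z)"
  by (rule smooth_on_differentiable[OF smooth_on_compose[OF G.S H.S maps smooth assms(2)] assms(1)])

text \<open>The Christoffel symbols transform like the coefficients of a connection. To derive this, both
  sides are lowered with \<open>G\<close>, which turns the claim into the transformation law of the symbols of
  the first kind, a consequence of the product rule.\<close>

lemma chr_transform:
  assumes z: "z \<in> S"
  shows "(\<Sum>l\<in>UNIV. J a l z * chr G l i j z) =
    pd i (J a j) z + (\<Sum>c\<in>UNIV. \<Sum>d\<in>UNIV. chr H a c d (\<Theta> z) * J c i z * J d j z)"
proof -
  have T: "\<Theta> z \<in> T" using z maps by blast
  have dJ: "J a i differentiable (at z)" for a i
    using smooth_on_differentiable[OF smooth_J z] .
  have dH: "(\<lambda>z. H (\<Theta> z) $ a $ b) differentiable (at z)" for a b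
    using diff_comp[OF z H.smooth_G] .
  have cH: "pd k (\<lambda>z. H (\<Theta> z) $ a $ b) z = (\<Sum>e\<in>UNIV. J e k z * pd e (\<lambda>y. H y $ a $ b) (\<Theta> z))" for k a b
    using pd_chain_J[OF z H.smooth_G] .
  have GJ: "G z $ i $ j = (\<Sum>a\<in>UNIV. \<Sum>b\<in>UNIV. J a i z * H (\<Theta> z) $ a $ b * J b j z)" if "z \<in> S" for i j z
    using pullback[OF that] by (simp add: J_def)
  have pG: "pd k (\<lambda>z. G z $ i $ j) z = (\<Sum>a\<in>UNIV. \<Sum>b\<in>UNIV.
      pd k (J a i) z * H (\<Theta> z) $ a $ b * J b j z
      + J a i z * (\<Sum>e\<in>UNIV. J e k z * pd e (\<lambda>y. H y $ a $ b) (\<Theta> z)) * J b j z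
      + J a i z * H (\<Theta> z) $ a $ b * pd k (J b j) z)" for i j k
  proof -
    have "pd k (\<lambda>z. G z $ i $ j) z = pd k (\<lambda>z. \<Sum>a\<in>UNIV. \<Sum>b\<in>UNIV. J a i z * H (\<Theta> z) $ a $ b * J b j z) z"
      by (rule dderiv_cong_open[OF G.S z]) (rule GJ)
    also have "\<dots> = (\<Sum>a\<in>UNIV. \<Sum>b\<in>UNIV. pd k (\<lambda>z. J a i z * H (\<Theta> z) $ a $ b * J b j z) z)"
      unfolding sum_2 by (simp add: dderiv_add dJ dH)
    finally show ?thesis by (simp add: dderiv_mult dJ dH cH distrib_right distrib_left)
  qed
  \<comment> \<open>The defect of the claim. Contracted with the Jacobian and \<open>H\<close> it
    becomes the lowered identity, so the contraction vanishes by \<open>X0\<close>; two nonsingular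
    2 by 2 systems then force the defect itself to vanish.\<close>
  define X where "X a = (\<Sum>l\<in>UNIV. J a l z * chr G l i j z) - pd i (J a j) z
     - (\<Sum>c\<in>UNIV. \<Sum>d\<in>UNIV. chr H a c d (\<Theta> z) * J c i z * J d j z)" for a
  have X0: "(\<Sum>b\<in>UNIV. J b k z * (\<Sum>a\<in>UNIV. H (\<Theta> z) $ b $ a * X a)) = 0" for k
  proof -
    have "(\<Sum>b\<in>UNIV. J b k z * (\<Sum>a\<in>UNIV. H (\<Theta> z) $ b $ a * X a)) =
      (\<Sum>l\<in>UNIV. G z $ k $ l * chr G l i j z)
      - (\<Sum>b\<in>UNIV. J b k z * (\<Sum>a\<in>UNIV. H (\<Theta> z) $ b $ a * pd i (J a j) z))
      - (\<Sum>b\<in>UNIV. J b k z * (\<Sum>c\<in>UNIV. \<Sum>d\<in>UNIV. (\<Sum>a\<in>UNIV. H (\<Theta> z) $ b $ a * chr H a c d (\<Theta> z)) * J c i z * J d j z))"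
      unfolding GJ[OF z] X_def sum_2 by (simp add: algebra_simps)
    also have "\<dots> = chr1 G k i j z
      - (\<Sum>b\<in>UNIV. J b k z * (\<Sum>a\<in>UNIV. H (\<Theta> z) $ b $ a * pd i (J a j) z))
      - (\<Sum>b\<in>UNIV. J b k z * (\<Sum>c\<in>UNIV. \<Sum>d\<in>UNIV. chr1 H b c d (\<Theta> z) * J c i z * J d j z))"
      unfolding G.lower_chr[OF z] H.lower_chr[OF T] ..
    also have "\<dots> = 0"
      unfolding chr1_def pG sum_2
      by (simp add: H.sym_G[OF T, of 2 1] H.pd_sym_G[OF T, of _ 2 1] pd_J_sym[OF z, of j _ i] pd_J_sym[OF z, of k] field_simps)
    finally show ?thesis .
  qed
  have "det (G z) = (J 1 1 z * J 2 2 z - J 1 2 z * J 2 1 z)\<^sup>2 * det (H (\<Theta> z))"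
    unfolding det_2 GJ[OF z] sum_2 by (simp add: H.sym_G[OF T, of 2 1] algebra_simps power2_eq_square)
  then have dj: "J 1 1 z * J 2 2 z - J 1 2 z * J 2 1 z \<noteq> 0" and dh: "det (H (\<Theta> z)) \<noteq> 0"
    using G.det_G[OF z] by auto
  have solve: "p = 0 \<and> q = 0" if "m11 * p + m12 * q = 0" "m21 * p + m22 * q = 0" "m11 * m22 - m12 * m21 \<noteq> 0"
    for m11 m12 m21 m22 p q :: real
  proof -
    have "(m11 * m22 - m12 * m21) * p = m22 * (m11 * p + m12 * q) - m12 * (m21 * p + m22 * q)"
      "(m11 * m22 - m12 * m21) * q = m11 * (m21 * p + m22 * q) - m21 * (m11 * p + m12 * q)"
      by (simp_all add: algebra_simps)
    then have "(m11 * m22 - m12 * m21) * p = 0" "(m11 * m22 - m12 * m21) * q = 0"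
      unfolding that(1,2) by simp_all
    then show ?thesis using that(3) by simp
  qed
  have "(\<Sum>a\<in>UNIV. H (\<Theta> z) $ 1 $ a * X a) = 0 \<and> (\<Sum>a\<in>UNIV. H (\<Theta> z) $ 2 $ a * X a) = 0"
    by (rule solve[OF X0[of 1, unfolded sum_2[of "\<lambda>b. J b 1 z * (f b)" for f]]
          X0[of 2, unfolded sum_2[of "\<lambda>b. J b 2 z * (f b)" for f]]])
      (use dj in \<open>simp add: algebra_simps\<close>)
  then have "X 1 = 0 \<and> X 2 = 0"
    using dh by (intro solve) (auto simp: sum_2 det_2)
  then have "X a = 0" using exhaust_2[of a] by auto
  then show ?thesis by (simp add: X_def)
qed

end

context metric_pullback
begin

text \<open>The transformation law solved for the second derivatives of the transition map, which
  can thereby be eliminated from the curvature.\<close>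

lemma pd_J:
  "z \<in> S \<Longrightarrow> pd i (J a j) z = (\<Sum>l\<in>UNIV. J a l z * chr G l i j z)
     - (\<Sum>c\<in>UNIV. \<Sum>d\<in>UNIV. chr H a c d (\<Theta> z) * J c i z * J d j z)"
  using chr_transform by simp

lemma pd_chr_transform:
  assumes z: "z \<in> S"
  shows "(\<Sum>l\<in>UNIV. J a l z * pd m (chr G l i j) z) = pd m (pd i (J a j)) z
    - (\<Sum>l\<in>UNIV. pd m (J a l) z * chr G l i j z)
    + (\<Sum>c\<in>UNIV. \<Sum>d\<in>UNIV. (\<Sum>e\<in>UNIV. J e m z * pd e (chr H a c d) (\<Theta> z)) * J c i z * J d j z
        + chr H a c d (\<Theta> z) * (pd m (J c i) z * J d j z + J c i z * pd m (J d j) z))"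
proof -
  have d: "J a i differentiable (at z)" "chr G l i j differentiable (at z)"
    "(\<lambda>z. chr H a c d (\<Theta> z)) differentiable (at z)" "pd i (J a j) differentiable (at z)" for a i l j c d
    using smooth_on_differentiable[OF smooth_J z] smooth_on_differentiable[OF G.smooth_chr z]
      diff_comp[OF z H.smooth_chr] smooth_on_differentiable[OF smooth_on_dderiv[OF smooth_J] z] by auto
  have "pd m (\<lambda>z. \<Sum>l\<in>UNIV. J a l z * chr G l i j z) z =
    pd m (\<lambda>z. pd i (J a j) z + (\<Sum>c\<in>UNIV. \<Sum>d\<in>UNIV. chr H a c d (\<Theta> z) * J c i z * J d j z)) z"
    by (rule dderiv_cong_open[OF G.S z]) (rule chr_transform)
  then show ?thesis
    unfolding pd_chain_J[OF z H.smooth_chr, symmetric] sum_2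
    by (simp add: dderiv_add dderiv_mult d algebra_simps)
qed

text \<open>Third derivatives of \<open>\<Theta>\<close> cancel because partial derivatives commute,
  second ones because \<open>pd_J\<close> replaces them by symbols. Since the tensor is
  antisymmetric in the pair of directions, passing from one coordinate pair to the other only costs
  the Jacobian determinant.\<close>

lemma riem_transform:
  assumes z: "z \<in> S"
  shows "(\<Sum>l\<in>UNIV. J a l z * riem G l k z) =
    (J 1 1 z * J 2 2 z - J 1 2 z * J 2 1 z) * (\<Sum>d\<in>UNIV. J d k z * riem H a d (\<Theta> z))"
proof -
  have T: "\<Theta> z \<in> T" using z maps by blast
  have c: "pd 1 (pd 2 (J a k)) z = pd 2 (pd 1 (J a k)) z"
    by (rule dderiv_commute[OF G.S smooth_J z])
  have cs: "chr G l 2 1 z = chr G l 1 2 z" "chr H l 2 1 (\<Theta> z) = chr H l 1 2 (\<Theta> z)" for l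
    using G.chr_sym[OF z] H.chr_sym[OF T] by blast+
  have ps: "pd e (chr H l 2 1) (\<Theta> z) = pd e (chr H l 1 2) (\<Theta> z)" for e l
    by (rule dderiv_cong_open[OF H.S T]) (rule H.chr_sym)
  have "(\<Sum>l\<in>UNIV. J a l z * riem G l k z) =
      (\<Sum>l\<in>UNIV. J a l z * pd 1 (chr G l 2 k) z) - (\<Sum>l\<in>UNIV. J a l z * pd 2 (chr G l 1 k) z)
      + (\<Sum>l\<in>UNIV. J a l z * (\<Sum>m\<in>UNIV. chr G l 1 m z * chr G m 2 k z - chr G l 2 m z * chr G m 1 k z))"
    by (simp add: riem_def sum_2 algebra_simps)
  also have "\<dots> = (J 1 1 z * J 2 2 z - J 1 2 z * J 2 1 z) * (\<Sum>d\<in>UNIV. J d k z * riem H a d (\<Theta> z))"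
    unfolding pd_chr_transform[OF z] c unfolding pd_J[OF z] riem_def sum_2
    using exhaust_2[of k] by (elim disjE; simp add: cs ps algebra_simps)
  finally show ?thesis .
qed

lemma det_transform:
  assumes z: "z \<in> S"
  shows "det (G z) = (J 1 1 z * J 2 2 z - J 1 2 z * J 2 1 z)\<^sup>2 * det (H (\<Theta> z))"
proof -
  have T: "\<Theta> z \<in> T" using z maps by blast
  show ?thesis
    unfolding det_2 pullback[OF z] J_def[symmetric] sum_2
    by (simp add: H.sym_G[OF T, of 2 1] algebra_simps power2_eq_square)
qed

text \<open>By antisymmetry only \<open>R 1 2\<close> survives. It picks up one Jacobian determinant
  from the direction pair and one from the lowered pair, matching the square in
  \<open>det_transform\<close>.\<close>

lemma curv_transform:
  assumes z: "z \<in> S"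
  shows "curv G z = curv H (\<Theta> z)"
proof -
  have T: "\<Theta> z \<in> T" using z maps by blast
  define R where "R b d = (\<Sum>a\<in>UNIV. H (\<Theta> z) $ b $ a * riem H a d (\<Theta> z))" for b d
  have R: "R b d = - R d b" for b d
    unfolding R_def by (rule H.lower_riem_antisym[OF T])
  have R': "R 1 1 = 0" "R 2 2 = 0" "R 2 1 = - R 1 2"
    using R[of 1 1] R[of 2 2] R[of 2 1] by auto
  define j where "j = J 1 1 z * J 2 2 z - J 1 2 z * J 2 1 z"
  have "(\<Sum>l\<in>UNIV. G z $ 1 $ l * riem G l 2 z) =
    (\<Sum>b\<in>UNIV. J b 1 z * (\<Sum>a\<in>UNIV. H (\<Theta> z) $ b $ a * (\<Sum>l\<in>UNIV. J a l z * riem G l 2 z)))"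
    unfolding pullback[OF z] J_def[symmetric] sum_2 by (simp add: algebra_simps)
  also have "\<dots> = (\<Sum>b\<in>UNIV. J b 1 z * (j * (\<Sum>d\<in>UNIV. J d 2 z * R b d)))"
    unfolding riem_transform[OF z] R_def j_def sum_2 by (simp add: algebra_simps)
  also have "\<dots> = j\<^sup>2 * R 1 2"
    unfolding sum_2 R' by (simp add: j_def power2_eq_square algebra_simps)
  finally have "curv G z = (j\<^sup>2 * R 1 2) / (j\<^sup>2 * det (H (\<Theta> z)))"
    unfolding curv_def det_transform[OF z] j_def by simp
  moreover have "j \<noteq> 0" using G.det_G[OF z] det_transform[OF z] by (auto simp: j_def)
  ultimately show ?thesis by (simp add: curv_def R_def)
qed

end

text \<open>Contracting two differentials with the inverse metric gives the inner product of the
  gradients.\<close>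

definition pgrad :: "(real^2 \<Rightarrow> real^2^2) \<Rightarrow> (real^2 \<Rightarrow> real) \<Rightarrow> (real^2 \<Rightarrow> real) \<Rightarrow> real^2 \<Rightarrow> real" where
  "pgrad G a b z = (\<Sum>i\<in>UNIV. \<Sum>j\<in>UNIV. matrix_inv (G z) $ i $ j * pd i a z * pd j b z)"

context plane_metric
begin

lemma plane_metric_subset: "open T \<Longrightarrow> T \<subseteq> S \<Longrightarrow> plane_metric G T"
  using smooth_on_subset[OF smooth_G] sym_G det_G by (unfold_locales) blast+

lemma det_nz: "z \<in> S \<Longrightarrow> det (G z) \<noteq> 0"
  using det_G by (metis less_irrefl)

lemma smooth_curv: "smooth_on (curv G) S"
  unfolding curv_def[abs_def] riem_def sum_2
  by (intro smooth_on_intros S smooth_G smooth_det smooth_chr det_nz)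

lemma smooth_plap: "smooth_on a S \<Longrightarrow> smooth_on (plap G a) S"
  unfolding plap_def[abs_def]
  by (intro smooth_on_intros S smooth_G smooth_det) (simp_all add: det_nz)

lemma smooth_pgrad: "smooth_on a S \<Longrightarrow> smooth_on b S \<Longrightarrow> smooth_on (pgrad G a b) S"
  unfolding pgrad_def[abs_def] sum_2
  by (intro smooth_on_intros S smooth_inv) auto

lemma pgrad_eq:
  assumes "z \<in> S"
  shows "pgrad G a b z = (G z$2$2 * pd 1 a z * pd 1 b z - G z$1$2 * (pd 1 a z * pd 2 b z + pd 2 a z * pd 1 b z)
    + G z$1$1 * pd 2 a z * pd 2 b z) / det (G z)"
  using det_G[OF assms] sym_G[OF assms, of 2 1]
  by (simp add: pgrad_def sum_2 matrix_inv_2 add_divide_distrib diff_divide_distrib algebra_simps)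

end

text \<open>In dimension two the inverse metric is its adjugate over the determinant. The
  contraction of the differentials with the adjugate and the determinant both scale by the squared
  Jacobian determinant, so the quotient is invariant.\<close>

lemma (in metric_pullback) pgrad_transform:
  assumes z: "z \<in> S" and ab: "a differentiable (at (\<Theta> z))" "b differentiable (at (\<Theta> z))"
  shows "pgrad G (\<lambda>z. a (\<Theta> z)) (\<lambda>z. b (\<Theta> z)) z = pgrad H a b (\<Theta> z)"
proof -
  have T: "\<Theta> z \<in> T" using z maps by blast
  have chain: "pd k (\<lambda>z. f (\<Theta> z)) z = (\<Sum>e\<in>UNIV. J e k z * pd e f (\<Theta> z))" if "f differentiable (at (\<Theta> z))" for f k
    unfolding J_def by (rule pd_chain[OF that smooth_on_differentiable[OF smooth z]])
  define j where "j = J 1 1 z * J 2 2 z - J 1 2 z * J 2 1 z"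
  have j: "j \<noteq> 0" using G.det_G[OF z] det_transform[OF z] by (auto simp: j_def)
  have "pgrad G (\<lambda>z. a (\<Theta> z)) (\<lambda>z. b (\<Theta> z)) z =
     (j\<^sup>2 * (H (\<Theta> z)$2$2 * pd 1 a (\<Theta> z) * pd 1 b (\<Theta> z)
       - H (\<Theta> z)$1$2 * (pd 1 a (\<Theta> z) * pd 2 b (\<Theta> z) + pd 2 a (\<Theta> z) * pd 1 b (\<Theta> z))
       + H (\<Theta> z)$1$1 * pd 2 a (\<Theta> z) * pd 2 b (\<Theta> z))) / det (G z)"
    unfolding G.pgrad_eq[OF z] chain[OF ab(1)] chain[OF ab(2)] pullback[OF z] J_def[symmetric] sum_2 j_def
    by (rule arg_cong[where f="\<lambda>x. x / _"])
      (simp add: H.sym_G[OF T, of 2 1] algebra_simps power2_eq_square)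
  also have "\<dots> = pgrad H a b (\<Theta> z)"
    unfolding H.pgrad_eq[OF T] det_transform[OF z] j_def[symmetric] using j by simp
  finally show ?thesis .
qed

lemma scaleR_matrix_mult_2: "(s *\<^sub>R B) ** (t *\<^sub>R C) = (s * t) *\<^sub>R (B ** C)" for B C :: "real^2^2"
  by (simp add: vec_eq_iff matrix_matrix_mult_def sum_2 algebra_simps)

lemma scaleR_matrix_vector_mult_2: "(s *\<^sub>R B) *v (t *\<^sub>R v) = (s * t) *\<^sub>R (B *v v)" for B :: "real^2^2"
  by (simp add: vec_eq_iff matrix_vector_mult_def sum_2 algebra_simps)

text \<open>With the entries named E, F, H, the vector (1, 0) yields E > 0, and on the vector (-F,
  E) the quadratic form equals E times the determinant.\<close>

lemma pos_def_det:
  fixes B :: "real^2^2"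
  assumes "transpose B = B" "\<And>v. v \<noteq> 0 \<Longrightarrow> v \<bullet> (B *v v) > 0"
  shows "det B > 0"
proof -
  have s: "B $ 2 $ 1 = B $ 1 $ 2" using arg_cong[OF assms(1), of "\<lambda>B. B $ 1 $ 2"] by (simp add: transpose_def)
  have q: "v \<bullet> (B *v v) = B$1$1 * v$1 * v$1 + 2 * B$1$2 * v$1 * v$2 + B$2$2 * v$2 * v$2" for v
    by (simp add: inner_vec_def matrix_vector_mult_def sum_2 s algebra_simps)
  have E: "B$1$1 > 0" using assms(2)[of "vector [1, 0]"] by (simp add: q vec_eq_iff forall_2)
  have "B$1$1 * (B$1$1 * B$2$2 - B$1$2 * B$1$2) > 0"
    using assms(2)[of "vector [- B$1$2, B$1$1]"] E by (simp add: q vec_eq_iff forall_2 algebra_simps)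
  then show ?thesis using E by (simp add: det_2 s zero_less_mult_iff)
qed

section \<open>Functions and metrics on a closed surface\<close>

locale surface =
  fixes M :: "'p::t2_space set" and A :: "'p chart set"
  assumes surface: "closed_surface M A"
begin

lemma compact_M: "compact M"
  using surface unfolding closed_surface_def by blast

lemma M_eq: "(\<Union>c\<in>A. dom_of c) = M"
  using surface unfolding closed_surface_def by blast

lemma dom_subset: "c \<in> A \<Longrightarrow> dom_of c \<subseteq> M"
  using M_eq by blast

lemma dom_openin: "c \<in> A \<Longrightarrow> openin (top_of_set M) (dom_of c)"
  using surface unfolding closed_surface_def by blast

lemma open_range: "c \<in> A \<Longrightarrow> open (range_of c)"
  using surface unfolding closed_surface_def by blast

lemma homeo: "c \<in> A \<Longrightarrow> homeomorphism (dom_of c) (range_of c) (coord c) (param c)"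
  using surface unfolding closed_surface_def by blast

lemma param_coord: "c \<in> A \<Longrightarrow> p \<in> dom_of c \<Longrightarrow> param c (coord c p) = p"
  using homeo[of c] by (simp add: homeomorphism_def)

lemma coord_param: "c \<in> A \<Longrightarrow> z \<in> range_of c \<Longrightarrow> coord c (param c z) = z"
  using homeo[of c] by (simp add: homeomorphism_def)

lemma param_in: "c \<in> A \<Longrightarrow> z \<in> range_of c \<Longrightarrow> param c z \<in> dom_of c"
  using homeo[of c] by (auto simp add: homeomorphism_def)

lemma coord_in: "p \<in> dom_of c \<Longrightarrow> coord c p \<in> range_of c"
  by (simp add: range_of_def)

lemma param_in_M: "c \<in> A \<Longrightarrow> z \<in> range_of c \<Longrightarrow> param c z \<in> M"
  using param_in dom_subset by blast

lemma continuous_coord: "c \<in> A \<Longrightarrow> continuous_on (dom_of c) (coord c)"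
  using homeo by (auto simp add: homeomorphism_def)

lemma continuous_param: "c \<in> A \<Longrightarrow> continuous_on (range_of c) (param c)"
  using homeo by (auto simp add: homeomorphism_def)

lemma chart_at: assumes "p \<in> M" shows "chart_at A p \<in> A" "p \<in> dom_of (chart_at A p)"
proof -
  have "\<exists>c. c \<in> A \<and> p \<in> dom_of c" using assms M_eq by blast
  from someI_ex[OF this] show "chart_at A p \<in> A" "p \<in> dom_of (chart_at A p)"
    by (auto simp: chart_at_def)
qed

lemma open_overlap:
  assumes "c \<in> A" "d \<in> A" shows "open (coord c ` (dom_of c \<inter> dom_of d))"
proof -
  obtain T where "open T" "dom_of d = M \<inter> T" using dom_openin[OF assms(2)] by (auto simp: openin_open)
  then have "openin (top_of_set (dom_of c)) (dom_of c \<inter> dom_of d)"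
    using dom_subset[OF assms(1)] by (auto simp: openin_open)
  then have "openin (top_of_set (range_of c)) (coord c ` (dom_of c \<inter> dom_of d))"
    using homeomorphism_imp_open_map[OF homeo[OF assms(1)]] by blast
  then show ?thesis using open_range[OF assms(1)] openin_open_eq by blast
qed

lemma smooth_transition:
  "c \<in> A \<Longrightarrow> d \<in> A \<Longrightarrow> smooth_on (coord d \<circ> param c) (coord c ` (dom_of c \<inter> dom_of d))"
  using surface unfolding closed_surface_def by blast

lemma overlap_in:
  assumes "c \<in> A" "d \<in> A" "z \<in> coord c ` (dom_of c \<inter> dom_of d)"
  shows "z \<in> range_of c" "param c z \<in> dom_of d" "coord d (param c z) \<in> range_of d"
    "param d (coord d (param c z)) = param c z"
proof -
  obtain p where p: "p \<in> dom_of c" "p \<in> dom_of d" "z = coord c p" using assms(3) by blast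
  show "z \<in> range_of c" "param c z \<in> dom_of d" "coord d (param c z) \<in> range_of d"
    "param d (coord d (param c z)) = param c z"
    using p by (simp_all add: param_coord assms(1,2) range_of_def)
qed

end

lemma smooth_functionsD: "f \<in> smooth_functions A \<Longrightarrow> c \<in> A \<Longrightarrow> smooth_on (\<lambda>z. f (param c z)) (range_of c)"
  by (auto simp: smooth_functions_def comp_def)

text \<open>The cut-off functions that localise integrals are only of class C^1, so gradient
  products are treated for this class.\<close>

definition (in surface) C1_functions :: "('p \<Rightarrow> real) set" where
  "C1_functions = {f. \<forall>c\<in>A. Ck_on 1 (\<lambda>z. f (param c z)) (range_of c)}"

lemma (in surface) C1_functionsI:
  "(\<And>c. c \<in> A \<Longrightarrow> Ck_on 1 (\<lambda>z. f (param c z)) (range_of c)) \<Longrightarrow> f \<in> C1_functions"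
  unfolding C1_functions_def by blast

lemma (in surface) C1_functionsD:
  "f \<in> C1_functions \<Longrightarrow> c \<in> A \<Longrightarrow> Ck_on 1 (\<lambda>z. f (param c z)) (range_of c)"
  unfolding C1_functions_def by blast

lemma (in surface) smooth_C1: "f \<in> smooth_functions A \<Longrightarrow> f \<in> C1_functions"
  by (rule C1_functionsI) (rule smooth_on_Ck_on[OF smooth_functionsD])

lemma (in surface) C1_functions_differentiable:
  "f \<in> C1_functions \<Longrightarrow> c \<in> A \<Longrightarrow> z \<in> range_of c \<Longrightarrow> (\<lambda>z. f (param c z)) differentiable (at z)"
  using C1_functionsD[of f c] by simp

section \<open>Curvature, gradients and Laplacian of a metric on the surface\<close>

locale metric_surface = surface M A for M :: "'p::t2_space set" and A +
  fixes g :: "'p metric"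
  assumes metric: "riemannian_metric A g"
begin

abbreviation G :: "'p chart \<Rightarrow> real^2 \<Rightarrow> real^2^2" where
  "G c \<equiv> \<lambda>z. g c (param c z)"

lemma plane_metric_chart: assumes c: "c \<in> A" shows "plane_metric (G c) (range_of c)"
proof
  show "open (range_of c)" by (rule open_range[OF c])
  show "smooth_on (\<lambda>z. G c z $ i $ j) (range_of c)" for i j
    using metric c unfolding riemannian_metric_def comp_def
    by (intro smooth_on_vec_nth open_range) auto
  fix z assume z: "z \<in> range_of c"
  have s: "transpose (G c z) = G c z" and pos: "\<And>v. v \<noteq> 0 \<Longrightarrow> v \<bullet> (G c z *v v) > 0"
    using metric c param_in[OF c z] unfolding riemannian_metric_def by auto
  show "G c z $ i $ j = G c z $ j $ i" for i j
    using arg_cong[OF s, of "\<lambda>B. B $ j $ i"] by (simp add: transpose_def)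
  show "det (G c z) > 0" using pos_def_det[OF s pos] .
qed

lemma pullback_chart:
  assumes c: "c \<in> A" and d: "d \<in> A"
  shows "metric_pullback (G c) (coord c ` (dom_of c \<inter> dom_of d)) (G d) (range_of d) (\<lambda>z. coord d (param c z))"
proof -
  let ?U = "coord c ` (dom_of c \<inter> dom_of d)" and ?\<Theta> = "\<lambda>z. coord d (param c z)"
  interpret G: plane_metric "G c" ?U
    by (rule plane_metric.plane_metric_subset[OF plane_metric_chart[OF c] open_overlap[OF c d]])
      (auto simp: range_of_def)
  interpret H: plane_metric "G d" "range_of d" by (rule plane_metric_chart[OF d])
  show ?thesis
  proof
    show sm: "smooth_on ?\<Theta> ?U" using smooth_transition[OF c d] by (simp add: comp_def)
    show "?\<Theta> ` ?U \<subseteq> range_of d" using overlap_in[OF c d] by blast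
    fix z i j assume z: "z \<in> ?U"
    define J where "J = matrix (frechet_derivative (coord d \<circ> param c) (at z))"
    have J: "J $ a $ i = pd i (\<lambda>z. ?\<Theta> z $ a) z" for a i
      using dderiv_vec_nth[OF smooth_on_differentiable[OF sm z], of "axis i 1" a]
      by (simp add: J_def matrix_def dderiv_def comp_def)
    have "param c z \<in> dom_of c \<inter> dom_of d" "coord c (param c z) = z"
      using overlap_in[OF c d z] param_in[OF c] coord_param[OF c] by blast+
    then have "G c z = transpose J ** G d (?\<Theta> z) ** J"
      using metric c d overlap_in[OF c d z] unfolding riemannian_metric_def J_def Let_def by metis
    then show "G c z $ i $ j = (\<Sum>a\<in>UNIV. \<Sum>b\<in>UNIV. pd i (\<lambda>z. ?\<Theta> z $ a) z * G d (?\<Theta> z) $ a $ b * pd j (\<lambda>z. ?\<Theta> z $ b) z)"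
      by (simp add: J[symmetric] matrix_matrix_mult_def transpose_def sum_2 algebra_simps)
  qed
qed

lemma christoffel_eq:
  assumes c: "c \<in> A" and p: "p \<in> dom_of c"
  shows "christoffel g c k i j p = chr (G c) k i j (coord c p)"
  by (simp add: christoffel_def chr_def chr1_def sum_2 partial_def dderiv_def comp_def param_coord[OF c p]
      field_simps)

lemma riemann_eq:
  assumes c: "c \<in> A" and p: "p \<in> dom_of c"
  shows "riemann g c l k 1 2 p = riem (G c) l k (coord c p)"
proof -
  have "partial c m (christoffel g c l i j) p = pd m (chr (G c) l i j) (coord c p)" for m i j
  proof -
    have "partial c m (christoffel g c l i j) p = pd m (\<lambda>z. christoffel g c l i j (param c z)) (coord c p)"
      by (simp add: partial_def dderiv_def comp_def)
    also have "\<dots> = pd m (chr (G c) l i j) (coord c p)"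
      by (rule dderiv_cong_open[OF open_range[OF c] coord_in[OF p]])
        (simp add: christoffel_eq c param_in coord_param)
    finally show ?thesis .
  qed
  then show ?thesis by (simp add: riemann_def riem_def christoffel_eq[OF c p])
qed

text \<open>Removes the arbitrary chart in the definition: a transition map pulls one coordinate
  metric back to the other, and \<open>curv\<close> is invariant under that.\<close>

lemma gauss_curvature_eq:
  assumes c: "c \<in> A" and p: "p \<in> dom_of c"
  shows "gauss_curvature A g p = curv (G c) (coord c p)"
proof -
  define d where "d = chart_at A p"
  have "p \<in> M" using dom_subset[OF c] p by blast
  then have d: "d \<in> A" "p \<in> dom_of d" using chart_at[of p] by (simp_all add: d_def)
  interpret P: metric_pullback "G c" "coord c ` (dom_of c \<inter> dom_of d)" "G d" "range_of d" "\<lambda>z. coord d (param c z)"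
    by (rule pullback_chart[OF c d(1)])
  have "gauss_curvature A g p = curv (G d) (coord d p)"
    by (simp add: gauss_curvature_def d_def[symmetric] Let_def curv_def riemann_eq d param_coord)
  also have "\<dots> = curv (G c) (coord c p)"
    using P.curv_transform[of "coord c p"] c p d by (simp add: param_coord)
  finally show ?thesis .
qed

lemma grad_inner_eq:
  assumes c: "c \<in> A" and p: "p \<in> dom_of c" and ab: "a \<in> C1_functions" "b \<in> C1_functions"
  shows "grad_inner A g a b p = pgrad (G c) (\<lambda>z. a (param c z)) (\<lambda>z. b (param c z)) (coord c p)"
proof -
  define d where "d = chart_at A p"
  have "p \<in> M" using dom_subset[OF c] p by blast
  then have d: "d \<in> A" "p \<in> dom_of d" using chart_at[of p] by (simp_all add: d_def)
  let ?U = "coord c ` (dom_of c \<inter> dom_of d)"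
  interpret P: metric_pullback "G c" ?U "G d" "range_of d" "\<lambda>z. coord d (param c z)"
    by (rule pullback_chart[OF c d(1)])
  have det: "det (g d p) > 0" and sym: "g d p $ 2 $ 1 = g d p $ 1 $ 2"
    using P.H.det_G[OF coord_in[OF d(2)]] P.H.sym_G[OF coord_in[OF d(2)], of 2 1] param_coord[OF d] by auto
  have inv: "matrix_inv (g d p) $ 1 $ 1 = g d p $ 2 $ 2 / det (g d p)"
    "matrix_inv (g d p) $ 1 $ 2 = - g d p $ 1 $ 2 / det (g d p)"
    "matrix_inv (g d p) $ 2 $ 1 = - g d p $ 1 $ 2 / det (g d p)"
    "matrix_inv (g d p) $ 2 $ 2 = g d p $ 1 $ 1 / det (g d p)"
    using matrix_inv_2[of "g d p"] det sym by auto
  have "invertible (g d p)" using det by (simp add: invertible_det_nz)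
  then have inv2: "g d p *v (matrix_inv (g d p) *v v) = v" for v
    using someI_ex[of "\<lambda>A'. g d p ** A' = mat 1 \<and> A' ** g d p = mat 1"]
    unfolding invertible_def matrix_inv_def by (simp add: matrix_vector_mul_assoc)
  have "grad_inner A g a b p = pgrad (G d) (\<lambda>z. a (param d z)) (\<lambda>z. b (param d z)) (coord d p)"
    unfolding grad_inner_def Let_def d_def[symmetric] gradient_def inv2
    by (simp add: differential_def partial_def pgrad_def dderiv_def comp_def param_coord[OF d]
        inner_vec_def matrix_vector_mult_def sum_2 inv algebra_simps)
  also have "\<dots> = pgrad (G c) (\<lambda>z. a (param d (coord d (param c z)))) (\<lambda>z. b (param d (coord d (param c z)))) (coord c p)"
    using P.pgrad_transform[of "coord c p", OF _ C1_functions_differentiable[OF ab(1) d(1)] C1_functions_differentiable[OF ab(2) d(1)]]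
      c p d by (simp add: param_coord coord_in)
  also have "\<dots> = pgrad (G c) (\<lambda>z. a (param c z)) (\<lambda>z. b (param c z)) (coord c p)"
  proof -
    \<comment> \<open>On the overlap the detour through the chart \<open>d\<close> is the identity,
      so both functions agree near the point.\<close>
    have "pd i (\<lambda>z. a (param d (coord d (param c z)))) (coord c p) = pd i (\<lambda>z. a (param c z)) (coord c p)" for i a
      by (rule dderiv_cong_open[OF open_overlap[OF c d(1)]]) (use p d overlap_in[OF c d(1)] in auto)
    then show ?thesis by (simp add: pgrad_def)
  qed
  finally show ?thesis .
qed

lemma smooth_functionsI: "(\<And>c. c \<in> A \<Longrightarrow> smooth_on (\<lambda>z. f (param c z)) (range_of c)) \<Longrightarrow> f \<in> smooth_functions A"
  by (auto simp: smooth_functions_def comp_def)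

lemma smooth_gauss_curvature: "gauss_curvature A g \<in> smooth_functions A"
proof (rule smooth_functionsI)
  fix c assume c: "c \<in> A"
  interpret plane_metric "G c" "range_of c" by (rule plane_metric_chart[OF c])
  show "smooth_on (\<lambda>z. gauss_curvature A g (param c z)) (range_of c)"
    using smooth_curv by (subst smooth_on_cong[OF S, of _ "curv (G c)"])
      (auto simp: gauss_curvature_eq[OF c param_in[OF c]] coord_param[OF c])
qed

lemma smooth_grad_inner:
  assumes "a \<in> smooth_functions A" "b \<in> smooth_functions A"
  shows "grad_inner A g a b \<in> smooth_functions A"
proof (rule smooth_functionsI)
  fix c assume c: "c \<in> A"
  interpret plane_metric "G c" "range_of c" by (rule plane_metric_chart[OF c])
  show "smooth_on (\<lambda>z. grad_inner A g a b (param c z)) (range_of c)"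
    using smooth_pgrad[OF assms[THEN smooth_functionsD[OF _ c]]]
    by (subst smooth_on_cong[OF S, of _ "pgrad (G c) (\<lambda>z. a (param c z)) (\<lambda>z. b (param c z))"])
      (auto simp: grad_inner_eq[OF c param_in[OF c] assms[THEN smooth_C1]] coord_param[OF c])
qed

lemma conformal_metric_surface:
  assumes a: "a \<in> smooth_functions A"
  shows "metric_surface M A (conformal g a)"
proof
  have "smooth_on (conformal g a c \<circ> param c) (range_of c)" if c: "c \<in> A" for c
  proof -
    have "smooth_on (\<lambda>z. exp (2 * a (param c z))) (range_of c)" "smooth_on (\<lambda>z. g c (param c z)) (range_of c)"
      using smooth_functionsD[OF a c] metric c
      by (auto simp: riemannian_metric_def comp_def intro!: smooth_on_intros open_range)
    then show ?thesis
      unfolding conformal_def comp_def smooth_on_def using Ck_on_scaleR[OF open_range[OF c]] by blast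
  qed
  moreover have "transpose (conformal g a c p) = conformal g a c p"
    "v \<noteq> 0 \<Longrightarrow> v \<bullet> (conformal g a c p *v v) > 0" if "c \<in> A" "p \<in> dom_of c" for c p v
  proof -
    have g: "transpose (g c p) = g c p" "v \<noteq> 0 \<Longrightarrow> v \<bullet> (g c p *v v) > 0"
      using metric that unfolding riemannian_metric_def by blast+
    show "transpose (conformal g a c p) = conformal g a c p"
      unfolding conformal_def transpose_scalar g(1) ..
    show "v \<noteq> 0 \<Longrightarrow> v \<bullet> (conformal g a c p *v v) > 0"
      using g(2) scaleR_matrix_vector_mult_2[of "exp (2 * a p)" "g c p" 1 v] by (simp add: conformal_def)
  qed
  moreover have "conformal g a c p = transpose J ** conformal g a d p ** J"
    if "c \<in> A" "d \<in> A" "p \<in> dom_of c \<inter> dom_of d"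
      and J: "J = matrix (frechet_derivative (coord d \<circ> param c) (at (coord c p)))" for c d p J
  proof -
    have "g c p = transpose J ** g d p ** J"
      using metric that unfolding riemannian_metric_def Let_def by blast
    moreover have "transpose J ** (t *\<^sub>R B) ** J = t *\<^sub>R (transpose J ** B ** J)" for B :: "real^2^2" and t
      using scaleR_matrix_mult_2[of 1 "transpose J" t B] scaleR_matrix_mult_2[of t "transpose J ** B" 1 J] by simp
    ultimately show ?thesis by (simp add: conformal_def)
  qed
  ultimately show "riemannian_metric A (conformal g a)"
    unfolding riemannian_metric_def Let_def by blast
qed

text \<open>Since \<open>e\<^sup>2\<^sup>a K(e\<^sup>2\<^sup>a g) = K(g) - \<Delta>a\<close>, taking this as the definition of \<open>\<Delta>\<close> makes it independent
  of charts by the invariance of the curvature.\<close>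

definition laplacian :: "('p \<Rightarrow> real) \<Rightarrow> 'p \<Rightarrow> real" where
  "laplacian a p = gauss_curvature A g p - exp (2 * a p) * gauss_curvature A (conformal g a) p"

lemma laplacian_eq:
  assumes a: "a \<in> smooth_functions A" and c: "c \<in> A" and p: "p \<in> dom_of c"
  shows "laplacian a p = plap (G c) (\<lambda>z. a (param c z)) (coord c p)"
proof -
  interpret C: metric_surface M A "conformal g a" by (rule conformal_metric_surface[OF a])
  interpret plane_metric "G c" "range_of c" by (rule plane_metric_chart[OF c])
  show ?thesis
    using curv_conformal[OF smooth_functionsD[OF a c] coord_in[OF p]]
    by (simp add: laplacian_def gauss_curvature_eq[OF c p] C.gauss_curvature_eq[OF c p] param_coord[OF c p])
      (simp add: conformal_def)
qed

lemma smooth_laplacian: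
  assumes "a \<in> smooth_functions A" shows "laplacian a \<in> smooth_functions A"
proof (rule smooth_functionsI)
  fix c assume c: "c \<in> A"
  interpret plane_metric "G c" "range_of c" by (rule plane_metric_chart[OF c])
  show "smooth_on (\<lambda>z. laplacian a (param c z)) (range_of c)"
    using smooth_plap[OF smooth_functionsD[OF assms c]]
    by (subst smooth_on_cong[OF S, of _ "plap (G c) (\<lambda>z. a (param c z))"])
      (auto simp: laplacian_eq[OF assms c param_in[OF c]] coord_param[OF c])
qed

text \<open>Both sides are computed in the chart \<open>chart_at A p\<close>, so only the scaling of
  the inverse matrix by \<open>exp (- 2 * v p)\<close> is used.\<close>

lemma grad_inner_conformal:
  assumes p: "p \<in> M"
  shows "exp (2 * v p) * grad_inner A (conformal g v) a b p = grad_inner A g a b p"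
proof -
  define d where "d = chart_at A p"
  have d: "d \<in> A" "p \<in> dom_of d" using chart_at[of p] p by (simp_all add: d_def)
  interpret plane_metric "G d" "range_of d" by (rule plane_metric_chart[OF d(1)])
  have det: "det (g d p) \<noteq> 0" using det_G[OF coord_in[OF d(2)]] param_coord[OF d] by auto
  then have inv: "matrix_inv (g d p) ** g d p = mat 1" "g d p ** matrix_inv (g d p) = mat 1"
    using someI_ex[of "\<lambda>A'. g d p ** A' = mat 1 \<and> A' ** g d p = mat 1"] invertible_det_nz[of "g d p"]
    unfolding invertible_def matrix_inv_def by simp_all
  have "matrix_inv (exp (2 * v p) *\<^sub>R g d p) = exp (- 2 * v p) *\<^sub>R matrix_inv (g d p)"
    by (rule matrix_inv_eqI) (simp_all add: scaleR_matrix_mult_2 inv flip: exp_add)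
  moreover have "(s *\<^sub>R B) *v v = s *\<^sub>R (B *v v)" for s v and B :: "real^2^2"
    using scaleR_matrix_vector_mult_2[of s B 1 v] by simp
  moreover have "B *v (s *\<^sub>R v) = s *\<^sub>R (B *v v)" for s v and B :: "real^2^2"
    using scaleR_matrix_vector_mult_2[of 1 B s v] by simp
  ultimately show ?thesis
    by (simp add: grad_inner_def Let_def d_def[symmetric] gradient_def conformal_def exp_minus field_simps)
qed

end

section \<open>The Riemannian area\<close>

text \<open>The theorem for absolutely integrable functions is an equivalence: integrability on one
  side gives it on the other, with equal integrals. For nonnegative functions this settles the
  infinite case as well, since both integrals are then infinite together.\<close>

lemma nn_integral_change_of_variables:
  fixes \<Theta> :: "real^2 \<Rightarrow> real^2" and f :: "real^2 \<Rightarrow> real"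
  assumes S: "S \<in> sets borel"
    and der: "\<And>x. x \<in> S \<Longrightarrow> (\<Theta> has_derivative \<Theta>' x) (at x)"
    and inj: "inj_on \<Theta> S"
    and f: "\<And>x. x \<in> S \<Longrightarrow> 0 \<le> f (\<Theta> x)"
    and mf: "(\<lambda>y. indicator (\<Theta> ` S) y * f y) \<in> borel_measurable borel"
    and mg: "(\<lambda>x. indicator S x * (\<bar>det (matrix (\<Theta>' x))\<bar> * f (\<Theta> x))) \<in> borel_measurable borel"
  shows "(\<integral>\<^sup>+x. ennreal (indicator S x * (\<bar>det (matrix (\<Theta>' x))\<bar> * f (\<Theta> x))) \<partial>lborel)
    = (\<integral>\<^sup>+y. ennreal (indicator (\<Theta> ` S) y * f y) \<partial>lborel)"
proof -
  define h where "h x = \<bar>det (matrix (\<Theta>' x))\<bar> * f (\<Theta> x)" for x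
  have iff: "h absolutely_integrable_on S \<and> integral S h = b \<longleftrightarrow> f absolutely_integrable_on \<Theta> ` S \<and> integral (\<Theta> ` S) f = b" for b
  proof -
    \<comment> \<open>The change of variables theorem speaks of vector-valued functions, so the
      scalar is wrapped as a vector of dimension one.\<close>
    have "(\<lambda>x. \<bar>det (matrix (\<Theta>' x))\<bar> *\<^sub>R (vec (f (\<Theta> x)) :: real^1)) absolutely_integrable_on S \<and>
       integral S (\<lambda>x. \<bar>det (matrix (\<Theta>' x))\<bar> *\<^sub>R (vec (f (\<Theta> x)) :: real^1)) = vec b
     \<longleftrightarrow> (\<lambda>x. vec (f x) :: real^1) absolutely_integrable_on (\<Theta> ` S) \<and> integral (\<Theta> ` S) (\<lambda>x. vec (f x) :: real^1) = vec b"
      by (rule has_absolute_integral_change_of_variables)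
        (use S der inj in \<open>auto intro: has_derivative_at_withinI\<close>)
    then show ?thesis
      unfolding absolutely_integrable_on_1_iff integral_on_1_eq h_def by (simp add: vec_eq_iff)
  qed
  have eq: "(\<integral>\<^sup>+x. ennreal (indicator T x * k x) \<partial>lborel) = (if k absolutely_integrable_on T then ennreal (integral T k) else \<infinity>)"
    if k: "\<And>x. x \<in> T \<Longrightarrow> 0 \<le> k x" and m: "(\<lambda>x. indicator T x * k x) \<in> borel_measurable borel"
    for T and k :: "real^2 \<Rightarrow> real"
  proof -
    have nn: "0 \<le> indicator T x * k x" for x using k by (auto simp: indicator_def)
    have m': "(\<lambda>x. indicator T x * k x) \<in> borel_measurable lebesgue"
      using measurable_completion[of "\<lambda>x. indicator T x * k x" lborel borel] m by simp
    have "(\<integral>\<^sup>+x. ennreal (indicator T x * k x) \<partial>lborel) = (\<integral>\<^sup>+x. ennreal (indicator T x * k x) \<partial>lebesgue)"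
      by (simp add: nn_integral_completion)
    also have "\<dots> = (if k absolutely_integrable_on T then ennreal (integral T k) else \<infinity>)"
    proof (cases "k absolutely_integrable_on T")
      case True
      then have "integrable lebesgue (\<lambda>x. indicator T x * k x)" by (simp add: set_integrable_def)
      from nn_integral_eq_integral[OF this] show ?thesis
        using True nn set_lebesgue_integral_eq_integral(2)[OF True] by (simp add: set_lebesgue_integral_def)
    next
      case False
      then have "\<not> integrable lebesgue (\<lambda>x. indicator T x * k x)" by (simp add: set_integrable_def)
      then have "\<not> (\<integral>\<^sup>+x. ennreal (indicator T x * k x) \<partial>lebesgue) < \<infinity>"
        using integrableI_nonneg[OF m'] nn by auto
      then show ?thesis using False by (simp only: infinity_ennreal_def less_top[symmetric] not_not if_False)
    qed
    finally show ?thesis .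
  qed
  have "(\<integral>\<^sup>+x. ennreal (indicator S x * h x) \<partial>lborel) = (\<integral>\<^sup>+y. ennreal (indicator (\<Theta> ` S) y * f y) \<partial>lborel)"
  proof -
    have "h absolutely_integrable_on S \<longleftrightarrow> f absolutely_integrable_on \<Theta> ` S"
      "h absolutely_integrable_on S \<Longrightarrow> integral S h = integral (\<Theta> ` S) f"
      using iff by blast+
    moreover have "(\<integral>\<^sup>+x. ennreal (indicator S x * h x) \<partial>lborel) = (if h absolutely_integrable_on S then ennreal (integral S h) else \<infinity>)"
      by (rule eq) (use f mg in \<open>auto simp: h_def\<close>)
    moreover have "(\<integral>\<^sup>+y. ennreal (indicator (\<Theta> ` S) y * f y) \<partial>lborel)
        = (if f absolutely_integrable_on \<Theta> ` S then ennreal (integral (\<Theta> ` S) f) else \<infinity>)"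
      by (rule eq) (use f mf in auto)
    ultimately show ?thesis by simp
  qed
  then show ?thesis by (simp add: h_def)
qed

section \<open>Charts and Borel sets\<close>

context surface
begin

abbreviation BM :: "'p measure" where "BM \<equiv> restrict_space borel M"

lemma M_borel [measurable]: "M \<in> sets borel"
  by (rule borel_closed[OF compact_imp_closed[OF compact_M]])

lemma sets_BM: "E \<in> sets BM \<longleftrightarrow> E \<subseteq> M \<and> E \<in> sets borel"
  using sets_restrict_space_iff[of M borel E] by simp

lemma dom_sets: assumes "c \<in> A" shows "dom_of c \<in> sets BM"
proof -
  obtain T where "open T" "dom_of c = M \<inter> T" using dom_openin[OF assms] by (auto simp: openin_open)
  then show ?thesis unfolding sets_BM by auto
qed

lemma range_sets: "c \<in> A \<Longrightarrow> range_of c \<in> sets borel"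
  by (rule borel_open[OF open_range])

lemma param_measurable:
  assumes "c \<in> A" shows "param c \<in> measurable (restrict_space lborel (range_of c)) BM"
proof (rule measurable_restrict_space2)
  show "param c \<in> space (restrict_space lborel (range_of c)) \<rightarrow> M"
    using param_in_M[OF assms] by (auto simp: space_restrict_space)
  have "param c \<in> borel_measurable (restrict_space borel (range_of c))"
    by (rule borel_measurable_continuous_on_restrict[OF continuous_param[OF assms]])
  then show "param c \<in> borel_measurable (restrict_space lborel (range_of c))"
    by (subst measurable_cong_sets[OF sets_restrict_space_cong[OF sets_lborel] refl])
qed

lemma coord_image_eq:
  assumes "c \<in> A" shows "coord c ` (E \<inter> dom_of c) = param c -` E \<inter> range_of c"
proof (rule set_eqI)
  fix z show "z \<in> coord c ` (E \<inter> dom_of c) \<longleftrightarrow> z \<in> param c -` E \<inter> range_of c"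
  proof
    assume "z \<in> coord c ` (E \<inter> dom_of c)"
    then obtain p where "p \<in> E" "p \<in> dom_of c" "z = coord c p" by blast
    then show "z \<in> param c -` E \<inter> range_of c" using param_coord[OF assms] by (simp add: range_of_def)
  next
    assume z: "z \<in> param c -` E \<inter> range_of c"
    then have "z = coord c (param c z)" "param c z \<in> E \<inter> dom_of c"
      using coord_param[OF assms] param_in[OF assms] by auto
    then show "z \<in> coord c ` (E \<inter> dom_of c)" by blast
  qed
qed

lemma coord_image_borel:
  assumes c: "c \<in> A" and E: "E \<in> sets BM" shows "coord c ` (E \<inter> dom_of c) \<in> sets borel"
proof -
  have "param c -` E \<inter> range_of c \<in> sets (restrict_space lborel (range_of c))"
    using measurable_sets[OF param_measurable[OF c] E] by (simp add: space_restrict_space)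
  then show ?thesis unfolding coord_image_eq[OF c]
    using range_sets[OF c] by (subst (asm) sets_restrict_space_iff) auto
qed

end

lemma disjoint_family_on_Int: "disjoint_family_on D I \<Longrightarrow> disjoint_family_on (\<lambda>i. E \<inter> D i) I"
  unfolding disjoint_family_on_def by blast

section \<open>Gluing the chart densities to one measure\<close>

context metric_surface
begin

definition chart_density :: "'p chart \<Rightarrow> real^2 \<Rightarrow> real" where
  "chart_density c z = sqrt (det (G c z))"

text \<open>Lives on the Borel sets of all of \<open>M\<close> and has no mass outside
  \<open>dom_of c\<close>, so that measures from different charts share a sigma-algebra and can be
  added.\<close>

definition chart_measure :: "'p chart \<Rightarrow> 'p measure" where
  "chart_measure c = distr (density (restrict_space lborel (range_of c)) (\<lambda>z. ennreal (chart_density c z))) BM (param c)"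

lemma sets_chart_measure [simp]: "sets (chart_measure c) = sets BM"
  by (simp add: chart_measure_def)

lemma chart_density_pos: "c \<in> A \<Longrightarrow> z \<in> range_of c \<Longrightarrow> chart_density c z > 0"
  using plane_metric.det_G[OF plane_metric_chart] by (simp add: chart_density_def)

lemma Ck_chart_density: assumes "c \<in> A" shows "Ck_on k (chart_density c) (range_of c)"
proof -
  interpret plane_metric "G c" "range_of c" by (rule plane_metric_chart[OF assms])
  show ?thesis unfolding chart_density_def[abs_def]
    by (rule Ck_on_sqrt[OF S smooth_on_Ck_on[OF smooth_det] det_G])
qed

lemma chart_density_measurable:
  assumes "c \<in> A" shows "chart_density c \<in> borel_measurable (restrict_space lborel (range_of c))"
  using borel_measurable_continuous_on_restrict[OF Ck_on_continuous[OF Ck_chart_density[OF assms]]]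
  by (subst measurable_cong_sets[OF sets_restrict_space_cong[OF sets_lborel] refl])

lemma emeasure_chart_measure:
  assumes c: "c \<in> A" and E: "E \<in> sets BM"
  shows "emeasure (chart_measure c) E =
    (\<integral>\<^sup>+z. ennreal (sqrt (det (g c (param c z)))) * indicator (coord c ` (E \<inter> dom_of c)) z \<partial>lborel)"
proof -
  let ?L = "restrict_space lborel (range_of c)"
  have sp: "range_of c \<inter> space lborel \<in> sets lborel" using range_sets[OF c] by simp
  note [measurable] = param_measurable[OF c] chart_density_measurable[OF c]
  have "emeasure (chart_measure c) E = emeasure (density ?L (\<lambda>z. ennreal (chart_density c z))) (param c -` E \<inter> range_of c)"
    unfolding chart_measure_def using E by (subst emeasure_distr) (auto simp: space_restrict_space)
  also have "\<dots> = (\<integral>\<^sup>+z. ennreal (chart_density c z) * indicator (param c -` E \<inter> range_of c) z \<partial>?L)"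
    using measurable_sets[OF param_measurable[OF c] E]
    by (subst emeasure_density) (auto simp: space_restrict_space)
  also have "\<dots> = (\<integral>\<^sup>+z. ennreal (chart_density c z) * indicator (param c -` E \<inter> range_of c) z * indicator (range_of c) z \<partial>lborel)"
    by (rule nn_integral_restrict_space[OF sp])
  also have "\<dots> = (\<integral>\<^sup>+z. ennreal (sqrt (det (g c (param c z)))) * indicator (coord c ` (E \<inter> dom_of c)) z \<partial>lborel)"
    unfolding coord_image_eq[OF c] by (intro nn_integral_cong) (auto simp: chart_density_def indicator_def)
  finally show ?thesis .
qed

text \<open>The determinants of the two coordinate metrics differ by the squared Jacobian
  determinant, so the densities differ by exactly the factor in the change of variables
  formula.\<close>

lemma chart_measure_overlap:
  assumes c: "c \<in> A" and d: "d \<in> A" and E: "E \<in> sets BM" "E \<subseteq> dom_of c" "E \<subseteq> dom_of d"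
  shows "emeasure (chart_measure c) E = emeasure (chart_measure d) E"
proof -
  let ?U = "coord c ` (dom_of c \<inter> dom_of d)" and ?\<Theta> = "\<lambda>z. coord d (param c z)"
  interpret P: metric_pullback "G c" ?U "G d" "range_of d" ?\<Theta>
    by (rule pullback_chart[OF c d])
  define S where "S = coord c ` (E \<inter> dom_of c)"
  have SU: "S \<subseteq> ?U" using E by (auto simp: S_def)
  have S: "S \<in> sets borel" unfolding S_def by (rule coord_image_borel[OF c E(1)])
  have \<Theta>S: "?\<Theta> ` S = coord d ` (E \<inter> dom_of d)"
  proof -
    have "?\<Theta> ` S = (\<lambda>p. coord d (param c (coord c p))) ` E" using E by (auto simp: S_def image_image)
    also have "\<dots> = coord d ` E" using E by (intro image_cong) (auto simp: param_coord[OF c])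
    finally show ?thesis using E by (simp add: inf.absorb1)
  qed
  define \<Theta>' where "\<Theta>' z = (\<lambda>v. dderiv v ?\<Theta> z)" for z
  have der: "(?\<Theta> has_derivative \<Theta>' z) (at z)" if "z \<in> S" for z
    unfolding \<Theta>'_def using that SU by (intro dderiv_works smooth_on_differentiable[OF P.smooth]) auto
  have inj: "inj_on ?\<Theta> S"
  proof (rule inj_onI)
    fix x y assume xy: "x \<in> S" "y \<in> S" "?\<Theta> x = ?\<Theta> y"
    have "x \<in> ?U" "y \<in> ?U" using xy SU by auto
    note o = overlap_in[OF c d this(1)] overlap_in[OF c d this(2)]
    have "param c x = param c y" using o xy(3) by metis
    then show "x = y" using o coord_param[OF c] by metis
  qed
  have dens: "\<bar>det (matrix (\<Theta>' z))\<bar> * chart_density d (?\<Theta> z) = chart_density c z" if "z \<in> S" for z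
  proof -
    have z: "z \<in> ?U" using that SU by auto
    have "matrix (\<Theta>' z) $ a $ i = P.J a i z" for a i
      unfolding P.J_def matrix_def \<Theta>'_def
      using dderiv_vec_nth[OF smooth_on_differentiable[OF P.smooth z], of "axis i 1" a] by simp
    then have "det (matrix (\<Theta>' z)) = P.J 1 1 z * P.J 2 2 z - P.J 1 2 z * P.J 2 1 z"
      by (simp add: det_2)
    then have "det (G c z) = (det (matrix (\<Theta>' z)))\<^sup>2 * det (G d (?\<Theta> z))"
      using P.det_transform[OF z] by simp
    then show ?thesis by (simp add: chart_density_def real_sqrt_mult)
  qed
  have meas: "(\<lambda>z. indicator (coord e ` (E \<inter> dom_of e)) z * chart_density e z) \<in> borel_measurable borel" if "e \<in> A" for e
  proof -
    have sp: "range_of e \<inter> space borel \<in> sets borel" using range_sets[OF that] by simp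
    have "(\<lambda>z. indicator (range_of e) z *\<^sub>R chart_density e z) \<in> borel_measurable borel"
      using borel_measurable_continuous_on_restrict[OF Ck_on_continuous[OF Ck_chart_density[OF that]]]
      by (subst (asm) borel_measurable_restrict_space_iff[OF sp])
    then have "(\<lambda>z. indicator (coord e ` (E \<inter> dom_of e)) z * (indicator (range_of e) z *\<^sub>R chart_density e z)) \<in> borel_measurable borel"
      by (intro borel_measurable_times borel_measurable_indicator coord_image_borel[OF that E(1)])
    also have "(\<lambda>z. indicator (coord e ` (E \<inter> dom_of e)) z * (indicator (range_of e) z *\<^sub>R chart_density e z))
      = (\<lambda>z. indicator (coord e ` (E \<inter> dom_of e)) z * chart_density e z)"
      by (rule ext) (auto simp: indicator_def range_of_def)
    finally show ?thesis .
  qed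
  have em: "emeasure (chart_measure e) E = (\<integral>\<^sup>+z. ennreal (indicator (coord e ` (E \<inter> dom_of e)) z * chart_density e z) \<partial>lborel)"
    if "e \<in> A" for e
    unfolding emeasure_chart_measure[OF that E(1)]
    by (intro nn_integral_cong) (simp add: chart_density_def indicator_def)
  have ind: "indicator S z * (\<bar>det (matrix (\<Theta>' z))\<bar> * chart_density d (?\<Theta> z)) = indicator S z * chart_density c z" for z
    using dens by (auto simp: indicator_def)
  have "(\<integral>\<^sup>+z. ennreal (indicator S z * (\<bar>det (matrix (\<Theta>' z))\<bar> * chart_density d (?\<Theta> z))) \<partial>lborel)
    = (\<integral>\<^sup>+y. ennreal (indicator (?\<Theta> ` S) y * chart_density d y) \<partial>lborel)"
  proof (rule nn_integral_change_of_variables[OF S der inj])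
    show "0 \<le> chart_density d (?\<Theta> x)" if "x \<in> S" for x
      using chart_density_pos[OF d, of "?\<Theta> x"] that SU P.maps by fastforce
    show "(\<lambda>y. indicator (?\<Theta> ` S) y * chart_density d y) \<in> borel_measurable borel"
      using meas[OF d] by (simp add: \<Theta>S)
    show "(\<lambda>x. indicator S x * (\<bar>det (matrix (\<Theta>' x))\<bar> * chart_density d (?\<Theta> x))) \<in> borel_measurable borel"
      using meas[OF c] by (simp add: ind S_def[symmetric])
  qed
  then show ?thesis unfolding em[OF c] em[OF d] ind \<Theta>S by (simp add: S_def)
qed

definition is_area :: "'p measure \<Rightarrow> bool" where
  "is_area \<mu> \<longleftrightarrow> sets \<mu> = sets BM \<and>
     (\<forall>c\<in>A. \<forall>E\<in>sets \<mu>. E \<subseteq> dom_of c \<longrightarrow> emeasure \<mu> E = emeasure (chart_measure c) E)"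

lemma area_measure_eq: "area_measure M A g = (THE \<mu>. is_area \<mu>)"
proof -
  have "is_area \<mu> \<longleftrightarrow> sets \<mu> = sets BM \<and> (\<forall>c\<in>A. \<forall>E\<in>sets \<mu>. E \<subseteq> dom_of c \<longrightarrow>
           emeasure \<mu> E =
             (\<integral>\<^sup>+z. ennreal (sqrt (det (g c (param c z)))) * indicator (coord c ` E) z \<partial>lborel))" for \<mu>
  proof -
    have 1: "emeasure (chart_measure c) E =
        (\<integral>\<^sup>+z. ennreal (sqrt (det (g c (param c z)))) * indicator (coord c ` E) z \<partial>lborel)"
      if "c \<in> A" "E \<in> sets BM" "E \<subseteq> dom_of c" for c E
      using emeasure_chart_measure[OF that(1,2)] inf.absorb1[OF that(3)] by simp
    show ?thesis unfolding is_area_def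
      by (intro conj_cong refl ball_cong imp_cong) (simp add: 1)
  qed
  then show ?thesis by (simp add: area_measure_def)
qed

text \<open>Compactness yields finitely many charts, and removing the earlier domains makes the
  pieces disjoint. They are in general no longer open, but Borel is enough for additivity.\<close>

lemma chart_partition:
  obtains n :: nat and cs :: "nat \<Rightarrow> 'p chart" and D :: "nat \<Rightarrow> 'p set"
  where "\<And>i. i < n \<Longrightarrow> cs i \<in> A" "\<And>i. i < n \<Longrightarrow> D i \<in> sets BM" "\<And>i. i < n \<Longrightarrow> D i \<subseteq> dom_of (cs i)"
    "disjoint_family_on D {..<n}" "(\<Union>i<n. D i) = M"
proof -
  have "\<forall>c. \<exists>T. c \<in> A \<longrightarrow> open T \<and> dom_of c = M \<inter> T"
    using dom_openin by (metis openin_open)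
  then obtain T where T: "\<And>c. c \<in> A \<Longrightarrow> open (T c)" "\<And>c. c \<in> A \<Longrightarrow> dom_of c = M \<inter> T c" by metis
  have "M \<subseteq> (\<Union>c\<in>A. T c)"
    using M_eq T(2) by blast
  then obtain C where C: "C \<subseteq> A" "finite C" "M \<subseteq> (\<Union>c\<in>C. T c)"
    using compactE_image[OF compact_M, of A T] T(1) by blast
  obtain n :: nat and cs where cs: "C = cs ` {i. i < n}"
    using C(2) finite_imp_nat_seg_image_inj_on by metis
  have csA: "cs i \<in> A" if "i < n" for i using that cs C by blast
  have cover: "(\<Union>i<n. dom_of (cs i)) = M"
  proof
    show "(\<Union>i<n. dom_of (cs i)) \<subseteq> M" using csA dom_subset by blast
    show "M \<subseteq> (\<Union>i<n. dom_of (cs i))" using C cs T by blast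
  qed
  define D where "D i = dom_of (cs i) - (\<Union>j<i. dom_of (cs j))" for i
  have D: "D i \<in> sets BM" if "i < n" for i
    unfolding D_def using csA dom_sets that by (intro sets.Diff sets.finite_UN) auto
  have "disjoint_family_on D {..<n}"
    unfolding disjoint_family_on_def D_def
  proof (intro ballI impI)
    fix i j :: nat assume "i \<noteq> j"
    then have "i < j \<or> j < i" by (rule nat_neq_iff[THEN iffD1])
    then show "(dom_of (cs i) - (\<Union>j<i. dom_of (cs j))) \<inter> (dom_of (cs j) - (\<Union>k<j. dom_of (cs k))) = {}" by blast
  qed
  moreover have "(\<Union>i<n. D i) = M"
  proof
    show "(\<Union>i<n. D i) \<subseteq> M" using cover by (auto simp: D_def)
    show "M \<subseteq> (\<Union>i<n. D i)"
    proof
      fix p assume "p \<in> M"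
      then have "\<exists>i. i < n \<and> p \<in> dom_of (cs i)" using cover by blast
      from exists_least_iff[THEN iffD1, OF this] obtain i where i: "i < n" "p \<in> dom_of (cs i)"
        "\<And>m. m < i \<Longrightarrow> \<not> (m < n \<and> p \<in> dom_of (cs m))" by blast
      then have "p \<in> D i" by (auto simp: D_def)
      then show "p \<in> (\<Union>i<n. D i)" using i(1) by blast
    qed
  qed
  ultimately show thesis using that[of n cs D] csA D by (auto simp: D_def)
qed

text \<open>Each piece of a partition lies in one chart, where the condition prescribes the measure;
  additivity does the rest.\<close>

lemma area_unique:
  assumes "is_area \<mu>" "is_area \<nu>" shows "\<mu> = \<nu>"
proof (rule measure_eqI)
  show "sets \<mu> = sets \<nu>" using assms by (simp add: is_area_def)
  fix E assume E: "E \<in> sets \<mu>"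
  obtain n :: nat and cs :: "nat \<Rightarrow> 'p chart" and D :: "nat \<Rightarrow> 'p set" where D: "\<And>i. i < n \<Longrightarrow> cs i \<in> A" "\<And>i. i < n \<Longrightarrow> D i \<in> sets BM" "\<And>i. i < n \<Longrightarrow> D i \<subseteq> dom_of (cs i)"
    "disjoint_family_on D {..<n}" "(\<Union>i<n. D i) = M" by (rule chart_partition, rule that)
  have "emeasure \<rho> E = (\<Sum>i<n. emeasure (chart_measure (cs i)) (E \<inter> D i))" if \<rho>: "is_area \<rho>" for \<rho>
  proof -
    have s: "sets \<rho> = sets BM" "E \<in> sets BM" using \<rho> E assms(1) by (auto simp: is_area_def)
    then have E': "E = (\<Union>i<n. E \<inter> D i)" using D(5) by (auto simp: sets_BM)
    have "emeasure \<rho> (\<Union>i<n. E \<inter> D i) = (\<Sum>i<n. emeasure \<rho> (E \<inter> D i))"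
      using D(2) s disjoint_family_on_Int[OF D(4), of E] by (intro sum_emeasure[symmetric]) auto
    also have "\<dots> = (\<Sum>i<n. emeasure (chart_measure (cs i)) (E \<inter> D i))"
    proof (rule sum.cong[OF refl])
      fix i assume "i \<in> {..<n}"
      then have i: "i < n" by simp
      have "E \<inter> D i \<in> sets \<rho>" "E \<inter> D i \<subseteq> dom_of (cs i)" using s D(2,3)[OF i] by auto
      then show "emeasure \<rho> (E \<inter> D i) = emeasure (chart_measure (cs i)) (E \<inter> D i)"
        using \<rho> D(1)[OF i] unfolding is_area_def by blast
    qed
    finally show ?thesis using E' by simp
  qed
  then show "emeasure \<mu> E = emeasure \<nu> E" using assms by metis
qed

text \<open>The sum of the chart measures over a partition is a measure. To check the prescribed
  value on a subset of some \<open>dom_of c\<close>, each summand is moved to the chart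
  \<open>c\<close> by \<open>chart_measure_overlap\<close>, and additivity in that chart reassembles
  the set.\<close>

lemma area_exists: "\<exists>\<mu>. is_area \<mu>"
proof -
  obtain n :: nat and cs :: "nat \<Rightarrow> 'p chart" and D :: "nat \<Rightarrow> 'p set" where D: "\<And>i. i < n \<Longrightarrow> cs i \<in> A" "\<And>i. i < n \<Longrightarrow> D i \<in> sets BM" "\<And>i. i < n \<Longrightarrow> D i \<subseteq> dom_of (cs i)"
    "disjoint_family_on D {..<n}" "(\<Union>i<n. D i) = M" by (rule chart_partition, rule that)
  define m where "m E = (\<Sum>i<n. emeasure (chart_measure (cs i)) (E \<inter> D i))" for E
  define \<mu> where "\<mu> = measure_of M (sets BM) m"
  have sa: "sigma_algebra M (sets BM)"
    using sets.sigma_algebra_axioms[of BM] by (simp add: space_restrict_space)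
  have [simp]: "sets \<mu> = sets BM"
    unfolding \<mu>_def using sigma_algebra.sets_measure_of_eq[OF sa] by simp
  have em: "emeasure \<mu> E = m E" if "E \<in> sets BM" for E
    unfolding \<mu>_def
  proof (rule emeasure_measure_of_sigma[OF sa _ _ that])
    show "positive (sets BM) m" by (simp add: positive_def m_def)
    show "countably_additive (sets BM) m"
    proof (rule countably_additiveI)
      fix F :: "nat \<Rightarrow> 'p set" assume F: "range F \<subseteq> sets BM" "disjoint_family F" "(\<Union>i. F i) \<in> sets BM"
      have "(\<Sum>k. m (F k)) = (\<Sum>i<n. \<Sum>k. emeasure (chart_measure (cs i)) (F k \<inter> D i))"
        unfolding m_def by (rule suminf_sum) simp
      also have "\<dots> = (\<Sum>i<n. emeasure (chart_measure (cs i)) (\<Union>k. F k \<inter> D i))"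
        using F D by (intro sum.cong refl suminf_emeasure) (auto simp: disjoint_family_on_def)
      also have "\<dots> = m (\<Union>k. F k)" by (simp add: m_def)
      finally show "(\<Sum>k. m (F k)) = m (\<Union>k. F k)" .
    qed
  qed
  have "is_area \<mu>"
    unfolding is_area_def
  proof (intro conjI ballI impI)
    fix c E assume c: "c \<in> A" and E: "E \<in> sets \<mu>" "E \<subseteq> dom_of c"
    have "emeasure \<mu> E = (\<Sum>i<n. emeasure (chart_measure (cs i)) (E \<inter> D i))"
      using em E by (simp add: m_def)
    also have "\<dots> = (\<Sum>i<n. emeasure (chart_measure c) (E \<inter> D i))"
    proof (rule sum.cong[OF refl])
      fix i assume "i \<in> {..<n}"
      then have i: "i < n" by simp
      have "E \<inter> D i \<in> sets BM" "E \<inter> D i \<subseteq> dom_of (cs i)" "E \<inter> D i \<subseteq> dom_of c" using E D(2,3)[OF i] by auto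
      then show "emeasure (chart_measure (cs i)) (E \<inter> D i) = emeasure (chart_measure c) (E \<inter> D i)"
        by (rule chart_measure_overlap[OF D(1)[OF i] c])
    qed
    also have "\<dots> = emeasure (chart_measure c) (\<Union>i<n. E \<inter> D i)"
      using D(2) E disjoint_family_on_Int[OF D(4), of E] by (intro sum_emeasure) auto
    also have "(\<Union>i<n. E \<inter> D i) = E" using E D(5) dom_subset[OF c] by auto
    finally show "emeasure \<mu> E = emeasure (chart_measure c) E" .
  qed simp
  then show ?thesis ..
qed

abbreviation area :: "'p measure" where "area \<equiv> area_measure M A g"

lemma is_area: "is_area area"
  unfolding area_measure_eq by (rule theI'[OF ex_ex1I[OF area_exists area_unique]])

lemma sets_area [simp]: "sets area = sets BM"
  using is_area by (simp add: is_area_def)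

lemma space_area [simp]: "space area = M"
  using sets_eq_imp_space_eq[OF sets_area] by (simp add: space_restrict_space)

lemma emeasure_area: "c \<in> A \<Longrightarrow> E \<in> sets BM \<Longrightarrow> E \<subseteq> dom_of c \<Longrightarrow> emeasure area E = emeasure (chart_measure c) E"
  using is_area unfolding is_area_def sets_area by blast

text \<open>Turns the area on a chart domain into a pushforward from the plane, so that integrals of
  functions vanishing outside the domain become Lebesgue integrals.\<close>

lemma chart_measure_eq_density:
  assumes c: "c \<in> A" shows "density area (indicator (dom_of c)) = chart_measure c"
proof (rule measure_eqI)
  show "sets (density area (indicator (dom_of c))) = sets (chart_measure c)" by simp
  fix E assume "E \<in> sets (density area (indicator (dom_of c)))"
  then have E: "E \<in> sets BM" by simp
  have "emeasure (density area (indicator (dom_of c))) E = emeasure area (dom_of c \<inter> E)"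
    using E dom_sets[OF c]
    by (subst emeasure_density) (auto simp: indicator_inter_arith[symmetric] intro!: borel_measurable_indicator)
  also have "\<dots> = emeasure (chart_measure c) (dom_of c \<inter> E)"
    using E dom_sets[OF c] by (intro emeasure_area[OF c]) auto
  also have "\<dots> = emeasure (chart_measure c) E"
  proof -
    have "dom_of c \<inter> E \<inter> dom_of c = E \<inter> dom_of c" by blast
    moreover have "dom_of c \<inter> E \<in> sets BM" using E dom_sets[OF c] by (rule sets.Int[rotated])
    ultimately show ?thesis using E by (simp add: emeasure_chart_measure[OF c])
  qed
  finally show "emeasure (density area (indicator (dom_of c))) E = emeasure (chart_measure c) E" .
qed

lemma integral_area_chart:
  fixes f :: "'p \<Rightarrow> real"
  assumes c: "c \<in> A" and f: "f \<in> borel_measurable BM" and supp: "\<And>p. p \<in> M \<Longrightarrow> p \<notin> dom_of c \<Longrightarrow> f p = 0"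
  shows "(LINT p|area. f p) = (LINT z|lborel. indicator (range_of c) z * (chart_density c z * f (param c z)))"
proof -
  let ?L = "restrict_space lborel (range_of c)"
  have sp: "range_of c \<inter> space lborel \<in> sets lborel" using range_sets[OF c] by simp
  have f': "f \<in> borel_measurable area" using f measurable_cong_sets[OF sets_area refl] by blast
  have dA: "(indicator (dom_of c) :: 'p \<Rightarrow> real) \<in> borel_measurable area"
    by (rule borel_measurable_indicator) (simp add: dom_sets[OF c])
  note pm = param_measurable[OF c] and cm = chart_density_measurable[OF c]
  have "(LINT p|area. f p) = (LINT p|area. indicator (dom_of c) p *\<^sub>R f p)"
    using supp by (intro Bochner_Integration.integral_cong) (auto simp: indicator_def)
  also have "\<dots> = (LINT p|density area (indicator (dom_of c)). f p)"
    using integral_density[OF f', of "indicator (dom_of c)"] dA by (simp add: ennreal_indicator)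
  also have "\<dots> = (LINT p|chart_measure c. f p)" by (simp add: chart_measure_eq_density[OF c])
  also have "\<dots> = (LINT z|density ?L (\<lambda>z. ennreal (chart_density c z)). f (param c z))"
    unfolding chart_measure_def using pm by (intro integral_distr f) auto
  also have "\<dots> = (LINT z|?L. chart_density c z *\<^sub>R f (param c z))"
    using cm measurable_compose[OF pm f] chart_density_pos[OF c]
    by (intro integral_density) (auto simp: space_restrict_space less_imp_le intro!: AE_I2)
  also have "\<dots> = (LINT z|lborel. indicator (range_of c) z *\<^sub>R (chart_density c z *\<^sub>R f (param c z)))"
    by (rule integral_restrict_space[OF sp])
  finally show ?thesis by simp
qed

end

section \<open>Green's identity\<close>

text \<open>The integrals of the difference quotients vanish by translation invariance.\<close>

lemma integral_pd_compact_support: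
  fixes X :: "real^2 \<Rightarrow> real"
  assumes X: "Ck_on 1 X UNIV" and K: "compact K" and supp: "\<And>z. z \<notin> K \<Longrightarrow> X z = 0"
  shows "integrable lborel (pd i X)" "(LINT z|lborel. pd i X z) = 0"
proof -
  define e :: "real^2" where "e = axis i 1"
  have ne: "norm e = 1" by (simp add: e_def)
  have dX: "X differentiable (at z)" for z using X by simp
  have cX: "continuous_on UNIV X" using Ck_on_continuous[OF X] .
  have cp: "continuous_on UNIV (pd i X)"
    using Ck_on_dderiv[of 0 X UNIV "axis i 1"] X by simp
  have p0: "pd i X z = 0" if "z \<notin> K" for z
  proof -
    have "pd i X z = pd i (\<lambda>z. 0) z"
      by (rule dderiv_cong_open[of "- K"]) (use K that supp compact_imp_closed in auto)
    then show ?thesis by (simp add: dderiv_const)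
  qed
  obtain B where B: "\<And>z. z \<in> K \<Longrightarrow> \<bar>pd i X z\<bar> \<le> B"
    using compact_imp_bounded[OF compact_continuous_image[OF continuous_on_subset[OF cp subset_UNIV] K]]
    by (auto simp: bounded_iff)
  have B': "\<bar>pd i X z\<bar> \<le> \<bar>B\<bar>" for z using B[of z] p0[of z] by (cases "z \<in> K") auto
  have int: "integrable lborel f" if "continuous_on UNIV f" "\<And>z. z \<notin> K \<Longrightarrow> f z = 0" for f :: "real^2 \<Rightarrow> real"
  proof -
    have "integrable lborel (\<lambda>x. indicator K x *\<^sub>R f x)"
      by (rule borel_integrable_compact[OF K continuous_on_subset[OF that(1) subset_UNIV]])
    also have "(\<lambda>x. indicator K x *\<^sub>R f x) = f" using that(2) by (intro ext) (auto simp: indicator_def)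
    finally show ?thesis .
  qed
  show "integrable lborel (pd i X)" using int[OF cp p0] .
  have iX: "integrable lborel X" by (rule int[OF cX]) (rule supp)
  obtain R where R: "\<And>z. z \<in> K \<Longrightarrow> norm z \<le> R"
    using compact_imp_bounded[OF K] by (auto simp: bounded_iff)
  define h where "h n = 1 / real (Suc n)" for n
  have h: "0 < h n" "h n \<le> 1" for n by (auto simp: h_def)
  define q where "q n z = (X (z + h n *\<^sub>R e) - X z) / h n" for n z
  have mX: "X \<in> borel_measurable lborel" using borel_measurable_continuous_onI[OF cX] by simp
  have mshift: "(\<lambda>z. X (z + v)) \<in> borel_measurable lborel" for v
    using borel_measurable_continuous_onI[OF continuous_on_compose2[OF cX, of UNIV "\<lambda>z. z + v"]]
    by (simp add: continuous_on_add continuous_on_id)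
  have shift: "(LINT z|lborel. X (z + v)) = (LINT z|lborel. X z)" "integrable lborel (\<lambda>z. X (z + v))" for v
  proof -
    have eq: "distr lborel borel ((+) v) = lborel" by (rule lborel_distr_plus)
    have "(LINT z|lborel. X z) = (LINT z|distr lborel borel ((+) v). X z)" by (simp only: eq)
    also have "\<dots> = (LINT z|lborel. X (v + z))" using mX by (intro integral_distr) auto
    finally show "(LINT z|lborel. X (z + v)) = (LINT z|lborel. X z)" by (simp add: add.commute)
    have "integrable (distr lborel borel ((+) v)) X" using iX by (simp only: eq)
    then have "integrable lborel (\<lambda>z. X (v + z))" using mX by (subst (asm) integrable_distr_eq) auto
    then show "integrable lborel (\<lambda>z. X (z + v))" by (simp add: add.commute)
  qed
  have q0: "(LINT z|lborel. q n z) = 0" for n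
    unfolding q_def using shift iX by simp
  \<comment> \<open>The mean value theorem bounds the quotients by the bound on the derivative, and
    because \<open>h n \<le> 1\<close> they all vanish outside one ball of radius
    \<open>R + 1\<close>: a single integrable majorant.\<close>
  have bound: "\<bar>q n z\<bar> \<le> \<bar>B\<bar> * indicator (cball 0 (R + 1)) z" for n z
  proof (cases "z \<in> cball 0 (R + 1)")
    case True
    have "((\<lambda>a. X (z + a *\<^sub>R e)) has_real_derivative pd i X (z + a *\<^sub>R e)) (at a)" for a
      unfolding e_def by (rule has_real_derivative_line[OF dX])
    then obtain a where "X (z + h n *\<^sub>R e) - X (z + 0 *\<^sub>R e) = (h n - 0) * pd i X (z + a *\<^sub>R e)"
      using MVT2[OF h(1)[of n], of "\<lambda>a. X (z + a *\<^sub>R e)" "\<lambda>a. pd i X (z + a *\<^sub>R e)"] by blast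
    then have "q n z = pd i X (z + a *\<^sub>R e)" using h(1)[of n] by (simp add: q_def)
    then show ?thesis using True B' by simp
  next
    case False
    then have n: "norm z > R + 1" by simp
    have "norm (z + h n *\<^sub>R e) > R"
      using norm_triangle_ineq4[of "z + h n *\<^sub>R e" "h n *\<^sub>R e"] n h[of n] ne by simp
    then have "z + h n *\<^sub>R e \<notin> K" "z \<notin> K" using R n by fastforce+
    then show ?thesis using supp by (simp add: q_def)
  qed
  have lim: "(\<lambda>n. q n z) \<longlonglongrightarrow> pd i X z" for z
  proof -
    have "((\<lambda>a. X (z + a *\<^sub>R e)) has_real_derivative pd i X (z + 0 *\<^sub>R e)) (at 0)"
      unfolding e_def by (rule has_real_derivative_line[OF dX])
    then have "((\<lambda>a. (X (z + a *\<^sub>R e) - X z) / a) \<longlongrightarrow> pd i X z) (at 0)"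
      by (simp add: DERIV_def)
    moreover have "filterlim h (at 0) sequentially"
      unfolding filterlim_at using h LIMSEQ_Suc[OF lim_inverse_n'] by (auto simp: h_def[abs_def])
    ultimately show ?thesis unfolding q_def by (rule filterlim_compose)
  qed
  have "(\<lambda>n. LINT z|lborel. q n z) \<longlonglongrightarrow> (LINT z|lborel. pd i X z)"
  proof (rule integral_dominated_convergence[where w = "\<lambda>z. \<bar>B\<bar> * indicator (cball 0 (R + 1)) z"])
    show "pd i X \<in> borel_measurable lborel" using borel_measurable_continuous_onI[OF cp] by simp
    show "q n \<in> borel_measurable lborel" for n
      unfolding q_def using mX mshift by (intro borel_measurable_divide borel_measurable_diff) auto
    show "integrable lborel (\<lambda>z::real^2. \<bar>B\<bar> * indicator (cball 0 (R + 1)) z)"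
      using emeasure_compact_finite[of "cball (0::real^2) (R + 1)"]
      by (intro integrable_mult_right integrable_real_indicator) auto
  qed (use lim bound in auto)
  then show "(LINT z|lborel. pd i X z) = 0"
    by (simp add: q0 LIMSEQ_const_iff)
qed

text \<open>Extension by zero is C^1 on the whole plane: on \<open>S\<close> it equals
  \<open>X\<close>, on the complement of \<open>K\<close> it vanishes, and these two open sets cover
  everything.\<close>

lemma integral_pd_compact_support_open:
  fixes X :: "real^2 \<Rightarrow> real"
  assumes S: "open S" and X: "Ck_on 1 X S" and K: "compact K" "K \<subseteq> S"
    and supp: "\<And>z. z \<in> S \<Longrightarrow> z \<notin> K \<Longrightarrow> X z = 0"
  shows "integrable lborel (\<lambda>z. indicator S z * pd i X z)" "(LINT z|lborel. indicator S z * pd i X z) = 0"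
proof -
  define Y where "Y z = (if z \<in> S then X z else 0)" for z
  have oK: "open (- K)" using compact_imp_closed[OF K(1)] by blast
  have YS: "Ck_on 1 Y S" using X by (subst Ck_on_cong[OF S, of Y X]) (auto simp: Y_def)
  have "Ck_on 1 Y (- K)"
    by (subst Ck_on_cong[OF oK, of Y "\<lambda>z. 0"]) (auto simp: Y_def supp Ck_on_const simp del: Ck_on.simps One_nat_def)
  then have "Ck_on 1 Y (S \<union> - K)" by (rule Ck_on_open_Un[OF S oK YS])
  moreover have "S \<union> - K = UNIV" using K(2) by blast
  ultimately have Y: "Ck_on 1 Y UNIV" by simp
  have "Y z = 0" if "z \<notin> K" for z using supp that by (auto simp: Y_def)
  note * = integral_pd_compact_support[OF Y K(1) this]
  have "indicator S z * pd i X z = pd i Y z" for z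
  proof (cases "z \<in> S")
    case True
    then show ?thesis using dderiv_cong_open[OF S True, of Y X] by (simp add: Y_def)
  next
    case False
    then have "z \<in> - K" using K(2) by auto
    then have "pd i Y z = pd i (\<lambda>z. 0) z"
      using oK supp by (intro dderiv_cong_open[of "- K"]) (auto simp: Y_def)
    then show ?thesis using False by (simp add: dderiv_const)
  qed
  then show "integrable lborel (\<lambda>z. indicator S z * pd i X z)" "(LINT z|lborel. indicator S z * pd i X z) = 0"
    using * by simp_all
qed

lemma dderiv_sqrt:
  fixes f :: "'v::real_normed_vector \<Rightarrow> real"
  assumes "f differentiable (at x)" "f x > 0"
  shows "dderiv v (\<lambda>x. sqrt (f x)) x = dderiv v f x / (2 * sqrt (f x))"
  unfolding dderiv_eq[OF has_derivative_real_sqrt[OF assms(2) dderiv_works[OF assms(1)]]]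
  by (simp add: field_simps)

lemma has_real_derivative_pos_part_square:
  "((\<lambda>t::real. (max 0 t)\<^sup>2) has_real_derivative 2 * max 0 t) (at t)"
proof (cases t "0::real" rule: linorder_cases)
  case less
  have "((\<lambda>t::real. 0) has_real_derivative 2 * max 0 t) (at t)" using less by simp
  then show ?thesis
    by (rule DERIV_cong_ev[THEN iffD1, rotated 3])
      (use less in \<open>auto intro!: eventually_mono[OF eventually_nhds_in_open[of "{..<0}" t]]\<close>)
next
  case greater
  have "((\<lambda>t::real. t\<^sup>2) has_real_derivative 2 * max 0 t) (at t)"
    using greater by (auto intro!: derivative_eq_intros)
  then show ?thesis
    by (rule DERIV_cong_ev[THEN iffD1, rotated 3])
      (use greater in \<open>auto intro!: eventually_mono[OF eventually_nhds_in_open[of "{0<..}" t]]\<close>)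
next
  case equal
  \<comment> \<open>At the kink the difference quotient is bounded by the absolute value of
    \<open>h\<close>.\<close>
  have "((\<lambda>h::real. ((max 0 h)\<^sup>2 - 0) / h) \<longlongrightarrow> 0) (at 0)"
  proof (rule Lim_null_comparison[where g="\<lambda>h. \<bar>h\<bar>"])
    show "\<forall>\<^sub>F h in at 0. norm (((max 0 h)\<^sup>2 - 0) / h) \<le> \<bar>h::real\<bar>"
      by (rule always_eventually) (auto simp: max_def power2_eq_square)
  qed (auto intro!: tendsto_eq_intros)
  then show ?thesis using equal by (simp add: DERIV_def)
qed

text \<open>A bump function of class \<open>C\<^sup>1\<close> is enough for integration by parts.\<close>

definition bump :: "real^2 \<Rightarrow> real \<Rightarrow> real^2 \<Rightarrow> real" where
  "bump z0 r z = (max 0 (r\<^sup>2 - (z - z0) \<bullet> (z - z0)))\<^sup>2"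

lemma Ck_bump: "Ck_on 1 (bump z0 r) UNIV"
proof -
  have "Ck_on (Suc 0) (\<lambda>t::real. (max 0 t)\<^sup>2) UNIV"
  proof (rule Ck_on_SucI[where f'="\<lambda>v t. 2 * max 0 t * v"])
    show "((\<lambda>t::real. (max 0 t)\<^sup>2) has_derivative (\<lambda>v. 2 * max 0 t * v)) (at t)" for t
      using has_real_derivative_pos_part_square[of t] by (simp add: has_field_derivative_def)
    show "Ck_on 0 (\<lambda>t::real. 2 * max 0 t * v) UNIV" for v
      by (auto intro!: continuous_intros)
  qed auto
  moreover have "Ck_on 1 (\<lambda>z. r\<^sup>2 - (z - z0) \<bullet> (z - z0)) UNIV"
    by (intro Ck_on_diff bounded_bilinear.Ck_on_prod[OF bounded_bilinear_inner] Ck_on_const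
        Ck_on_bounded_linear bounded_linear_ident open_UNIV)
  ultimately show ?thesis unfolding bump_def[abs_def]
    using Ck_on_compose[OF open_UNIV open_UNIV subset_UNIV, of 1 "\<lambda>z. r\<^sup>2 - (z - z0) \<bullet> (z - z0)" "\<lambda>t. (max 0 t)\<^sup>2"]
    by simp
qed

lemma bump_pos: "0 < r \<Longrightarrow> z \<in> ball z0 r \<Longrightarrow> bump z0 r z > 0"
proof -
  assume "0 < r" "z \<in> ball z0 r"
  then have "(dist z z0)\<^sup>2 < r\<^sup>2" by (intro power_strict_mono) (auto simp: dist_commute)
  then show ?thesis by (simp add: bump_def dist_norm power2_norm_eq_inner)
qed

lemma bump_zero: "0 < r \<Longrightarrow> z \<notin> cball z0 r \<Longrightarrow> bump z0 r z = 0"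
proof -
  assume "0 < r" "z \<notin> cball z0 r"
  then have "r\<^sup>2 \<le> (dist z z0)\<^sup>2" by (intro power_mono) (auto simp: dist_commute)
  then show ?thesis by (simp add: bump_def dist_norm power2_norm_eq_inner)
qed

lemma bump_nonneg: "bump z0 r z \<ge> 0"
  by (simp add: bump_def)

context plane_metric
begin

text \<open>The bracket is the divergence of \<open>\<phi>\<close> times the gradient of
  \<open>a\<close>. The square root of the determinant times the inverse metric is the adjugate over
  that square root, which explains the quotients on the right.\<close>

lemma divergence_form:
  assumes z: "z \<in> S" and \<phi>: "\<phi> differentiable (at z)" and a: "smooth_on a S"
  shows "sqrt (det (G z)) * (pgrad G \<phi> a z + \<phi> z * plap G a z) =
    pd 1 (\<lambda>z. \<phi> z * ((G z$2$2 * pd 1 a z - G z$1$2 * pd 2 a z) / sqrt (det (G z)))) z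
    + pd 2 (\<lambda>z. \<phi> z * ((G z$1$1 * pd 2 a z - G z$1$2 * pd 1 a z) / sqrt (det (G z)))) z"
proof -
  note dG = diff_G[OF z]
  have dD: "(\<lambda>z. det (G z)) differentiable (at z)" by (rule smooth_on_differentiable[OF smooth_det z])
  have D: "det (G z) > 0" by (rule det_G[OF z])
  \<comment> \<open>Writing the determinant as \<open>P * P\<close> makes the final identity
    rational in \<open>P\<close>.\<close>
  define P where "P = sqrt (det (G z))"
  have P: "P > 0" "det (G z) = P * P" using D by (simp_all add: P_def)
  have dP: "(\<lambda>z. sqrt (det (G z))) differentiable (at z)"
    using has_derivative_real_sqrt[OF D dderiv_works[OF dD]] by (auto simp: differentiable_def)
  have da: "pd i a differentiable (at z)" for i
    by (rule smooth_on_differentiable[OF smooth_on_dderiv[OF a] z])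
  have c: "pd 2 (pd 1 a) z = pd 1 (pd 2 a) z" by (rule dderiv_commute[OF S a z])
  have dP1: "pd i (\<lambda>z. sqrt (det (G z))) z = pd i (\<lambda>z. det (G z)) z / (2 * P)" for i
    using dderiv_sqrt[OF dD D] by (simp add: P_def)
  have prod: "pd i (\<lambda>z. \<phi> z * ((f z * p z - h z * q z) / sqrt (det (G z)))) z =
     pd i \<phi> z * ((f z * p z - h z * q z) / P) + \<phi> z * (((pd i f z * p z + f z * pd i p z - pd i h z * q z - h z * pd i q z) * P
       - (f z * p z - h z * q z) * (pd i (\<lambda>z. det (G z)) z / (2 * P))) / P\<^sup>2)"
    if "f differentiable (at z)" "p differentiable (at z)" "h differentiable (at z)" "q differentiable (at z)" for i f p h q
  proof -
    have n: "(\<lambda>z. f z * p z - h z * q z) differentiable (at z)" using that by simp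
    have "(\<lambda>z. (f z * p z - h z * q z) / sqrt (det (G z))) differentiable (at z)"
      using n dP D by (intro differentiable_divide) auto
    moreover have "pd i (\<lambda>z. f z * p z - h z * q z) z = pd i f z * p z + f z * pd i p z - pd i h z * q z - h z * pd i q z"
      using that by (simp add: dderiv_diff dderiv_mult)
    moreover have nz: "sqrt (det (G z)) \<noteq> 0" using D by simp
    ultimately show ?thesis
      by (simp only: dderiv_mult[OF \<phi>] dderiv_divide[OF n dP nz] dP1 P_def)
  qed
  show ?thesis
    unfolding prod[OF dG da dG da] pgrad_eq[OF z] plap_def c P_def[symmetric]
    using P(1) unfolding P(2) by (simp add: field_simps power2_eq_square)
qed

end

section \<open>Finite covers by coordinate balls and cut-off functions\<close>

context surface
begin

lemma continuous_on_M:
  fixes f :: "'p \<Rightarrow> 'b::topological_space"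
  assumes "\<And>c. c \<in> A \<Longrightarrow> continuous_on (range_of c) (\<lambda>z. f (param c z))"
  shows "continuous_on M f"
proof -
  have "continuous (at p within M) f" if p: "p \<in> M" for p
  proof -
    obtain c where c: "c \<in> A" "p \<in> dom_of c" using chart_at[OF p] by (rule that)
    obtain T where T: "open T" "dom_of c = M \<inter> T" using dom_openin[OF c(1)] by (auto simp: openin_open)
    have "continuous_on (dom_of c) (\<lambda>p. f (param c (coord c p)))"
      by (rule continuous_on_compose2[OF assms[OF c(1)] continuous_coord[OF c(1)]]) (simp add: range_of_def)
    then have "continuous_on (dom_of c) f"
      by (rule continuous_on_eq) (simp add: param_coord[OF c(1)])
    then have "continuous (at p within dom_of c) f"
      using c(2) by (simp add: continuous_on_eq_continuous_within)
    moreover have "at p within dom_of c = at p within M"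
      using T c(2) by (intro at_within_nhd[of p T]) auto
    ultimately show ?thesis by simp
  qed
  then show ?thesis by (simp add: continuous_on_eq_continuous_within)
qed

lemma smooth_continuous: "f \<in> smooth_functions A \<Longrightarrow> continuous_on M f"
  by (rule continuous_on_M) (rule smooth_on_continuous[OF smooth_functionsD])

lemma param_image_openin:
  assumes c: "c \<in> A" and U: "open U" "U \<subseteq> range_of c"
  shows "openin (top_of_set M) (param c ` U)"
proof -
  have "openin (top_of_set (range_of c)) U" using U by (meson open_subset)
  then have "openin (top_of_set (dom_of c)) (param c ` U)"
    using homeomorphism_imp_open_map[OF homeomorphism_symD[OF homeo[OF c]]] by blast
  then show ?thesis using dom_openin[OF c] openin_trans by blast
qed

text \<open>The bumps will be positive on the open balls, whose images cover \<open>M\<close>, and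
  vanish off the closed balls, which are compact subsets of the chart ranges.\<close>

lemma ball_cover:
  obtains I :: "('p chart \<times> (real^2) \<times> real) set"
  where "finite I" "\<And>c z r. (c, z, r) \<in> I \<Longrightarrow> c \<in> A \<and> 0 < r \<and> cball z r \<subseteq> range_of c"
    "\<And>p. p \<in> M \<Longrightarrow> \<exists>c z r. (c, z, r) \<in> I \<and> p \<in> param c ` ball z r"
proof -
  define J :: "('p chart \<times> (real^2) \<times> real) set" where "J = {(c, z, r). c \<in> A \<and> 0 < r \<and> cball z r \<subseteq> range_of c}"
  define U :: "'p chart \<times> (real^2) \<times> real \<Rightarrow> 'p set" where "U = (\<lambda>(c, z, r). param c ` ball z r)"
  have "\<exists>T. open T \<and> U j = M \<inter> T" if "j \<in> J" for j
  proof -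
    obtain c z r where j': "j = (c, z, r)" by (cases j) auto
    then have j: "j = (c, z, r)" "c \<in> A" "cball z r \<subseteq> range_of c" using that by (simp_all add: J_def)
    then have "ball z r \<subseteq> range_of c" using ball_subset_cball by blast
    then show ?thesis using param_image_openin[OF j(2) open_ball] by (simp add: U_def j(1) openin_open)
  qed
  then obtain T where T: "\<And>j. j \<in> J \<Longrightarrow> open (T j)" "\<And>j. j \<in> J \<Longrightarrow> U j = M \<inter> T j" by metis
  have cov: "\<exists>j\<in>J. p \<in> U j" if p: "p \<in> M" for p
  proof -
    obtain c where c: "c \<in> A" "p \<in> dom_of c" using chart_at[OF p] by (rule that)
    obtain r where r: "0 < r" "cball (coord c p) r \<subseteq> range_of c"
      using open_contains_cball open_range[OF c(1)] coord_in[OF c(2)] by blast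
    have "p \<in> U (c, coord c p, r)"
      unfolding U_def using r(1) param_coord[OF c] by (auto intro!: rev_image_eqI[of "coord c p"])
    moreover have "(c, coord c p, r) \<in> J" using c r by (simp add: J_def)
    ultimately show ?thesis by blast
  qed
  then have "M \<subseteq> (\<Union>j\<in>J. T j)" using T(2) by blast
  then obtain I where I: "I \<subseteq> J" "finite I" "M \<subseteq> (\<Union>j\<in>I. T j)"
    using compactE_image[OF compact_M, of J T] T(1) by blast
  show thesis
  proof (rule that[of I])
    show "finite I" by (rule I(2))
    show "c \<in> A \<and> 0 < r \<and> cball z r \<subseteq> range_of c" if "(c, z, r) \<in> I" for c z r
      using that I(1) by (auto simp: J_def)
    fix p assume p: "p \<in> M"
    then obtain j where j: "j \<in> I" "p \<in> T j" using I(3) by blast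
    then have "p \<in> U j" using T(2)[of j] I(1) p by blast
    obtain c z r where "j = (c, z, r)" by (cases j) auto
    then have "(c, z, r) \<in> I" "p \<in> param c ` ball z r" using \<open>p \<in> U j\<close> j(1) by (simp_all add: U_def)
    then show "\<exists>c z r. (c, z, r) \<in> I \<and> p \<in> param c ` ball z r" by blast
  qed
qed

definition chart_bump :: "'p chart \<times> (real^2) \<times> real \<Rightarrow> 'p \<Rightarrow> real" where
  "chart_bump j p = (case j of (c, z, r) \<Rightarrow> if p \<in> dom_of c then bump z r (coord c p) else 0)"

lemma chart_bump_support:
  assumes c: "c \<in> A" and r: "0 < r" "cball z r \<subseteq> range_of c"
  shows "compact (param c ` cball z r)" "param c ` cball z r \<subseteq> dom_of c"
    "\<And>p. p \<notin> param c ` cball z r \<Longrightarrow> chart_bump (c, z, r) p = 0"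
proof -
  show "compact (param c ` cball z r)"
    by (rule compact_continuous_image[OF continuous_on_subset[OF continuous_param[OF c] r(2)] compact_cball])
  show "param c ` cball z r \<subseteq> dom_of c" using r(2) param_in[OF c] by blast
  fix p assume p: "p \<notin> param c ` cball z r"
  show "chart_bump (c, z, r) p = 0"
  proof (cases "p \<in> dom_of c")
    case True
    then have "coord c p \<notin> cball z r" using p param_coord[OF c True] by (metis imageI)
    then show ?thesis using bump_zero[OF r(1)] True by (simp add: chart_bump_def)
  qed (simp add: chart_bump_def)
qed

lemma open_off_compact:
  assumes d: "d \<in> A" and K: "compact K"
  shows "open {w \<in> range_of d. param d w \<notin> K}"
proof -
  have "open (range_of d \<inter> param d -` (- K))"
    by (rule continuous_open_preimage[OF continuous_param[OF d] open_range[OF d]])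
      (use compact_imp_closed[OF K] in blast)
  moreover have "range_of d \<inter> param d -` (- K) = {w \<in> range_of d. param d w \<notin> K}" by blast
  ultimately show ?thesis by simp
qed

text \<open>In another chart \<open>d\<close> two open regions suffice: the overlap, where the
  function is a bump after a smooth transition, and the preimage of the complement of the compact
  support, where it is zero. The second is open because compact sets are closed in a Hausdorff
  space.\<close>

lemma chart_bump_C1:
  assumes c: "c \<in> A" and r: "0 < r" "cball z r \<subseteq> range_of c"
  shows "chart_bump (c, z, r) \<in> C1_functions"
proof (rule C1_functionsI)
  fix d assume d: "d \<in> A"
  define K where "K = param c ` cball z r"
  note K = chart_bump_support[OF c r, folded K_def]
  define U where "U = coord d ` (dom_of d \<inter> dom_of c)"
  define V where "V = {w \<in> range_of d. param d w \<notin> K}"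
  have oU: "open U" unfolding U_def by (rule open_overlap[OF d c])
  have oV: "open V" unfolding V_def by (rule open_off_compact[OF d K(1)])
  have tr: "Ck_on 1 (\<lambda>w. coord c (param d w)) U"
    using smooth_on_Ck_on[OF smooth_transition[OF d c], of 1] unfolding U_def comp_def .
  have "Ck_on 1 (\<lambda>w. bump z r (coord c (param d w))) U"
    by (rule Ck_on_compose[OF oU open_UNIV subset_UNIV tr Ck_bump])
  then have CU: "Ck_on 1 (\<lambda>w. chart_bump (c, z, r) (param d w)) U"
    using overlap_in(2)[OF d c] by (subst Ck_on_cong[OF oU]) (auto simp: U_def chart_bump_def simp del: Ck_on.simps One_nat_def)
  have CV: "Ck_on 1 (\<lambda>w. chart_bump (c, z, r) (param d w)) V"
    by (subst Ck_on_cong[OF oV, of _ "\<lambda>w. 0"]) (auto simp: V_def K Ck_on_const simp del: Ck_on.simps One_nat_def)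
  have "Ck_on 1 (\<lambda>w. chart_bump (c, z, r) (param d w)) (U \<union> V)"
    by (rule Ck_on_open_Un[OF oU oV CU CV])
  moreover have "U \<union> V = range_of d"
  proof -
    have "U \<subseteq> range_of d" by (auto simp: U_def range_of_def)
    moreover have "w \<in> U" if "w \<in> range_of d" "param d w \<in> K" for w
    proof -
      have "param d w \<in> dom_of d \<inter> dom_of c" using that K(2) param_in[OF d] by blast
      then have "coord d (param d w) \<in> U" unfolding U_def by blast
      then show ?thesis using coord_param[OF d that(1)] by simp
    qed
    ultimately show ?thesis by (auto simp: V_def)
  qed
  ultimately show "Ck_on 1 (\<lambda>w. chart_bump (c, z, r) (param d w)) (range_of d)" by simp
qed

end

lemma (in plane_metric) continuous_pgrad:
  assumes "Ck_on 1 \<phi> S" "Ck_on 1 a S"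
  shows "continuous_on S (pgrad G \<phi> a)"
  unfolding pgrad_def[abs_def] sum_2
  using Ck_on_continuous[OF Ck_on_dderiv[of 0 \<phi> S]] Ck_on_continuous[OF Ck_on_dderiv[of 0 a S]] assms
  by (intro continuous_on_add continuous_on_mult smooth_on_continuous[OF smooth_inv]) (simp_all only: One_nat_def)

section \<open>The divergence theorem on the surface\<close>

context metric_surface
begin

text \<open>Finitely many coordinate balls cover \<open>M\<close>, and on each closed ball the
  density is continuous, hence bounded.\<close>

lemma area_finite: "finite_measure area"
proof (rule finite_measureI)
  obtain I where I: "finite I" "\<And>c z r. (c, z, r) \<in> I \<Longrightarrow> c \<in> A \<and> 0 < r \<and> cball z r \<subseteq> range_of c"
    "\<And>p. p \<in> M \<Longrightarrow> \<exists>c z r. (c, z, r) \<in> I \<and> p \<in> param c ` ball z r" by (rule ball_cover, rule that)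
  define U :: "'p chart \<times> (real^2) \<times> real \<Rightarrow> 'p set" where "U = (\<lambda>(c, z, r). param c ` ball z r)"
  have U: "U j \<in> sets BM \<and> emeasure area (U j) < \<infinity>" if jI: "j \<in> I" for j
  proof -
    obtain c z r where j: "j = (c, z, r)" by (cases j) auto
    have c: "c \<in> A" and r: "cball z r \<subseteq> range_of c" using I(2)[of c z r] jI j by auto
    have b: "ball z r \<subseteq> range_of c" using r ball_subset_cball by blast
    have "openin (top_of_set M) (param c ` ball z r)" by (rule param_image_openin[OF c open_ball b])
    then have s: "param c ` ball z r \<in> sets BM" by (auto simp: openin_open sets_BM)
    have sub: "param c ` ball z r \<subseteq> dom_of c" using b param_in[OF c] by blast
    have im: "coord c ` (param c ` ball z r) = ball z r"
      using b coord_param[OF c] by (force simp: image_image)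
    obtain B where "\<forall>y\<in>cball z r. \<bar>chart_density c y\<bar> \<le> B"
      using compact_imp_bounded[OF compact_continuous_image[OF continuous_on_subset[OF Ck_on_continuous[OF Ck_chart_density[OF c, of 0]] r] compact_cball]]
      by (auto simp: bounded_iff)
    then have B: "\<And>y. y \<in> cball z r \<Longrightarrow> \<bar>chart_density c y\<bar> \<le> B" by blast
    have "emeasure area (param c ` ball z r) =
        (\<integral>\<^sup>+y. ennreal (sqrt (det (g c (param c y)))) * indicator (ball z r) y \<partial>lborel)"
      using emeasure_area[OF c s sub] emeasure_chart_measure[OF c s] sub im by (simp add: inf.absorb1)
    also have "\<dots> \<le> (\<integral>\<^sup>+y. ennreal B * indicator (cball z r) y \<partial>lborel)"
    proof (rule nn_integral_mono)
      fix y
      show "ennreal (sqrt (det (g c (param c y)))) * indicator (ball z r) y \<le> ennreal B * indicator (cball z r) y"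
      proof (cases "y \<in> ball z r")
        case True
        then have "y \<in> cball z r" by simp
        then show ?thesis using B[of y] True by (auto simp: chart_density_def intro!: ennreal_leI)
      qed simp
    qed
    also have "\<dots> = ennreal B * emeasure lborel (cball z r)" by (rule nn_integral_cmult_indicator) simp
    also have "\<dots> < \<infinity>" using emeasure_compact_finite[of "cball z r"] by (simp add: ennreal_mult_less_top)
    finally show ?thesis using s j by (simp add: U_def)
  qed
  have cov: "M \<subseteq> (\<Union>j\<in>I. U j)" using I(3) unfolding U_def by blast
  have "emeasure area (space area) \<le> emeasure area (\<Union>j\<in>I. U j)"
    using U I(1) cov by (intro emeasure_mono sets.finite_UN) auto
  also have "\<dots> \<le> (\<Sum>j\<in>I. emeasure area (U j))"
    using U I(1) by (intro emeasure_subadditive_finite) auto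
  also have "\<dots> < \<infinity>" using U I(1) by (simp add: less_top[symmetric])
  finally show "emeasure area (space area) \<noteq> \<infinity>" by simp
qed

lemma measurable_continuous: "continuous_on M f \<Longrightarrow> (f :: 'p \<Rightarrow> real) \<in> borel_measurable BM"
  by (rule borel_measurable_continuous_on_restrict)

lemma integrable_continuous:
  assumes f: "continuous_on M (f :: 'p \<Rightarrow> real)" shows "integrable area f"
proof -
  obtain B where B: "\<And>p. p \<in> M \<Longrightarrow> norm (f p) \<le> B"
    using compact_imp_bounded[OF compact_continuous_image[OF f compact_M]] by (auto simp: bounded_iff)
  have "f \<in> borel_measurable area"
    using measurable_continuous[OF f] measurable_cong_sets[OF sets_area refl] by blast
  then show ?thesis
    using B by (intro finite_measure.integrable_const_bound[OF area_finite, of _ B]) (auto intro!: AE_I2)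
qed

text \<open>By the product rule this is the divergence of \<open>f\<close> times the gradient of
  \<open>a\<close>.\<close>

definition green :: "('p \<Rightarrow> real) \<Rightarrow> ('p \<Rightarrow> real) \<Rightarrow> 'p \<Rightarrow> real" where
  "green f a p = grad_inner A g f a p + f p * laplacian a p"

lemma green_chart:
  assumes f: "f \<in> C1_functions" and a: "a \<in> smooth_functions A" and c: "c \<in> A" and z: "z \<in> range_of c"
  shows "green f a (param c z) = pgrad (G c) (\<lambda>z. f (param c z)) (\<lambda>z. a (param c z)) z
    + f (param c z) * plap (G c) (\<lambda>z. a (param c z)) z"
  using grad_inner_eq[OF c param_in[OF c z] f smooth_C1[OF a]] laplacian_eq[OF a c param_in[OF c z]]
  by (simp add: green_def coord_param[OF c z])

lemma continuous_green:
  assumes f: "f \<in> C1_functions" and a: "a \<in> smooth_functions A"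
  shows "continuous_on M (green f a)"
proof (rule continuous_on_M)
  fix c assume c: "c \<in> A"
  interpret plane_metric "G c" "range_of c" by (rule plane_metric_chart[OF c])
  have "continuous_on (range_of c) (\<lambda>z. pgrad (G c) (\<lambda>z. f (param c z)) (\<lambda>z. a (param c z)) z
    + f (param c z) * plap (G c) (\<lambda>z. a (param c z)) z)"
    by (intro continuous_on_add continuous_on_mult continuous_pgrad smooth_on_continuous[OF smooth_plap]
        smooth_functionsD[OF a c] C1_functionsD[OF f c] C1_functionsD[OF smooth_C1[OF a] c]
        Ck_on_continuous[OF C1_functionsD[OF f c]])
  then show "continuous_on (range_of c) (\<lambda>z. green f a (param c z))"
    by (rule continuous_on_eq) (simp add: green_chart[OF f a c])
qed

text \<open>With the support inside one chart, the integral becomes that of a Euclidean divergence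
  with compact support.\<close>

lemma green_local:
  assumes f: "f \<in> C1_functions" and a: "a \<in> smooth_functions A"
    and c: "c \<in> A" and r: "0 < r" "cball z r \<subseteq> range_of c"
    and supp: "\<And>p. p \<in> M \<Longrightarrow> p \<notin> param c ` cball z r \<Longrightarrow> f p = 0"
  shows "(LINT p|area. green f a p) = 0"
proof -
  note K = chart_bump_support(1,2)[OF c r]
  interpret plane_metric "G c" "range_of c" by (rule plane_metric_chart[OF c])
  define \<phi> \<alpha> where "\<phi> = (\<lambda>z. f (param c z))" and "\<alpha> = (\<lambda>z. a (param c z))"
  have sa: "smooth_on \<alpha> (range_of c)" unfolding \<alpha>_def by (rule smooth_functionsD[OF a c])
  have C\<phi>: "Ck_on 1 \<phi> (range_of c)" unfolding \<phi>_def by (rule C1_functionsD[OF f c])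
  define X1 X2 where "X1 = (\<lambda>z. \<phi> z * ((G c z$2$2 * pd 1 \<alpha> z - G c z$1$2 * pd 2 \<alpha> z) / sqrt (det (G c z))))"
    and "X2 = (\<lambda>z. \<phi> z * ((G c z$1$1 * pd 2 \<alpha> z - G c z$1$2 * pd 1 \<alpha> z) / sqrt (det (G c z))))"
  have Csq: "Ck_on 1 (\<lambda>z. sqrt (det (G c z))) (range_of c)"
    by (rule Ck_on_sqrt[OF S smooth_on_Ck_on[OF smooth_det] det_G])
  have X: "Ck_on 1 X1 (range_of c)" "Ck_on 1 X2 (range_of c)"
    unfolding X1_def X2_def using det_G
    by (intro Ck_on_mult Ck_on_divide Ck_on_diff S C\<phi> Csq smooth_on_Ck_on[OF smooth_G]
        smooth_on_Ck_on[OF smooth_on_dderiv[OF sa]]; simp; fastforce)+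
  have X0: "X1 y = 0" "X2 y = 0" if "y \<in> range_of c" "y \<notin> cball z r" for y
  proof -
    have "param c y \<notin> param c ` cball z r"
    proof
      assume "param c y \<in> param c ` cball z r"
      then obtain x where "x \<in> cball z r" "param c y = param c x" by blast
      then have "y = x" using coord_param[OF c] that(1) r(2) by (metis subsetD)
      then show False using that(2) \<open>x \<in> cball z r\<close> by blast
    qed
    then have "\<phi> y = 0" using supp param_in_M[OF c that(1)] by (simp add: \<phi>_def)
    then show "X1 y = 0" "X2 y = 0" by (simp_all add: X1_def X2_def)
  qed
  note i1 = integral_pd_compact_support_open[OF S X(1) compact_cball r(2) X0(1), where i=1]
  note i2 = integral_pd_compact_support_open[OF S X(2) compact_cball r(2) X0(2), where i=2]
  \<comment> \<open>Outside the chart domain \<open>f\<close> vanishes on a whole neighbourhood, the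
    complement of a compact set, so its gradient vanishes there too; this licenses integrating in
    the single chart \<open>c\<close>.\<close>
  have out: "green f a p = 0" if p: "p \<in> M" "p \<notin> dom_of c" for p
  proof -
    obtain d where d: "d \<in> A" "p \<in> dom_of d" using chart_at[OF p(1)] by (rule that)
    define V where "V = {w \<in> range_of d. param d w \<notin> param c ` cball z r}"
    have V: "open V" unfolding V_def by (rule open_off_compact[OF d(1) K(1)])
    have pV: "coord d p \<in> V" using p K(2) coord_in[OF d(2)] param_coord[OF d] by (auto simp: V_def)
    have "pd i (\<lambda>z. f (param d z)) (coord d p) = pd i (\<lambda>z. 0) (coord d p)" for i
      by (rule dderiv_cong_open[OF V pV]) (use supp param_in_M[OF d(1)] in \<open>auto simp: V_def\<close>)
    moreover have "f p = 0" using supp p K(2) by blast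
    ultimately show ?thesis
      using green_chart[OF f a d(1) coord_in[OF d(2)]] by (simp add: param_coord[OF d] pgrad_def dderiv_const)
  qed
  have "(LINT p|area. green f a p) = (LINT z|lborel. indicator (range_of c) z * (chart_density c z * green f a (param c z)))"
    by (rule integral_area_chart[OF c measurable_continuous[OF continuous_green[OF f a]] out])
  also have "\<dots> = (LINT z|lborel. indicator (range_of c) z * pd 1 X1 z + indicator (range_of c) z * pd 2 X2 z)"
  proof (rule Bochner_Integration.integral_cong[OF refl])
    fix y :: "real^2"
    show "indicator (range_of c) y * (chart_density c y * green f a (param c y)) =
      indicator (range_of c) y * pd 1 X1 y + indicator (range_of c) y * pd 2 X2 y"
    proof (cases "y \<in> range_of c")
      case True
      have "\<phi> differentiable (at y)" using C\<phi> True by simp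
      from divergence_form[OF True this sa] show ?thesis
        using True green_chart[OF f a c True]
        by (simp add: chart_density_def X1_def X2_def \<phi>_def[symmetric] \<alpha>_def[symmetric] fun_cong[OF \<phi>_def, symmetric])
    qed simp
  qed
  also have "\<dots> = 0" using i1 i2 by simp
  finally show ?thesis .
qed

lemma C1_mult: "f \<in> C1_functions \<Longrightarrow> h \<in> C1_functions \<Longrightarrow> (\<lambda>p. f p * h p) \<in> C1_functions"
  by (rule C1_functionsI) (intro Ck_on_mult open_range C1_functionsD)

lemma C1_sum: "(\<And>j. j \<in> I \<Longrightarrow> f j \<in> C1_functions) \<Longrightarrow> (\<lambda>p. \<Sum>j\<in>I. f j p) \<in> C1_functions"
  by (rule C1_functionsI) (intro Ck_on_sum open_range C1_functionsD)

lemma C1_divide: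
  assumes "f \<in> C1_functions" "h \<in> C1_functions" "\<And>p. p \<in> M \<Longrightarrow> h p \<noteq> 0"
  shows "(\<lambda>p. f p / h p) \<in> C1_functions"
  by (rule C1_functionsI) (intro Ck_on_divide open_range C1_functionsD assms param_in_M)

text \<open>Normalising the bumps by their sum \<open>B\<close> gives a C^1 partition of unity;
  \<open>green\<close> is linear in its first argument, and each localised piece integrates to
  zero.\<close>

theorem green_identity:
  assumes f: "f \<in> C1_functions" and a: "a \<in> smooth_functions A"
  shows "(LINT p|area. grad_inner A g f a p + f p * laplacian a p) = 0"
proof -
  obtain I where I: "finite I" "\<And>c z r. (c, z, r) \<in> I \<Longrightarrow> c \<in> A \<and> 0 < r \<and> cball z r \<subseteq> range_of c"
    "\<And>p. p \<in> M \<Longrightarrow> \<exists>c z r. (c, z, r) \<in> I \<and> p \<in> param c ` ball z r" by (rule ball_cover, rule that)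
  have bC1: "chart_bump j \<in> C1_functions" if "j \<in> I" for j
    using I(2) that chart_bump_C1 by (cases j) auto
  define B where "B p = (\<Sum>j\<in>I. chart_bump j p)" for p
  have B: "B p > 0" if p: "p \<in> M" for p
  proof -
    obtain c z r where j: "(c, z, r) \<in> I" "p \<in> param c ` ball z r" using I(3)[OF p] by blast
    have c: "c \<in> A" "0 < r" "cball z r \<subseteq> range_of c" using I(2)[OF j(1)] by auto
    obtain y where y: "y \<in> ball z r" "p = param c y" using j(2) by blast
    have "y \<in> range_of c" using y(1) c(3) ball_subset_cball by blast
    then have "chart_bump (c, z, r) p > 0"
      using bump_pos[OF c(2) y(1)] y(2) param_in[OF c(1)] coord_param[OF c(1)] by (simp add: chart_bump_def)
    moreover have "chart_bump j p \<ge> 0" for j by (auto simp: chart_bump_def bump_nonneg split: prod.split)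
    ultimately show ?thesis unfolding B_def by (intro sum_pos2[OF I(1) j(1)])
  qed
  have BC1: "B \<in> C1_functions" unfolding B_def by (rule C1_sum[OF bC1])
  define h where "h j p = chart_bump j p * f p / B p" for j p
  have hC1: "h j \<in> C1_functions" if "j \<in> I" for j
    unfolding h_def by (intro C1_divide C1_mult bC1 f BC1 that) (use B in force)
  have hsum: "(\<Sum>j\<in>I. h j p) = f p" if "p \<in> M" for p
    using B[OF that] by (simp add: h_def sum_divide_distrib[symmetric] sum_distrib_right[symmetric] B_def)
  have "green f a p = (\<Sum>j\<in>I. green (h j) a p)" if p: "p \<in> M" for p
  proof -
    obtain c where c: "c \<in> A" "p \<in> dom_of c" using chart_at[OF p] by (rule that)
    note z = coord_in[OF c(2)]
    have d: "(\<lambda>z. h j (param c z)) differentiable (at (coord c p))" if "j \<in> I" for j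
      by (rule C1_functions_differentiable[OF hC1[OF that] c(1) z])
    have "pd i (\<lambda>z. f (param c z)) (coord c p) = pd i (\<lambda>z. \<Sum>j\<in>I. h j (param c z)) (coord c p)" for i
      by (rule dderiv_cong_open[OF open_range[OF c(1)] z]) (simp add: hsum param_in_M[OF c(1)])
    moreover have "pd i (\<lambda>z. \<Sum>j\<in>I. h j (param c z)) (coord c p) = (\<Sum>j\<in>I. pd i (\<lambda>z. h j (param c z)) (coord c p))" for i
      by (rule dderiv_eq[OF has_derivative_sum]) (rule dderiv_works[OF d])
    ultimately have pd: "pd i (\<lambda>z. f (param c z)) (coord c p) = (\<Sum>j\<in>I. pd i (\<lambda>z. h j (param c z)) (coord c p))" for i by simp
    have "green f a p = pgrad (G c) (\<lambda>z. f (param c z)) (\<lambda>z. a (param c z)) (coord c p)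
        + (\<Sum>j\<in>I. h j p) * plap (G c) (\<lambda>z. a (param c z)) (coord c p)"
      using green_chart[OF f a c(1) z] hsum[OF p] by (simp add: param_coord[OF c])
    also have "\<dots> = (\<Sum>j\<in>I. pgrad (G c) (\<lambda>z. h j (param c z)) (\<lambda>z. a (param c z)) (coord c p)
        + h j p * plap (G c) (\<lambda>z. a (param c z)) (coord c p))"
      unfolding pgrad_def sum_2 pd by (simp add: sum.distrib sum_distrib_left sum_distrib_right)
    also have "\<dots> = (\<Sum>j\<in>I. green (h j) a p)"
      using green_chart[OF hC1 a c(1) z] by (simp add: param_coord[OF c])
    finally show ?thesis .
  qed
  then have "(LINT p|area. green f a p) = (LINT p|area. (\<Sum>j\<in>I. green (h j) a p))"
    by (intro Bochner_Integration.integral_cong) simp_all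
  also have "\<dots> = (\<Sum>j\<in>I. (LINT p|area. green (h j) a p))"
    by (rule Bochner_Integration.integral_sum) (rule integrable_continuous[OF continuous_green[OF hC1 a]])
  also have "\<dots> = 0"
  proof (rule sum.neutral, rule ballI)
    fix j assume j: "j \<in> I"
    obtain c z r where jc: "j = (c, z, r)" by (cases j) auto
    have c: "c \<in> A" "0 < r" "cball z r \<subseteq> range_of c" using I(2)[of c z r] j jc by auto
    show "(LINT p|area. green (h j) a p) = 0"
      using chart_bump_support(3)[OF c] by (intro green_local[OF hC1[OF j] a c]) (simp add: h_def jc)
  qed
  finally show ?thesis by (simp add: green_def)
qed

end

section \<open>Two-parameter families of functions\<close>

text \<open>A linear operator without zeroth-order term. Keeping the coefficients abstract lets the
  differentiation of the Laplacian in a parameter ignore their origin: they depend on the point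
  alone.\<close>

definition second_order :: "(nat \<Rightarrow> real^2 \<Rightarrow> real) \<Rightarrow> (real^2 \<Rightarrow> real) \<Rightarrow> real^2 \<Rightarrow> real" where
  "second_order k a z = k 0 z * pd 1 (pd 1 a) z + k 1 z * pd 1 (pd 2 a) z + k 2 z * pd 2 (pd 2 a) z
     + k 3 z * pd 1 a z + k 4 z * pd 2 a z"

text \<open>The coefficients are obtained before the function \<open>a\<close>, so one choice serves
  all members of a family.\<close>

lemma (in plane_metric) plap_second_order:
  obtains k where "\<And>n. smooth_on (k n) S" "\<And>a z. z \<in> S \<Longrightarrow> plap G a z = second_order k a z"
proof (rule that)
  let ?D = "\<lambda>z. det (G z)" and ?E = "\<lambda>z. G z $ 1 $ 1" and ?F = "\<lambda>z. G z $ 1 $ 2" and ?H = "\<lambda>z. G z $ 2 $ 2"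
  define k :: "nat \<Rightarrow> real^2 \<Rightarrow> real" where "k n =
    (if n = 0 then (\<lambda>z. ?H z / ?D z) else if n = 1 then (\<lambda>z. - (2 * ?F z) / ?D z)
     else if n = 2 then (\<lambda>z. ?E z / ?D z)
     else if n = 3 then (\<lambda>z. (pd 1 ?H z - pd 2 ?F z) / ?D z - (pd 1 ?D z * ?H z - pd 2 ?D z * ?F z) / (2 * (?D z)\<^sup>2))
     else (\<lambda>z. (pd 2 ?E z - pd 1 ?F z) / ?D z - (pd 2 ?D z * ?E z - pd 1 ?D z * ?F z) / (2 * (?D z)\<^sup>2)))" for n
  have nz: "2 * (?D z)\<^sup>2 \<noteq> 0" if "z \<in> S" for z using det_nz[OF that] by simp
  show "smooth_on (k n) S" for n
    unfolding k_def if_distrib[of "\<lambda>f. smooth_on f S"]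
    by (simp split: if_split; intro conjI impI smooth_on_intros S smooth_G smooth_det det_nz nz; assumption)
  fix a z assume "z \<in> S"
  then have "?D z \<noteq> 0" by (rule det_nz)
  then show "plap G a z = second_order k a z"
    unfolding plap_def second_order_def k_def by (simp add: field_simps power2_eq_square)
qed

text \<open>Together with \<open>smooth_on_affine\<close> this handles slicing at fixed parameters,
  forgetting the parameters and exchanging them: all are affine substitutions.\<close>

lemma dderiv_affine:
  assumes "F differentiable (at (x + L y))" "bounded_linear L"
  shows "dderiv v (\<lambda>y. F (x + L y)) y = dderiv (L v) F (x + L y)"
proof -
  have "((\<lambda>y. x + L y) has_derivative L) (at y)"
    using bounded_linear_imp_has_derivative[OF assms(2)] has_derivative_add_const by (auto intro!: derivative_eq_intros)
  from diff_chain_at[OF this dderiv_works[OF assms(1)]] show ?thesis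
    using dderiv_eq by (fastforce simp: comp_def)
qed

lemma smooth_on_affine:
  fixes F :: "'b::euclidean_space \<Rightarrow> 'c::real_normed_vector"
  assumes "open S" "open T" "smooth_on F T" "bounded_linear L" "\<And>y. y \<in> S \<Longrightarrow> x + L y \<in> T"
  shows "smooth_on (\<lambda>y. F (x + L y)) S"
proof (rule smooth_on_compose[OF assms(1,2) _ _ assms(3)])
  show "(\<lambda>y. x + L y) ` S \<subseteq> T" using assms(5) by blast
  show "smooth_on (\<lambda>y. x + L y) S"
    by (rule smooth_on_add[OF assms(1) smooth_on_const smooth_on_bounded_linear[OF assms(4,1)]])
qed

abbreviation ds :: "real \<times> real \<times> (real^2)" where "ds \<equiv> (1, 0, 0)"
abbreviation dx :: "2 \<Rightarrow> real \<times> real \<times> (real^2)" where "dx i \<equiv> (0, 0, axis i 1)"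

text \<open>A two-parameter family of functions on the surface, read in a chart, is a single function of
  the parameters and the coordinates.\<close>

definition lift :: "(real \<Rightarrow> real \<Rightarrow> 'p \<Rightarrow> real) \<Rightarrow> 'p chart \<Rightarrow> real \<times> real \<times> (real^2) \<Rightarrow> real" where
  "lift \<alpha> c = (\<lambda>x. \<alpha> (fst x) (fst (snd x)) (param c (snd (snd x))))"

lemma lift_apply [simp]: "lift \<alpha> c (s, t, z) = \<alpha> s t (param c z)"
  by (simp add: lift_def)

lemma bl_z: "bounded_linear (\<lambda>z::real^2. (0::real, 0::real, z))"
  by (intro bounded_linear_Pair bounded_linear_zero bounded_linear_ident)

lemma slice_z:
  assumes "F differentiable (at (s, t, z))"
  shows "pd i (\<lambda>z. F (s, t, z)) z = dderiv (dx i) F (s, t, z)"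
  using dderiv_affine[of F "(s, t, 0)" "\<lambda>z. (0, 0, z)" z, OF _ bl_z] assms by simp

lemma slice_s:
  fixes F :: "real \<times> real \<times> (real^2) \<Rightarrow> real"
  assumes "F differentiable (at (s, t, z))"
  shows "((\<lambda>s. F (s, t, z)) has_real_derivative dderiv ds F (s, t, z)) (at s)"
proof -
  have "F differentiable (at ((0, t, z) + s *\<^sub>R ds))" using assms by simp
  from has_real_derivative_line[OF this] show ?thesis by simp
qed

definition second_order_lift ::
  "(nat \<Rightarrow> real^2 \<Rightarrow> real) \<Rightarrow> (real \<times> real \<times> (real^2) \<Rightarrow> real) \<Rightarrow> real \<times> real \<times> (real^2) \<Rightarrow> real" where
  "second_order_lift k f x =
     k 0 (snd (snd x)) * dderiv (dx 1) (dderiv (dx 1) f) x + k 1 (snd (snd x)) * dderiv (dx 1) (dderiv (dx 2) f) x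
     + k 2 (snd (snd x)) * dderiv (dx 2) (dderiv (dx 2) f) x
     + k 3 (snd (snd x)) * dderiv (dx 1) f x + k 4 (snd (snd x)) * dderiv (dx 2) f x"

section \<open>Jointly smooth families and their parameter derivatives\<close>

locale param_surface = metric_surface M A g for M :: "'p::t2_space set" and A g +
  fixes \<epsilon> :: real
  assumes eps: "\<epsilon> > 0"
begin

abbreviation I :: "real set" where "I \<equiv> {-\<epsilon><..<\<epsilon>}"
abbreviation \<Omega> :: "'p chart \<Rightarrow> (real \<times> real \<times> (real^2)) set" where "\<Omega> c \<equiv> I \<times> I \<times> range_of c"

lemma zero_I: "0 \<in> I" using eps by simp

lemma open_\<Omega>: "c \<in> A \<Longrightarrow> open (\<Omega> c)"
  by (intro open_Times open_range open_greaterThanLessThan)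

text \<open>Joint smoothness in parameters and coordinates, and not merely of each slice, is what
  makes parameter derivatives commute with spatial ones.\<close>

definition fam :: "(real \<Rightarrow> real \<Rightarrow> 'p \<Rightarrow> real) \<Rightarrow> bool" where
  "fam \<alpha> \<longleftrightarrow> (\<forall>c\<in>A. smooth_on (lift \<alpha> c) (\<Omega> c))"

lemma famI: "(\<And>c. c \<in> A \<Longrightarrow> smooth_on (lift \<alpha> c) (\<Omega> c)) \<Longrightarrow> fam \<alpha>"
  unfolding fam_def by blast

lemma famD: "fam \<alpha> \<Longrightarrow> c \<in> A \<Longrightarrow> smooth_on (lift \<alpha> c) (\<Omega> c)"
  unfolding fam_def by blast

lemma fam_differentiable:
  "fam \<alpha> \<Longrightarrow> c \<in> A \<Longrightarrow> s \<in> I \<Longrightarrow> t \<in> I \<Longrightarrow> z \<in> range_of c \<Longrightarrow> lift \<alpha> c differentiable (at (s, t, z))"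
  by (rule smooth_on_differentiable[OF famD]) auto

lemma fam_smooth:
  assumes \<alpha>: "fam \<alpha>" and st: "s \<in> I" "t \<in> I"
  shows "\<alpha> s t \<in> smooth_functions A"
proof (rule smooth_functionsI)
  fix c assume c: "c \<in> A"
  have "smooth_on (\<lambda>z. lift \<alpha> c ((s, t, 0) + (0, 0, z))) (range_of c)"
    by (rule smooth_on_affine[OF open_range[OF c] open_\<Omega>[OF c] famD[OF \<alpha> c] bl_z]) (use st in auto)
  then show "smooth_on (\<lambda>z. \<alpha> s t (param c z)) (range_of c)" by simp
qed

lemma smooth_on_snd_snd:
  assumes "c \<in> A" "smooth_on (f :: real^2 \<Rightarrow> real) (range_of c)"
  shows "smooth_on (\<lambda>x. f (snd (snd x))) (\<Omega> c)"
proof -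
  have bl: "bounded_linear (\<lambda>x :: real \<times> real \<times> (real^2). snd (snd x))"
    by (intro bounded_linear_intros)
  have "smooth_on (\<lambda>x. f (0 + snd (snd x))) (\<Omega> c)"
    by (rule smooth_on_affine[OF open_\<Omega>[OF assms(1)] open_range[OF assms(1)] assms(2) bl]) auto
  then show ?thesis by simp
qed

lemma dderiv_snd_snd:
  assumes "(f :: real^2 \<Rightarrow> real) differentiable (at z)"
  shows "dderiv ds (\<lambda>x. f (snd (snd x))) (s, t, z) = 0"
proof -
  have bl: "bounded_linear (\<lambda>x :: real \<times> real \<times> (real^2). snd (snd x))"
    by (intro bounded_linear_intros)
  have "dderiv ds (\<lambda>x. f (0 + snd (snd x))) (s, t, z) = dderiv (snd (snd ds)) f (0 + snd (snd (s, t, z)))"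
    by (rule dderiv_affine[OF _ bl]) (use assms in simp)
  also have "\<dots> = 0"
    using has_derivative_linear[OF dderiv_works[OF assms]] linear_0 by fastforce
  finally show ?thesis by simp
qed

lemma fam_const:
  assumes "f \<in> smooth_functions A" shows "fam (\<lambda>s t. f)"
proof (rule famI)
  fix c assume c: "c \<in> A"
  show "smooth_on (lift (\<lambda>s t. f) c) (\<Omega> c)"
    using smooth_on_snd_snd[OF c smooth_functionsD[OF assms c]] by (simp add: lift_def)
qed

lemma fam_add: "fam \<alpha> \<Longrightarrow> fam \<beta> \<Longrightarrow> fam (\<lambda>s t p. \<alpha> s t p + \<beta> s t p)"
  unfolding fam_def lift_def by (intro ballI smooth_on_add open_\<Omega>; blast)

lemma fam_diff: "fam \<alpha> \<Longrightarrow> fam \<beta> \<Longrightarrow> fam (\<lambda>s t p. \<alpha> s t p - \<beta> s t p)"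
  unfolding fam_def lift_def by (intro ballI smooth_on_diff open_\<Omega>; blast)

lemma fam_mult: "fam \<alpha> \<Longrightarrow> fam \<beta> \<Longrightarrow> fam (\<lambda>s t p. \<alpha> s t p * \<beta> s t p)"
  unfolding fam_def lift_def by (intro ballI smooth_on_mult open_\<Omega>; blast)

lemma fam_divide:
  assumes "fam \<alpha>" "fam \<beta>" "\<And>s t p. s \<in> I \<Longrightarrow> t \<in> I \<Longrightarrow> p \<in> M \<Longrightarrow> \<beta> s t p \<noteq> 0"
  shows "fam (\<lambda>s t p. \<alpha> s t p / \<beta> s t p)"
proof (rule famI)
  fix c assume c: "c \<in> A"
  have "smooth_on (\<lambda>x. lift \<alpha> c x / lift \<beta> c x) (\<Omega> c)"
    by (rule smooth_on_divide[OF open_\<Omega>[OF c] famD[OF assms(1) c] famD[OF assms(2) c]])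
      (use assms(3) param_in_M[OF c] in auto)
  then show "smooth_on (lift (\<lambda>s t p. \<alpha> s t p / \<beta> s t p) c) (\<Omega> c)" by (simp add: lift_def)
qed

text \<open>Exchanging the parameters reduces statements about \<open>d_t\<close> to their
  counterparts for \<open>d_s\<close>.\<close>

lemma fam_swap:
  assumes "fam \<alpha>" shows "fam (\<lambda>s t. \<alpha> t s)"
proof (rule famI)
  fix c assume c: "c \<in> A"
  have bl: "bounded_linear (\<lambda>x :: real \<times> real \<times> (real^2). (fst (snd x), fst x, snd (snd x)))"
    by (intro bounded_linear_intros)
  have "smooth_on (\<lambda>x. lift \<alpha> c (0 + (fst (snd x), fst x, snd (snd x)))) (\<Omega> c)"
    by (rule smooth_on_affine[OF open_\<Omega>[OF c] open_\<Omega>[OF c] famD[OF assms c] bl]) auto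
  then show "smooth_on (lift (\<lambda>s t. \<alpha> t s) c) (\<Omega> c)" by (simp add: lift_def)
qed

lemma d_t_swap: "d_t \<alpha> s t = d_s (\<lambda>s t. \<alpha> t s) t s"
  by (rule ext) (simp add: d_t_def d_s_def)

lemma lift_d_s:
  assumes "fam \<alpha>" "c \<in> A" "x \<in> \<Omega> c"
  shows "lift (d_s \<alpha>) c x = dderiv ds (lift \<alpha> c) x"
proof -
  obtain s t z where x: "x = (s, t, z)" by (cases x) auto
  have "((\<lambda>s. lift \<alpha> c (s, t, z)) has_real_derivative dderiv ds (lift \<alpha> c) (s, t, z)) (at s)"
    by (rule slice_s[OF fam_differentiable]) (use assms x in auto)
  then show ?thesis unfolding x by (simp add: d_s_def DERIV_imp_deriv)
qed

lemma fam_d_s: assumes "fam \<alpha>" shows "fam (d_s \<alpha>)"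
proof (rule famI)
  fix c assume c: "c \<in> A"
  show "smooth_on (lift (d_s \<alpha>) c) (\<Omega> c)"
    by (rule iffD2[OF smooth_on_cong[OF open_\<Omega>[OF c] lift_d_s[OF assms c]] smooth_on_dderiv[OF famD[OF assms c]]])
qed

lemma fam_d_t: assumes "fam \<alpha>" shows "fam (d_t \<alpha>)"
proof -
  have "fam (\<lambda>s t. d_s (\<lambda>s t. \<alpha> t s) t s)" by (rule fam_swap[OF fam_d_s[OF fam_swap[OF assms]]])
  also have "(\<lambda>s t. d_s (\<lambda>s t. \<alpha> t s) t s) = d_t \<alpha>" by (intro ext) (simp add: d_t_swap)
  finally show ?thesis .
qed

lemma has_derivative_d_s:
  assumes "fam \<alpha>" "s \<in> I" "t \<in> I" "p \<in> M"
  shows "((\<lambda>\<sigma>. \<alpha> \<sigma> t p) has_real_derivative d_s \<alpha> s t p) (at s)"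
proof -
  obtain c where c: "c \<in> A" "p \<in> dom_of c" using chart_at[OF assms(4)] by (rule that)
  have x: "(s, t, coord c p) \<in> \<Omega> c" using assms coord_in[OF c(2)] by simp
  have "((\<lambda>s. lift \<alpha> c (s, t, coord c p)) has_real_derivative dderiv ds (lift \<alpha> c) (s, t, coord c p)) (at s)"
    by (rule slice_s[OF smooth_on_differentiable[OF famD[OF assms(1) c(1)] x]])
  then show ?thesis using lift_d_s[OF assms(1) c(1) x] by (simp add: param_coord[OF c])
qed

lemma has_derivative_d_t:
  assumes "fam \<alpha>" "s \<in> I" "t \<in> I" "p \<in> M"
  shows "((\<lambda>\<tau>. \<alpha> s \<tau> p) has_real_derivative d_t \<alpha> s t p) (at t)"
  using has_derivative_d_s[OF fam_swap[OF assms(1)] assms(3,2,4)] by (simp add: d_t_swap)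

lemma d_s_cong:
  assumes "\<And>\<sigma>. \<sigma> \<in> I \<Longrightarrow> \<alpha> \<sigma> t p = \<beta> \<sigma> t p" "s \<in> I"
  shows "d_s \<alpha> s t p = d_s \<beta> s t p"
  unfolding d_s_def
  by (rule deriv_cong_ev[OF _ refl]) (use assms in \<open>auto intro!: eventually_mono[OF eventually_nhds_in_open[of I s]]\<close>)

lemma d_t_cong:
  assumes "\<And>\<tau>. \<tau> \<in> I \<Longrightarrow> \<alpha> s \<tau> p = \<beta> s \<tau> p" "t \<in> I"
  shows "d_t \<alpha> s t p = d_t \<beta> s t p"
  unfolding d_t_swap by (rule d_s_cong) (use assms in auto)

lemma d_s_d_t:
  assumes "fam \<alpha>" "s \<in> I" "t \<in> I" "p \<in> M"
  shows "d_s (d_t \<alpha>) s t p = d_t (d_s \<alpha>) s t p"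
proof -
  obtain c where c: "c \<in> A" "p \<in> dom_of c" using chart_at[OF assms(4)] by (rule that)
  have x: "(s, t, coord c p) \<in> \<Omega> c" using assms coord_in[OF c(2)] by simp
  let ?dt = "(0, 1, 0) :: real \<times> real \<times> (real^2)"
  have dt: "lift (d_t \<beta>) c x = dderiv ?dt (lift \<beta> c) x" if "fam \<beta>" "x \<in> \<Omega> c" for x \<beta>
  proof -
    obtain s t z where x: "x = (s, t, z)" by (cases x) auto
    have "lift \<beta> c differentiable (at ((s, 0, z) + t *\<^sub>R ?dt))"
      using smooth_on_differentiable[OF famD[OF that(1) c(1)] that(2)] x by simp
    from has_real_derivative_line[OF this] show ?thesis unfolding x by (simp add: d_t_def DERIV_imp_deriv)
  qed
  have "d_s (d_t \<alpha>) s t p = dderiv ds (lift (d_t \<alpha>) c) (s, t, coord c p)"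
    using lift_d_s[OF fam_d_t[OF assms(1)] c(1) x] by (simp add: param_coord[OF c])
  also have "\<dots> = dderiv ds (dderiv ?dt (lift \<alpha> c)) (s, t, coord c p)"
    by (rule dderiv_cong_open[OF open_\<Omega>[OF c(1)] x]) (rule dt[OF assms(1)])
  also have "\<dots> = dderiv ?dt (dderiv ds (lift \<alpha> c)) (s, t, coord c p)"
    by (rule dderiv_commute[OF open_\<Omega>[OF c(1)] famD[OF assms(1) c(1)] x])
  also have "\<dots> = dderiv ?dt (lift (d_s \<alpha>) c) (s, t, coord c p)"
    by (rule dderiv_cong_open[OF open_\<Omega>[OF c(1)] x]) (rule lift_d_s[OF assms(1) c(1), symmetric])
  also have "\<dots> = d_t (d_s \<alpha>) s t p"
    using dt[OF fam_d_s[OF assms(1)] x] by (simp add: param_coord[OF c])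
  finally show ?thesis .
qed

lemma dderiv_ds_dx:
  assumes "fam \<alpha>" "c \<in> A" "x \<in> \<Omega> c"
  shows "dderiv ds (dderiv (dx i) (lift \<alpha> c)) x = dderiv (dx i) (lift (d_s \<alpha>) c) x"
proof -
  have "dderiv ds (dderiv (dx i) (lift \<alpha> c)) x = dderiv (dx i) (dderiv ds (lift \<alpha> c)) x"
    by (rule dderiv_commute[OF open_\<Omega>[OF assms(2)] famD[OF assms(1,2)] assms(3)])
  also have "\<dots> = dderiv (dx i) (lift (d_s \<alpha>) c) x"
    by (rule dderiv_cong_open[OF open_\<Omega>[OF assms(2)] assms(3)]) (rule lift_d_s[OF assms(1,2), symmetric])
  finally show ?thesis .
qed

lemma pd_lift:
  "fam \<alpha> \<Longrightarrow> c \<in> A \<Longrightarrow> s \<in> I \<Longrightarrow> t \<in> I \<Longrightarrow> z \<in> range_of c \<Longrightarrow>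
    pd i (\<lambda>z. \<alpha> s t (param c z)) z = dderiv (dx i) (lift \<alpha> c) (s, t, z)"
  using slice_z[OF fam_differentiable] by fastforce

lemma pd_pd_lift:
  assumes "fam \<alpha>" "c \<in> A" "s \<in> I" "t \<in> I" "z \<in> range_of c"
  shows "pd j (pd i (\<lambda>z. \<alpha> s t (param c z))) z = dderiv (dx j) (dderiv (dx i) (lift \<alpha> c)) (s, t, z)"
proof -
  have "pd j (pd i (\<lambda>z. \<alpha> s t (param c z))) z = pd j (\<lambda>z. dderiv (dx i) (lift \<alpha> c) (s, t, z)) z"
    by (rule dderiv_cong_open[OF open_range[OF assms(2)] assms(5)]) (rule pd_lift[OF assms(1-4)])
  also have "\<dots> = dderiv (dx j) (dderiv (dx i) (lift \<alpha> c)) (s, t, z)"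
    by (rule slice_z[OF smooth_on_differentiable[OF smooth_on_dderiv[OF famD[OF assms(1,2)]]]]) (use assms in auto)
  finally show ?thesis .
qed

lemma lift_grad_inner:
  assumes a: "fam a" and b: "fam b" and c: "c \<in> A" and x: "x \<in> \<Omega> c"
  shows "lift (\<lambda>s t. grad_inner A g (a s t) (b s t)) c x =
    (\<Sum>i\<in>UNIV. \<Sum>j\<in>UNIV. matrix_inv (G c (snd (snd x))) $ i $ j * dderiv (dx i) (lift a c) x * dderiv (dx j) (lift b c) x)"
proof -
  obtain s t z where st: "x = (s, t, z)" "s \<in> I" "t \<in> I" "z \<in> range_of c" using x by (cases x) auto
  show ?thesis unfolding st(1) lift_apply snd_conv
    unfolding grad_inner_eq[OF c param_in[OF c st(4)] fam_smooth[OF a st(2,3), THEN smooth_C1] fam_smooth[OF b st(2,3), THEN smooth_C1]]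
      coord_param[OF c st(4)] pgrad_def pd_lift[OF a c st(2-4)] pd_lift[OF b c st(2-4)] ..
qed

lemma fam_grad_inner:
  assumes a: "fam a" and b: "fam b" shows "fam (\<lambda>s t. grad_inner A g (a s t) (b s t))"
proof (rule famI)
  fix c assume c: "c \<in> A"
  interpret plane_metric "G c" "range_of c" by (rule plane_metric_chart[OF c])
  let ?r = "\<lambda>x. \<Sum>i\<in>UNIV. \<Sum>j\<in>UNIV. matrix_inv (G c (snd (snd x))) $ i $ j * dderiv (dx i) (lift a c) x * dderiv (dx j) (lift b c) x"
  have "smooth_on (\<lambda>x. \<Sum>i\<in>UNIV. \<Sum>j\<in>UNIV. matrix_inv (G c (snd (snd x))) $ i $ j * dderiv (dx i) (lift a c) x * dderiv (dx j) (lift b c) x) (\<Omega> c)"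
    unfolding sum_2 by (intro smooth_on_intros open_\<Omega>[OF c] famD[OF a c] famD[OF b c] smooth_on_snd_snd[OF c smooth_inv])
  then show "smooth_on (lift (\<lambda>s t. grad_inner A g (a s t) (b s t)) c) (\<Omega> c)"
    using smooth_on_cong[of "\<Omega> c" "lift (\<lambda>s t. grad_inner A g (a s t) (b s t)) c" ?r, OF open_\<Omega>[OF c]]
      lift_grad_inner[OF a b c] by blast
qed

text \<open>The inverse metric is independent of the parameters, so the product rule hits only the
  two differentials, and there \<open>ds\<close> commutes with the spatial directions.\<close>

lemma d_s_grad_inner:
  assumes a: "fam a" and b: "fam b" and st: "s \<in> I" "t \<in> I" and p: "p \<in> M"
  shows "d_s (\<lambda>s t. grad_inner A g (a s t) (b s t)) s t p =
    grad_inner A g (d_s a s t) (b s t) p + grad_inner A g (a s t) (d_s b s t) p"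
proof -
  obtain c where c: "c \<in> A" "p \<in> dom_of c" using chart_at[OF p] by (rule that)
  interpret plane_metric "G c" "range_of c" by (rule plane_metric_chart[OF c(1)])
  let ?x = "(s, t, coord c p)"
  have x: "?x \<in> \<Omega> c" using st coord_in[OF c(2)] by simp
  note pc = param_coord[OF c]
  let ?m = "\<lambda>i j x. matrix_inv (G c (snd (snd x))) $ i $ j"
  have m: "?m i j differentiable (at ?x)" "dderiv ds (?m i j) ?x = 0" for i j
    using smooth_on_differentiable[OF smooth_on_snd_snd[OF c(1) smooth_inv] x]
      dderiv_snd_snd[OF smooth_on_differentiable[OF smooth_inv coord_in[OF c(2)]]] by blast+
  have d: "dderiv (dx i) (lift a c) differentiable (at ?x)" "dderiv (dx i) (lift b c) differentiable (at ?x)" for i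
    using smooth_on_differentiable[OF smooth_on_dderiv[OF famD[OF a c(1)]] x]
      smooth_on_differentiable[OF smooth_on_dderiv[OF famD[OF b c(1)]] x] by blast+
  have "d_s (\<lambda>s t. grad_inner A g (a s t) (b s t)) s t p
      = dderiv ds (lift (\<lambda>s t. grad_inner A g (a s t) (b s t)) c) ?x"
    using lift_d_s[OF fam_grad_inner[OF a b] c(1) x] by (simp add: pc)
  also have "\<dots> = dderiv ds (\<lambda>x. \<Sum>i\<in>UNIV. \<Sum>j\<in>UNIV. ?m i j x * dderiv (dx i) (lift a c) x * dderiv (dx j) (lift b c) x) ?x"
    by (rule dderiv_cong_open[OF open_\<Omega>[OF c(1)] x]) (rule lift_grad_inner[OF a b c(1)])
  also have "\<dots> = (\<Sum>i\<in>UNIV. \<Sum>j\<in>UNIV. ?m i j ?x * dderiv (dx i) (lift (d_s a) c) ?x * dderiv (dx j) (lift b c) ?x)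
      + (\<Sum>i\<in>UNIV. \<Sum>j\<in>UNIV. ?m i j ?x * dderiv (dx i) (lift a c) ?x * dderiv (dx j) (lift (d_s b) c) ?x)"
    unfolding sum_2
    by (simp add: dderiv_add dderiv_mult m d dderiv_ds_dx[OF a c(1) x] dderiv_ds_dx[OF b c(1) x] del: snd_conv)
  also have "\<dots> = grad_inner A g (d_s a s t) (b s t) p + grad_inner A g (a s t) (d_s b s t) p"
    using lift_grad_inner[OF fam_d_s[OF a] b c(1) x] lift_grad_inner[OF a fam_d_s[OF b] c(1) x]
    by (simp add: pc)
  finally show ?thesis .
qed

lemma d_t_grad_inner:
  assumes a: "fam a" and b: "fam b" and st: "s \<in> I" "t \<in> I" and p: "p \<in> M"
  shows "d_t (\<lambda>s t. grad_inner A g (a s t) (b s t)) s t p =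
    grad_inner A g (d_t a s t) (b s t) p + grad_inner A g (a s t) (d_t b s t) p"
  using d_s_grad_inner[OF fam_swap[OF a] fam_swap[OF b] st(2,1) p] by (simp add: d_t_swap)

lemma lift_laplacian:
  assumes a: "fam a" and c: "c \<in> A" and x: "x \<in> \<Omega> c"
    and k: "\<And>a z. z \<in> range_of c \<Longrightarrow> plap (G c) a z = second_order k a z"
  shows "lift (\<lambda>s t. laplacian (a s t)) c x = second_order_lift k (lift a c) x"
proof -
  obtain s t z where st: "x = (s, t, z)" "s \<in> I" "t \<in> I" "z \<in> range_of c" using x by (cases x) auto
  show ?thesis unfolding st(1) lift_apply second_order_lift_def snd_conv
    unfolding laplacian_eq[OF fam_smooth[OF a st(2,3)] c param_in[OF c st(4)]] coord_param[OF c st(4)] k[OF st(4)]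
      second_order_def pd_lift[OF a c st(2-4)] pd_pd_lift[OF a c st(2-4)] ..
qed

lemma fam_laplacian: assumes a: "fam a" shows "fam (\<lambda>s t. laplacian (a s t))"
proof (rule famI)
  fix c assume c: "c \<in> A"
  interpret plane_metric "G c" "range_of c" by (rule plane_metric_chart[OF c])
  obtain k where sm: "\<And>n. smooth_on (k n) (range_of c)"
    and k: "\<And>a z. z \<in> range_of c \<Longrightarrow> plap (G c) a z = second_order k a z" by (rule plap_second_order, rule that)
  have "smooth_on (second_order_lift k (lift a c)) (\<Omega> c)"
    unfolding second_order_lift_def[abs_def]
    by (intro smooth_on_intros open_\<Omega>[OF c] famD[OF a c] smooth_on_snd_snd[OF c] sm)
  then show "smooth_on (lift (\<lambda>s t. laplacian (a s t)) c) (\<Omega> c)"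
    using smooth_on_cong[of "\<Omega> c" "lift (\<lambda>s t. laplacian (a s t)) c", OF open_\<Omega>[OF c] lift_laplacian[OF a c _ k]]
    by blast
qed

text \<open>The coefficients from \<open>plap_second_order\<close> are constant along
  \<open>ds\<close>, and \<open>ds\<close> commutes with spatial derivatives up to second
  order.\<close>

lemma d_s_laplacian:
  assumes a: "fam a" and st: "s \<in> I" "t \<in> I" and p: "p \<in> M"
  shows "d_s (\<lambda>s t. laplacian (a s t)) s t p = laplacian (d_s a s t) p"
proof -
  obtain c where c: "c \<in> A" "p \<in> dom_of c" using chart_at[OF p] by (rule that)
  interpret plane_metric "G c" "range_of c" by (rule plane_metric_chart[OF c(1)])
  obtain k where sm: "\<And>n. smooth_on (k n) (range_of c)"
    and k: "\<And>a z. z \<in> range_of c \<Longrightarrow> plap (G c) a z = second_order k a z" by (rule plap_second_order, rule that)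
  let ?x = "(s, t, coord c p)"
  have x: "?x \<in> \<Omega> c" using st coord_in[OF c(2)] by simp
  note pc = param_coord[OF c]
  have m: "(\<lambda>x. k n (snd (snd x))) differentiable (at ?x)" "dderiv ds (\<lambda>x. k n (snd (snd x))) ?x = 0" for n
    using smooth_on_differentiable[OF smooth_on_snd_snd[OF c(1) sm] x]
      dderiv_snd_snd[OF smooth_on_differentiable[OF sm coord_in[OF c(2)]]] by blast+
  have d: "dderiv (dx i) (lift a c) differentiable (at ?x)" "dderiv (dx j) (dderiv (dx i) (lift a c)) differentiable (at ?x)" for i j
    using smooth_on_differentiable[OF smooth_on_dderiv[OF famD[OF a c(1)]] x]
      smooth_on_differentiable[OF smooth_on_dderiv[OF smooth_on_dderiv[OF famD[OF a c(1)]]] x] by blast+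
  have d2: "dderiv ds (dderiv (dx j) (dderiv (dx i) (lift a c))) ?x = dderiv (dx j) (dderiv (dx i) (lift (d_s a) c)) ?x" for i j
  proof -
    have "dderiv ds (dderiv (dx j) (dderiv (dx i) (lift a c))) ?x = dderiv (dx j) (dderiv ds (dderiv (dx i) (lift a c))) ?x"
      by (rule dderiv_commute[OF open_\<Omega>[OF c(1)] smooth_on_dderiv[OF famD[OF a c(1)]] x])
    also have "\<dots> = dderiv (dx j) (dderiv (dx i) (lift (d_s a) c)) ?x"
      by (rule dderiv_cong_open[OF open_\<Omega>[OF c(1)] x]) (rule dderiv_ds_dx[OF a c(1)])
    finally show ?thesis .
  qed
  have "d_s (\<lambda>s t. laplacian (a s t)) s t p = dderiv ds (lift (\<lambda>s t. laplacian (a s t)) c) ?x"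
    using lift_d_s[OF fam_laplacian[OF a] c(1) x] by (simp add: pc)
  also have "\<dots> = dderiv ds (second_order_lift k (lift a c)) ?x"
    by (rule dderiv_cong_open[OF open_\<Omega>[OF c(1)] x]) (rule lift_laplacian[OF a c(1) _ k])
  also have "\<dots> = second_order_lift k (lift (d_s a) c) ?x"
    unfolding second_order_lift_def[abs_def]
    by (simp add: dderiv_add dderiv_mult m d d2 dderiv_ds_dx[OF a c(1) x] del: snd_conv)
  also have "\<dots> = laplacian (d_s a s t) p"
    using lift_laplacian[OF fam_d_s[OF a] c(1) x k] by (simp add: pc)
  finally show ?thesis .
qed

lemma d_t_laplacian:
  assumes a: "fam a" and st: "s \<in> I" "t \<in> I" and p: "p \<in> M"
  shows "d_t (\<lambda>s t. laplacian (a s t)) s t p = laplacian (d_t a s t) p"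
  using d_s_laplacian[OF fam_swap[OF a] st(2,1) p] by (simp add: d_t_swap)

end

section \<open>The sectional curvature\<close>

lemma plap_cong:
  assumes "open S" "z \<in> S" "\<And>y. y \<in> S \<Longrightarrow> a y = b y"
  shows "plap G a z = plap G b z"
proof -
  have 1: "pd i a y = pd i b y" if "y \<in> S" for i y
    by (rule dderiv_cong_open[OF assms(1) that assms(3)])
  have 2: "pd j (pd i a) z = pd j (pd i b) z" for i j
    by (rule dderiv_cong_open[OF assms(1,2) 1])
  show ?thesis by (simp add: plap_def 1[OF assms(2)] 2)
qed

lemma (in plane_metric) plap_linear:
  assumes a: "smooth_on a S" and b: "smooth_on b S" and z: "z \<in> S"
  shows "plap G (\<lambda>z. s * a z + t * b z) z = s * plap G a z + t * plap G b z"
proof -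
  have lin: "pd i (\<lambda>z. s * a z + t * b z) y = s * pd i a y + t * pd i b y"
    if "smooth_on a S" "smooth_on b S" "y \<in> S" for i y a b
    using smooth_on_differentiable[OF that(1,3)] smooth_on_differentiable[OF that(2,3)]
    by (simp add: dderiv_add dderiv_mult dderiv_const)
  have lin2: "pd j (pd i (\<lambda>z. s * a z + t * b z)) z = s * pd j (pd i a) z + t * pd j (pd i b) z" for i j
  proof -
    have "pd j (pd i (\<lambda>z. s * a z + t * b z)) z = pd j (\<lambda>z. s * pd i a z + t * pd i b z) z"
      by (rule dderiv_cong_open[OF S z]) (rule lin[OF a b])
    then show ?thesis using lin[OF smooth_on_dderiv[OF a] smooth_on_dderiv[OF b] z] by simp
  qed
  obtain k where "\<And>a z. z \<in> S \<Longrightarrow> plap G a z = second_order k a z" by (rule plap_second_order, rule that)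
  from this[OF z] show ?thesis by (simp only: second_order_def lin[OF a b z] lin2) (simp add: algebra_simps)
qed

text \<open>A family is tied to \<open>u\<close> only at points of \<open>M\<close>, while functions
  on the whole type may differ elsewhere. This and the congruence rules for gradients and Laplacians
  bridge that gap.\<close>

lemma (in surface) area_measure_cong:
  assumes "\<And>c p. p \<in> M \<Longrightarrow> g c p = g' c p"
  shows "area_measure M A g = area_measure M A g'"
proof -
  have "(\<integral>\<^sup>+z. ennreal (sqrt (det (g c (param c z)))) * indicator (coord c ` E) z \<partial>lborel)
     = (\<integral>\<^sup>+z. ennreal (sqrt (det (g' c (param c z)))) * indicator (coord c ` E) z \<partial>lborel)"
    if "c \<in> A" "E \<subseteq> dom_of c" for c E
  proof (rule nn_integral_cong)
    fix z :: "real^2"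
    show "ennreal (sqrt (det (g c (param c z)))) * indicator (coord c ` E) z =
      ennreal (sqrt (det (g' c (param c z)))) * indicator (coord c ` E) z"
    proof (cases "z \<in> coord c ` E")
      case True
      then have "z \<in> range_of c" using that(2) by (auto simp: range_of_def)
      then show ?thesis using assms[OF param_in_M[OF that(1)]] by simp
    qed simp
  qed
  then have "(sets \<mu> = sets BM \<and> (\<forall>c\<in>A. \<forall>E\<in>sets \<mu>. E \<subseteq> dom_of c \<longrightarrow>
           emeasure \<mu> E = (\<integral>\<^sup>+z. ennreal (sqrt (det (g c (param c z)))) * indicator (coord c ` E) z \<partial>lborel)))
    \<longleftrightarrow> (sets \<mu> = sets BM \<and> (\<forall>c\<in>A. \<forall>E\<in>sets \<mu>. E \<subseteq> dom_of c \<longrightarrow>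
           emeasure \<mu> E = (\<integral>\<^sup>+z. ennreal (sqrt (det (g' c (param c z)))) * indicator (coord c ` E) z \<partial>lborel)))" for \<mu>
    by (intro conj_cong refl ball_cong imp_cong) simp
  then show ?thesis unfolding area_measure_def by (simp only:)
qed

context surface
begin

lemma smooth_functions_divide:
  assumes "f \<in> smooth_functions A" "h \<in> smooth_functions A" "\<And>p. p \<in> M \<Longrightarrow> h p \<noteq> 0"
  shows "(\<lambda>p. f p / h p) \<in> smooth_functions A"
proof -
  have "smooth_on (\<lambda>z. f (param c z) / h (param c z)) (range_of c)" if c: "c \<in> A" for c
    by (rule smooth_on_divide[OF open_range[OF c] smooth_functionsD[OF assms(1) c] smooth_functionsD[OF assms(2) c]])
      (rule assms(3)[OF param_in_M[OF c]])
  then show ?thesis by (simp add: smooth_functions_def comp_def)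
qed

end

section \<open>Algebra of gradients and of the Laplacian on the surface\<close>

context metric_surface
begin

lemma grad_inner_cong:
  assumes p: "p \<in> M" and "\<And>q. q \<in> M \<Longrightarrow> a q = a' q" "\<And>q. q \<in> M \<Longrightarrow> b q = b' q"
  shows "grad_inner A g a b p = grad_inner A g a' b' p"
proof -
  note d = chart_at[OF p]
  have "partial (chart_at A p) i f p = partial (chart_at A p) i f' p" if "\<And>q. q \<in> M \<Longrightarrow> f q = f' q" for i f f'
    unfolding partial_def dderiv_def[symmetric]
    by (rule dderiv_cong_open[OF open_range[OF d(1)] coord_in[OF d(2)]]) (simp add: that param_in_M[OF d(1)])
  from this[OF assms(2)] this[OF assms(3)] show ?thesis
    by (simp add: grad_inner_def Let_def gradient_def differential_def)
qed

lemma laplacian_cong: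
  assumes p: "p \<in> M" and "a \<in> smooth_functions A" "b \<in> smooth_functions A" "\<And>q. q \<in> M \<Longrightarrow> a q = b q"
  shows "laplacian a p = laplacian b p"
proof -
  note d = chart_at[OF p]
  show ?thesis
    unfolding laplacian_eq[OF assms(2) d] laplacian_eq[OF assms(3) d]
    by (rule plap_cong[OF open_range[OF d(1)] coord_in[OF d(2)]]) (rule assms(4)[OF param_in_M[OF d(1)]])
qed

lemma laplacian_zero: "laplacian (\<lambda>p. 0) p = 0"
  by (simp add: laplacian_def conformal_def)

lemma laplacian_linear:
  assumes a: "a \<in> smooth_functions A" and b: "b \<in> smooth_functions A" and p: "p \<in> M"
    and ab: "(\<lambda>p. s * a p + t * b p) \<in> smooth_functions A"
  shows "laplacian (\<lambda>p. s * a p + t * b p) p = s * laplacian a p + t * laplacian b p"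
proof -
  note d = chart_at[OF p]
  interpret plane_metric "G (chart_at A p)" "range_of (chart_at A p)" by (rule plane_metric_chart[OF d(1)])
  show ?thesis
    unfolding laplacian_eq[OF a d] laplacian_eq[OF b d] laplacian_eq[OF ab d]
    by (rule plap_linear[OF smooth_functionsD[OF a d(1)] smooth_functionsD[OF b d(1)] coord_in[OF d(2)]])
qed

text \<open>In the fixed chart the gradient product is a bilinear form with a symmetric matrix of
  positive determinant; the rules below and the sign of \<open>wedge_norm2\<close> are read off from
  this.\<close>

lemma grad_inner_chart_at:
  assumes "p \<in> M" "a \<in> C1_functions" "b \<in> C1_functions"
  defines "c \<equiv> chart_at A p"
  shows "grad_inner A g a b p = (\<Sum>i\<in>UNIV. \<Sum>j\<in>UNIV. matrix_inv (g c p) $ i $ j *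
      pd i (\<lambda>z. a (param c z)) (coord c p) * pd j (\<lambda>z. b (param c z)) (coord c p))"
    and "matrix_inv (g c p) $ 2 $ 1 = matrix_inv (g c p) $ 1 $ 2"
    and "matrix_inv (g c p) $ 1 $ 1 * matrix_inv (g c p) $ 2 $ 2 - matrix_inv (g c p) $ 1 $ 2 * matrix_inv (g c p) $ 2 $ 1 > 0"
proof -
  have c: "c \<in> A" "p \<in> dom_of c" using chart_at[OF assms(1)] by (simp_all add: c_def)
  interpret plane_metric "G c" "range_of c" by (rule plane_metric_chart[OF c(1)])
  note pc = param_coord[OF c]
  show "grad_inner A g a b p = (\<Sum>i\<in>UNIV. \<Sum>j\<in>UNIV. matrix_inv (g c p) $ i $ j *
      pd i (\<lambda>z. a (param c z)) (coord c p) * pd j (\<lambda>z. b (param c z)) (coord c p))"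
    unfolding grad_inner_eq[OF c assms(2,3)] pgrad_def pc ..
  have D: "det (g c p) > 0" using det_G[OF coord_in[OF c(2)]] by (simp add: pc)
  have s: "g c p $ 2 $ 1 = g c p $ 1 $ 2" using sym_G[OF coord_in[OF c(2)], of 2 1] by (simp add: pc)
  note inv = matrix_inv_2[of "g c p"]
  show "matrix_inv (g c p) $ 2 $ 1 = matrix_inv (g c p) $ 1 $ 2" using inv D s by simp
  have "matrix_inv (g c p) $ 1 $ 1 * matrix_inv (g c p) $ 2 $ 2 - matrix_inv (g c p) $ 1 $ 2 * matrix_inv (g c p) $ 2 $ 1
     = det (g c p) / (det (g c p) * det (g c p))"
    unfolding inv[OF less_imp_neq[OF D, symmetric]] det_2[of "g c p"]
    by (simp add: diff_divide_distrib mult.commute)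
  then show "matrix_inv (g c p) $ 1 $ 1 * matrix_inv (g c p) $ 2 $ 2 - matrix_inv (g c p) $ 1 $ 2 * matrix_inv (g c p) $ 2 $ 1 > 0"
    using D by simp
qed

lemma grad_inner_commute:
  assumes "p \<in> M" "a \<in> C1_functions" "b \<in> C1_functions"
  shows "grad_inner A g a b p = grad_inner A g b a p"
  unfolding grad_inner_chart_at(1)[OF assms] grad_inner_chart_at(1)[OF assms(1,3,2)] sum_2
  by (simp add: grad_inner_chart_at(2)[OF assms])

lemma C1_add: "f \<in> C1_functions \<Longrightarrow> h \<in> C1_functions \<Longrightarrow> (\<lambda>p. f p + h p) \<in> C1_functions"
  by (rule C1_functionsI) (intro Ck_on_add open_range C1_functionsD)

lemma grad_inner_add:
  assumes p: "p \<in> M" and C1: "a \<in> C1_functions" "b \<in> C1_functions" "h \<in> C1_functions"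
  shows "grad_inner A g (\<lambda>q. a q + b q) h p = grad_inner A g a h p + grad_inner A g b h p"
proof -
  note d = chart_at[OF p]
  have "pd i (\<lambda>z. a (param (chart_at A p) z) + b (param (chart_at A p) z)) (coord (chart_at A p) p) =
    pd i (\<lambda>z. a (param (chart_at A p) z)) (coord (chart_at A p) p) + pd i (\<lambda>z. b (param (chart_at A p) z)) (coord (chart_at A p) p)" for i
    by (intro dderiv_add C1_functions_differentiable C1 d(1) coord_in d(2))
  then show ?thesis
    unfolding grad_inner_chart_at(1)[OF p C1_add[OF C1(1,2)] C1(3)] grad_inner_chart_at(1)[OF p C1(1,3)] grad_inner_chart_at(1)[OF p C1(2,3)]
    by (simp add: sum_2 algebra_simps)
qed

lemma grad_inner_mult:
  assumes p: "p \<in> M" and C1: "a \<in> C1_functions" "b \<in> C1_functions" "h \<in> C1_functions"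
  shows "grad_inner A g (\<lambda>q. a q * b q) h p = a p * grad_inner A g b h p + b p * grad_inner A g a h p"
proof -
  note d = chart_at[OF p]
  have "pd i (\<lambda>z. a (param (chart_at A p) z) * b (param (chart_at A p) z)) (coord (chart_at A p) p) =
    pd i (\<lambda>z. a (param (chart_at A p) z)) (coord (chart_at A p) p) * b p + a p * pd i (\<lambda>z. b (param (chart_at A p) z)) (coord (chart_at A p) p)" for i
    using dderiv_mult[OF C1_functions_differentiable[OF C1(1) d(1) coord_in[OF d(2)]] C1_functions_differentiable[OF C1(2) d(1) coord_in[OF d(2)]]]
    by (simp add: param_coord[OF d])
  then show ?thesis
    unfolding grad_inner_chart_at(1)[OF p C1_mult[OF C1(1,2)] C1(3)] grad_inner_chart_at(1)[OF p C1(1,3)] grad_inner_chart_at(1)[OF p C1(2,3)]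
    by (simp add: sum_2 algebra_simps)
qed

text \<open>Lagrange's identity in dimension two: both sides equal the squared 2 by 2 minor of the
  differentials times the determinant of the inverse metric.\<close>

lemma wedge_norm2_eq:
  assumes "p \<in> M" "a \<in> C1_functions" "b \<in> C1_functions"
  shows "wedge_norm2 A g a b p = grad_inner A g a a p * grad_inner A g b b p - (grad_inner A g a b p)\<^sup>2"
    and "wedge_norm2 A g a b p \<ge> 0"
proof -
  note * = grad_inner_chart_at[OF assms(1)]
  define c where "c = chart_at A p"
  define m where "m = matrix_inv (g c p)"
  have m: "m $ 2 $ 1 = m $ 1 $ 2" "m$1$1 * m$2$2 - m$1$2 * m$2$1 > 0"
    using *(2,3)[OF assms(2,3)] by (simp_all add: m_def c_def)
  define a' b' where "a' = differential c a p" and "b' = differential c b p"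
  have ab: "pd i (\<lambda>z. a (param c z)) (coord c p) = a' $ i" "pd i (\<lambda>z. b (param c z)) (coord c p) = b' $ i" for i
    by (simp_all add: a'_def b'_def differential_def partial_def dderiv_def comp_def)
  have w: "wedge_norm2 A g a b p = (a'$1 * b'$2 - a'$2 * b'$1)\<^sup>2 * (m$1$1 * m$2$2 - m$1$2 * m$2$1)"
    by (simp add: wedge_norm2_def Let_def c_def[symmetric] a'_def[symmetric] b'_def[symmetric]
        two_form_norm2_def m_def[symmetric] wedge_def sum_2 power2_eq_square) (simp add: field_simps)
  show "wedge_norm2 A g a b p = grad_inner A g a a p * grad_inner A g b b p - (grad_inner A g a b p)\<^sup>2"
    unfolding w *(1)[OF assms(2,2)] *(1)[OF assms(3,3)] *(1)[OF assms(2,3)] c_def[symmetric] m_def[symmetric] ab sum_2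
    by (simp add: m(1) power2_eq_square algebra_simps)
  show "wedge_norm2 A g a b p \<ge> 0" unfolding w using m(2) by simp
qed

end

section \<open>Curvature of a two-parameter family\<close>

lemma conformal_diff: "conformal g0 w = conformal (conformal g0 u) (\<lambda>p. w p - u p)"
proof (intro ext)
  fix c p
  have "exp (2 * (w p - u p)) * exp (2 * u p) = exp (2 * w p)"
    by (simp add: right_diff_distrib flip: exp_add)
  then show "conformal g0 w c p = conformal (conformal g0 u) (\<lambda>p. w p - u p) c p"
    by (simp add: conformal_def)
qed

text \<open>The metric at \<open>(0, 0)\<close> serves as base point: \<open>e\<^sup>2\<^sup>w g\<^sub>0 = e\<^sup>2\<^sup>v g\<close> for \<open>v = w - u\<close>, and with
  \<open>\<Phi> = e\<^sup>2\<^sup>v K(e\<^sup>2\<^sup>v g) = K(g) - \<Delta>v\<close> the bilinear form of the connection becomes the inner product of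
  gradients for the fixed metric \<open>g\<close> divided by \<open>\<Phi>\<close>.\<close>

locale conformal_family = param_surface M A g \<epsilon> for M :: "'p::t2_space set" and A g \<epsilon> +
  fixes g0 u and w :: "real \<Rightarrow> real \<Rightarrow> 'p \<Rightarrow> real" and \<phi> \<psi>
  assumes g: "g = conformal g0 u" and u: "u \<in> smooth_functions A" and w: "fam w"
    and \<phi>: "\<phi> \<in> smooth_functions A" and \<psi>: "\<psi> \<in> smooth_functions A"
    and K_pos: "\<And>s t p. s \<in> I \<Longrightarrow> t \<in> I \<Longrightarrow> p \<in> M \<Longrightarrow> gauss_curvature A (conformal g0 (w s t)) p > 0"
    and w0: "\<And>p. p \<in> M \<Longrightarrow> w 0 0 p = u p" "\<And>p. p \<in> M \<Longrightarrow> d_s w 0 0 p = \<phi> p" "\<And>p. p \<in> M \<Longrightarrow> d_t w 0 0 p = \<psi> p"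
begin

abbreviation gi where "gi \<equiv> grad_inner A g"
abbreviation K where "K \<equiv> gauss_curvature A g"

definition v :: "real \<Rightarrow> real \<Rightarrow> 'p \<Rightarrow> real" where "v s t p = w s t p - u p"

definition \<Phi> :: "real \<Rightarrow> real \<Rightarrow> 'p \<Rightarrow> real" where "\<Phi> s t p = K p - laplacian (v s t) p"

lemma conf: "conformal g0 (w s t) = conformal g (v s t)"
  using conformal_diff[of g0 "w s t" u] by (simp add: g v_def[abs_def])

lemma \<Phi>_eq: "\<Phi> s t p = exp (2 * v s t p) * gauss_curvature A (conformal g0 (w s t)) p"
  by (simp add: \<Phi>_def laplacian_def conf)

lemma \<Phi>_pos: "s \<in> I \<Longrightarrow> t \<in> I \<Longrightarrow> p \<in> M \<Longrightarrow> \<Phi> s t p > 0"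
  unfolding \<Phi>_eq using K_pos by simp

lemma fam_v: "fam v"
  using fam_diff[OF w fam_const[OF u]] by (simp add: v_def[abs_def])

lemma fam_\<Phi>: "fam \<Phi>"
  using fam_diff[OF fam_const[OF smooth_gauss_curvature] fam_laplacian[OF fam_v]] by (simp add: \<Phi>_def[abs_def])

lemma d_v:
  assumes "s \<in> I" "t \<in> I" "p \<in> M"
  shows "d_s v s t p = d_s w s t p" "d_t v s t p = d_t w s t p"
proof -
  have "((\<lambda>\<sigma>. v \<sigma> t p) has_real_derivative d_s w s t p - 0) (at s)"
    unfolding v_def by (intro DERIV_diff has_derivative_d_s[OF w assms] DERIV_const)
  then show "d_s v s t p = d_s w s t p" unfolding d_s_def[of v] by (simp add: DERIV_imp_deriv)
  have "((\<lambda>\<tau>. v s \<tau> p) has_real_derivative d_t w s t p - 0) (at t)"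
    unfolding v_def by (intro DERIV_diff has_derivative_d_t[OF w assms] DERIV_const)
  then show "d_t v s t p = d_t w s t p" unfolding d_t_def[of v] by (simp add: DERIV_imp_deriv)
qed

text \<open>\<open>K\<close> does not move with the parameters, and neither does the
  \<open>u\<close> subtracted in \<open>v\<close>, so only the Laplacian term of
  \<open>\<Phi>\<close> is differentiated.\<close>

lemma d_\<Phi>:
  assumes st: "s \<in> I" "t \<in> I" and p: "p \<in> M"
  shows "d_s \<Phi> s t p = - laplacian (d_s w s t) p" "d_t \<Phi> s t p = - laplacian (d_t w s t) p"
proof -
  have lap: "laplacian (d_s v s t) p = laplacian (d_s w s t) p" "laplacian (d_t v s t) p = laplacian (d_t w s t) p"
    by (intro laplacian_cong[OF p] fam_smooth fam_d_s fam_d_t fam_v w st d_v; assumption)+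
  have "((\<lambda>\<sigma>. \<Phi> \<sigma> t p) has_real_derivative 0 - d_s (\<lambda>s t. laplacian (v s t)) s t p) (at s)"
    unfolding \<Phi>_def by (intro DERIV_diff has_derivative_d_s[OF fam_laplacian[OF fam_v] st p] DERIV_const)
  then show "d_s \<Phi> s t p = - laplacian (d_s w s t) p"
    unfolding d_s_def[of \<Phi>] using d_s_laplacian[OF fam_v st p] lap by (simp add: DERIV_imp_deriv)
  have "((\<lambda>\<tau>. \<Phi> s \<tau> p) has_real_derivative 0 - d_t (\<lambda>s t. laplacian (v s t)) s t p) (at t)"
    unfolding \<Phi>_def by (intro DERIV_diff has_derivative_d_t[OF fam_laplacian[OF fam_v] st p] DERIV_const)
  then show "d_t \<Phi> s t p = - laplacian (d_t w s t) p"
    unfolding d_t_def[of \<Phi>] using d_t_laplacian[OF fam_v st p] lap by (simp add: DERIV_imp_deriv)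
qed

text \<open>The factor \<open>exp (2 * v s t p)\<close> contained in \<open>\<Phi>\<close> is
  exactly the one by which the gradient product of the conformal metric differs from
  \<open>gi\<close>.\<close>

lemma scaled_grad_inner:
  assumes "p \<in> M"
  shows "1 / gauss_curvature A (conformal g0 (w s t)) p * grad_inner A (conformal g0 (w s t)) a b p = gi a b p / \<Phi> s t p"
  unfolding \<Phi>_eq grad_inner_conformal[OF assms, of "v s t" a b, symmetric] conf by simp

lemma cov_s_eq: "p \<in> M \<Longrightarrow> cov_s A g0 w \<alpha> s t p = d_s \<alpha> s t p + gi (\<alpha> s t) (d_s w s t) p / \<Phi> s t p"
  using scaled_grad_inner[of p s t] by (simp add: cov_s_def cov_deriv_def d_s_def[abs_def])

lemma cov_t_eq: "p \<in> M \<Longrightarrow> cov_t A g0 w \<alpha> s t p = d_t \<alpha> s t p + gi (\<alpha> s t) (d_t w s t) p / \<Phi> s t p"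
  using scaled_grad_inner[of p s t] by (simp add: cov_t_def cov_deriv_def d_t_def[abs_def])

lemma \<Phi>_0: "p \<in> M \<Longrightarrow> \<Phi> 0 0 p = K p" and K_0: "p \<in> M \<Longrightarrow> gauss_curvature A (conformal g0 (w 0 0)) p = K p"
proof -
  assume p: "p \<in> M"
  have "laplacian (v 0 0) p = laplacian (\<lambda>p. 0) p"
    by (intro laplacian_cong[OF p] fam_smooth[OF fam_v zero_I zero_I])
      (auto simp: v_def w0 smooth_functions_def comp_def smooth_on_const)
  then show 1: "\<Phi> 0 0 p = K p" by (simp add: \<Phi>_def laplacian_zero)
  show "gauss_curvature A (conformal g0 (w 0 0)) p = K p"
    using 1 unfolding \<Phi>_eq by (simp add: v_def w0 p)
qed

text \<open>\<open>N\<close> and \<open>P\<close> are the numerators of the connection terms in the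
  covariant derivatives of \<open>d_t w\<close> in the directions t and s.\<close>

definition N :: "real \<Rightarrow> real \<Rightarrow> 'p \<Rightarrow> real" where "N s t = gi (d_t w s t) (d_t w s t)"
definition P :: "real \<Rightarrow> real \<Rightarrow> 'p \<Rightarrow> real" where "P s t = gi (d_t w s t) (d_s w s t)"

lemma fam_w: "fam (d_s w)" "fam (d_t w)" "fam (d_t (d_t w))" "fam (d_s (d_t w))"
  by (intro fam_d_s fam_d_t w)+

lemma fam_NP: "fam N" "fam P"
  using fam_grad_inner[OF fam_w(2,2)] fam_grad_inner[OF fam_w(2,1)] by (simp_all add: N_def[abs_def] P_def[abs_def])

lemma \<Phi>_nz: "s \<in> I \<Longrightarrow> t \<in> I \<Longrightarrow> p \<in> M \<Longrightarrow> \<Phi> s t p \<noteq> 0"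
  using \<Phi>_pos by fastforce

lemma fam_NP\<Phi>: "fam (\<lambda>s t p. N s t p / \<Phi> s t p)" "fam (\<lambda>s t p. P s t p / \<Phi> s t p)"
  by (intro fam_divide fam_NP fam_\<Phi> \<Phi>_nz; assumption)+

text \<open>The third-order derivatives of the family cancel by the symmetry of mixed partial
  derivatives, and so do all second-order derivatives by the product rule for the inner product of
  gradients: only first-order data of the family survive in the curvature.\<close>

lemma curvature_pointwise:
  assumes p: "p \<in> M"
  shows "cov_s A g0 w (cov_t A g0 w (d_t w)) 0 0 p - cov_t A g0 w (cov_s A g0 w (d_t w)) 0 0 p =
    (gi \<psi> \<psi> p * laplacian \<phi> p - gi \<psi> \<phi> p * laplacian \<psi> p) / (K p)\<^sup>2
    + (gi (\<lambda>q. gi \<psi> \<psi> q / K q) \<phi> p - gi (\<lambda>q. gi \<psi> \<phi> q / K q) \<psi> p) / K p"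
proof -
  note z = zero_I
  have C1: "\<alpha> 0 0 \<in> C1_functions" if "fam \<alpha>" for \<alpha>
    by (rule smooth_C1[OF fam_smooth[OF that z z]])
  \<comment> \<open>Closed forms of the two inner covariant derivatives. The agreement is
    established on \<open>M\<close>, hence the passage through congruence rules.\<close>
  define Y1 where "Y1 s t q = d_t (d_t w) s t q + N s t q / \<Phi> s t q" for s t q
  define Y2 where "Y2 s t q = d_s (d_t w) s t q + P s t q / \<Phi> s t q" for s t q
  have sm: "d_t w 0 0 \<in> C1_functions" "d_s w 0 0 \<in> C1_functions" "d_t (d_t w) 0 0 \<in> C1_functions" "d_s (d_t w) 0 0 \<in> C1_functions"
    "(\<lambda>q. N 0 0 q / \<Phi> 0 0 q) \<in> C1_functions" "(\<lambda>q. P 0 0 q / \<Phi> 0 0 q) \<in> C1_functions"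
    using fam_w[THEN C1] fam_NP\<Phi>[THEN C1] by simp_all
  have c1: "cov_t A g0 w (d_t w) s t q = Y1 s t q" "cov_s A g0 w (d_t w) s t q = Y2 s t q" if "q \<in> M" for s t q
    using that by (simp_all add: cov_t_eq cov_s_eq Y1_def Y2_def N_def P_def)
  have "d_s (cov_t A g0 w (d_t w)) 0 0 p = d_s Y1 0 0 p" "d_t (cov_s A g0 w (d_t w)) 0 0 p = d_t Y2 0 0 p"
    by (intro d_s_cong d_t_cong c1 p z)+
  moreover have "gi (cov_t A g0 w (d_t w) 0 0) (d_s w 0 0) p = gi (Y1 0 0) (d_s w 0 0) p"
     "gi (cov_s A g0 w (d_t w) 0 0) (d_t w 0 0) p = gi (Y2 0 0) (d_t w 0 0) p"
    by (intro grad_inner_cong p c1 refl; assumption)+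
  ultimately have R: "cov_s A g0 w (cov_t A g0 w (d_t w)) 0 0 p - cov_t A g0 w (cov_s A g0 w (d_t w)) 0 0 p =
    d_s Y1 0 0 p + gi (Y1 0 0) (d_s w 0 0) p / \<Phi> 0 0 p - (d_t Y2 0 0 p + gi (Y2 0 0) (d_t w 0 0) p / \<Phi> 0 0 p)"
    by (simp add: cov_s_eq[OF p] cov_t_eq[OF p])
  have nz: "\<Phi> 0 0 p \<noteq> 0" by (rule \<Phi>_nz[OF z z p])
  have "((\<lambda>\<sigma>. Y1 \<sigma> 0 p) has_real_derivative d_s (d_t (d_t w)) 0 0 p
      + (d_s N 0 0 p * \<Phi> 0 0 p - N 0 0 p * d_s \<Phi> 0 0 p) / (\<Phi> 0 0 p * \<Phi> 0 0 p)) (at 0)"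
    unfolding Y1_def by (intro DERIV_add DERIV_divide has_derivative_d_s fam_w fam_NP fam_\<Phi> z p nz)
  then have Y1: "d_s Y1 0 0 p = d_s (d_t (d_t w)) 0 0 p
      + (d_s N 0 0 p * \<Phi> 0 0 p - N 0 0 p * d_s \<Phi> 0 0 p) / (\<Phi> 0 0 p * \<Phi> 0 0 p)"
    unfolding d_s_def[of Y1] by (rule DERIV_imp_deriv)
  have "((\<lambda>\<tau>. Y2 0 \<tau> p) has_real_derivative d_t (d_s (d_t w)) 0 0 p
      + (d_t P 0 0 p * \<Phi> 0 0 p - P 0 0 p * d_t \<Phi> 0 0 p) / (\<Phi> 0 0 p * \<Phi> 0 0 p)) (at 0)"
    unfolding Y2_def by (intro DERIV_add DERIV_divide has_derivative_d_t fam_w fam_NP fam_\<Phi> z p nz)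
  then have Y2: "d_t Y2 0 0 p = d_t (d_s (d_t w)) 0 0 p
      + (d_t P 0 0 p * \<Phi> 0 0 p - P 0 0 p * d_t \<Phi> 0 0 p) / (\<Phi> 0 0 p * \<Phi> 0 0 p)"
    unfolding d_t_def[of Y2] by (rule DERIV_imp_deriv)
  have ddd: "d_t (d_s (d_t w)) 0 0 p = d_s (d_t (d_t w)) 0 0 p"
    by (rule d_s_d_t[OF fam_w(2) z z p, symmetric])
  have dN: "d_s N 0 0 p = 2 * gi (d_s (d_t w) 0 0) (d_t w 0 0) p"
    using d_s_grad_inner[OF fam_w(2,2) z z p] grad_inner_commute[OF p sm(4,1)] by (simp add: N_def[abs_def])
  have "d_t P 0 0 p = gi (d_t (d_t w) 0 0) (d_s w 0 0) p + gi (d_t w 0 0) (d_t (d_s w) 0 0) p"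
    using d_t_grad_inner[OF fam_w(2,1) z z p] by (simp add: P_def[abs_def])
  also have "gi (d_t w 0 0) (d_t (d_s w) 0 0) p = gi (d_t w 0 0) (d_s (d_t w) 0 0) p"
    by (rule grad_inner_cong[OF p refl d_s_d_t[OF w z z, symmetric]])
  also have "\<dots> = gi (d_s (d_t w) 0 0) (d_t w 0 0) p" by (rule grad_inner_commute[OF p sm(1,4)])
  finally have dP: "d_t P 0 0 p = gi (d_t (d_t w) 0 0) (d_s w 0 0) p + gi (d_s (d_t w) 0 0) (d_t w 0 0) p" .
  have gY: "gi (Y1 0 0) (d_s w 0 0) p = gi (d_t (d_t w) 0 0) (d_s w 0 0) p + gi (\<lambda>q. N 0 0 q / \<Phi> 0 0 q) (d_s w 0 0) p"
    "gi (Y2 0 0) (d_t w 0 0) p = gi (d_s (d_t w) 0 0) (d_t w 0 0) p + gi (\<lambda>q. P 0 0 q / \<Phi> 0 0 q) (d_t w 0 0) p"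
    using grad_inner_add[OF p sm(3,5,2)] grad_inner_add[OF p sm(4,6,1)] by (simp_all add: Y1_def[abs_def] Y2_def[abs_def])
  \<comment> \<open>The two copies of the product of the gradients of \<open>d_s (d_t w)\<close> and
    \<open>d_t w\<close> in \<open>dN\<close> cancel against one copy in \<open>dP\<close> and one
    in \<open>gY\<close>; the product of the gradients of \<open>d_t (d_t w)\<close> and
    \<open>d_s w\<close> enters through \<open>dP\<close> and \<open>gY\<close> with opposite
    signs.\<close>
  have "cov_s A g0 w (cov_t A g0 w (d_t w)) 0 0 p - cov_t A g0 w (cov_s A g0 w (d_t w)) 0 0 p =
    (N 0 0 p * laplacian (d_s w 0 0) p - P 0 0 p * laplacian (d_t w 0 0) p) / (\<Phi> 0 0 p)\<^sup>2
    + (gi (\<lambda>q. N 0 0 q / \<Phi> 0 0 q) (d_s w 0 0) p - gi (\<lambda>q. P 0 0 q / \<Phi> 0 0 q) (d_t w 0 0) p) / \<Phi> 0 0 p"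
    unfolding R Y1 Y2 ddd dN dP gY d_\<Phi>[OF z z p] using nz
    by (simp add: field_simps power2_eq_square)
  moreover have NP: "N 0 0 q = gi \<psi> \<psi> q" "P 0 0 q = gi \<psi> \<phi> q" if "q \<in> M" for q
    unfolding N_def P_def by (intro grad_inner_cong that w0; assumption)+
  moreover have "laplacian (d_s w 0 0) p = laplacian \<phi> p" "laplacian (d_t w 0 0) p = laplacian \<psi> p"
    by (intro laplacian_cong p fam_smooth[OF _ z z] fam_w \<phi> \<psi> w0; assumption)+
  moreover have "gi (\<lambda>q. N 0 0 q / \<Phi> 0 0 q) (d_s w 0 0) p = gi (\<lambda>q. gi \<psi> \<psi> q / K q) \<phi> p"
    "gi (\<lambda>q. P 0 0 q / \<Phi> 0 0 q) (d_t w 0 0) p = gi (\<lambda>q. gi \<psi> \<phi> q / K q) \<psi> p"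
    using NP \<Phi>_0 w0 by (auto intro!: grad_inner_cong p)
  ultimately show ?thesis using NP[OF p] \<Phi>_0[OF p] by simp
qed

lemma family_curvature_eq:
  "family_curvature M A g0 w = (LINT p|area. 1 / K p * (- (gi \<phi> \<phi> p * gi \<psi> \<psi> p) + (gi \<phi> \<psi> p)\<^sup>2))"
proof -
  have Kp: "K p > 0" if "p \<in> M" for p
    using \<Phi>_pos[OF zero_I zero_I that] \<Phi>_0[OF that] by simp
  then have Knz: "K p \<noteq> 0" if "p \<in> M" for p using that by fastforce
  have am: "area_measure M A (conformal g0 (w 0 0)) = area"
    unfolding g by (rule area_measure_cong) (simp add: conformal_def w0)
  define f1 f2 where "f1 p = gi \<psi> \<psi> p / K p" and "f2 p = gi \<psi> \<phi> p / K p" for p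
  have sm: "f1 \<in> smooth_functions A" "f2 \<in> smooth_functions A"
    unfolding f1_def f2_def by (intro smooth_functions_divide smooth_grad_inner smooth_gauss_curvature \<phi> \<psi> Knz; assumption)+
  note c1 = sm[THEN smooth_C1] \<phi>[THEN smooth_C1] \<psi>[THEN smooth_C1]
  \<comment> \<open>The test factor \<open>\<phi>\<close> is moved into the vector fields, so that
    Green's identity applies to \<open>h1\<close> and \<open>h2\<close>. The terms where the
    derivative falls on that factor are compensated by \<open>R\<close>.\<close>
  define h1 h2 where "h1 p = \<phi> p * f1 p" and "h2 p = \<phi> p * f2 p" for p
  have hC: "h1 \<in> C1_functions" "h2 \<in> C1_functions"
    unfolding h1_def h2_def by (intro C1_mult c1)+
  have h: "gi h1 \<phi> p = \<phi> p * gi f1 \<phi> p + f1 p * gi \<phi> \<phi> p" "gi h2 \<psi> p = \<phi> p * gi f2 \<psi> p + f2 p * gi \<phi> \<psi> p" if "p \<in> M" for p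
    using grad_inner_mult[OF that c1(3,1,3)] grad_inner_mult[OF that c1(3,2,4)] by (simp_all add: h1_def[abs_def] h2_def[abs_def])
  define R where "R p = 1 / K p * (- (gi \<phi> \<phi> p * gi \<psi> \<psi> p) + (gi \<phi> \<psi> p)\<^sup>2)" for p
  have cont: "continuous_on M R"
    unfolding R_def
    by (intro continuous_intros smooth_continuous[OF smooth_grad_inner] smooth_continuous[OF smooth_gauss_curvature] \<phi> \<psi>) (use Knz in blast)
  have pointwise: "(cov_s A g0 w (cov_t A g0 w (d_t w)) 0 0 p - cov_t A g0 w (cov_s A g0 w (d_t w)) 0 0 p)
      * d_s w 0 0 p * gauss_curvature A (conformal g0 (w 0 0)) p = green h1 \<phi> p - green h2 \<psi> p + R p"
    if p: "p \<in> M" for p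
  proof -
    have "gi \<psi> \<phi> p = gi \<phi> \<psi> p" by (rule grad_inner_commute[OF p c1(4,3)])
    then show ?thesis
      unfolding curvature_pointwise[OF p] K_0[OF p] w0(2)[OF p] green_def h[OF p] R_def
      unfolding f1_def[abs_def, symmetric] f2_def[abs_def, symmetric] h1_def h2_def
      using Knz[OF p] by (simp add: f1_def f2_def field_simps power2_eq_square)
  qed
  have "family_curvature M A g0 w = (LINT p|area. green h1 \<phi> p - green h2 \<psi> p + R p)"
    unfolding family_curvature_def formal_metric_def am
    by (rule Bochner_Integration.integral_cong[OF refl]) (simp add: pointwise)
  also have "\<dots> = (LINT p|area. green h1 \<phi> p) - (LINT p|area. green h2 \<psi> p) + (LINT p|area. R p)"
    using integrable_continuous[OF continuous_green[OF hC(1) \<phi>]] integrable_continuous[OF continuous_green[OF hC(2) \<psi>]]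
      integrable_continuous[OF cont] by simp
  also have "\<dots> = (LINT p|area. R p)"
    using green_identity[OF hC(1) \<phi>] green_identity[OF hC(2) \<psi>] by (simp add: green_def)
  finally show ?thesis by (simp add: R_def)
qed

end

text \<open>Along \<open>u + s * \<phi> + t * \<psi>\<close> the positivity condition reads K - s
  Delta phi - t Delta psi > 0. On the compact surface the curvature has a positive lower bound and
  both Laplacians are bounded, so small parameters suffice.\<close>

lemma linear_family_exists:
  assumes "metric_surface M A g" "g = conformal g0 u"
    and u: "u \<in> Gamma1_plus M A g0" and \<phi>: "\<phi> \<in> smooth_functions A" and \<psi>: "\<psi> \<in> smooth_functions A"
  shows "\<exists>w. family_through M A g0 u \<phi> \<psi> w"
proof -
  interpret metric_surface M A g by fact
  have us: "u \<in> smooth_functions A" and Kpos: "\<And>p. p \<in> M \<Longrightarrow> gauss_curvature A g p > 0"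
    using u by (auto simp: Gamma1_plus_def assms(2))
  obtain k where k: "k > 0" "\<And>p. p \<in> M \<Longrightarrow> gauss_curvature A g p \<ge> k"
  proof (cases "M = {}")
    \<comment> \<open>On an empty surface no minimum is attained, and any positive bound will
      do.\<close>
    case True
    then show thesis using that[of 1] by simp
  next
    case False
    obtain q where "q \<in> M" "\<And>p. p \<in> M \<Longrightarrow> gauss_curvature A g q \<le> gauss_curvature A g p"
      using continuous_attains_inf[OF compact_M False smooth_continuous[OF smooth_gauss_curvature]] by blast
    then show thesis using that[of "gauss_curvature A g q"] Kpos by blast
  qed
  have bdd: "\<exists>B. \<forall>p\<in>M. \<bar>laplacian a p\<bar> \<le> B" if "a \<in> smooth_functions A" for a
    using compact_imp_bounded[OF compact_continuous_image[OF smooth_continuous[OF smooth_laplacian[OF that]] compact_M]]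
    by (simp add: bounded_iff)
  obtain B1 B2 where B: "\<And>p. p \<in> M \<Longrightarrow> \<bar>laplacian \<phi> p\<bar> \<le> B1" "\<And>p. p \<in> M \<Longrightarrow> \<bar>laplacian \<psi> p\<bar> \<le> B2"
    using bdd[OF \<phi>] bdd[OF \<psi>] by blast
  define B where "B = \<bar>B1\<bar> + \<bar>B2\<bar>"
  have B0: "B \<ge> 0" by (simp add: B_def)
  \<comment> \<open>The summand 1 covers \<open>B = 0\<close> and makes
    \<open>\<epsilon> * B\<close> strictly smaller than the lower bound \<open>k\<close>.\<close>
  define \<epsilon> where "\<epsilon> = k / (B + 1)"
  have \<epsilon>: "\<epsilon> > 0" "\<epsilon> * B < k" using k(1) B0 by (simp_all add: \<epsilon>_def divide_simps)
  interpret param_surface M A g \<epsilon> by unfold_locales (rule \<epsilon>(1))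
  define w where "w s t p = u p + (s * \<phi> p + t * \<psi> p)" for s t p
  have lin: "fam (\<lambda>s t p. s)" "fam (\<lambda>s t p. t)"
    by (rule famI, simp only: lift_def, rule smooth_on_bounded_linear, intro bounded_linear_intros, rule open_\<Omega>, assumption)+
  have fam_lin: "fam (\<lambda>s t p. s * \<phi> p + t * \<psi> p)"
    by (intro fam_add fam_mult lin fam_const \<phi> \<psi>)
  have fw: "fam w" unfolding w_def by (rule fam_add[OF fam_const[OF us] fam_lin])
  have "w s t \<in> Gamma1_plus M A g0" if st: "s \<in> {-\<epsilon><..<\<epsilon>}" "t \<in> {-\<epsilon><..<\<epsilon>}" for s t
    unfolding Gamma1_plus_def
  proof (intro CollectI conjI ballI)
    show "w s t \<in> smooth_functions A" by (rule fam_smooth[OF fw st])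
    fix p assume p: "p \<in> M"
    have conf: "conformal g0 (w s t) = conformal g (\<lambda>p. s * \<phi> p + t * \<psi> p)"
      using conformal_diff[of g0 "w s t" u] by (simp add: assms(2) w_def[abs_def])
    have "\<bar>s * laplacian \<phi> p\<bar> \<le> \<epsilon> * \<bar>B1\<bar>" "\<bar>t * laplacian \<psi> p\<bar> \<le> \<epsilon> * \<bar>B2\<bar>"
      using st B[OF p] unfolding abs_mult by (intro mult_mono; simp; linarith)+
    then have "s * laplacian \<phi> p + t * laplacian \<psi> p \<le> \<epsilon> * B" unfolding B_def distrib_left by linarith
    then have "gauss_curvature A g p - laplacian (\<lambda>p. s * \<phi> p + t * \<psi> p) p > 0"
      using laplacian_linear[OF \<phi> \<psi> p fam_smooth[OF fam_lin st]] k(2)[OF p] \<epsilon>(2) by simp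
    then have "exp (2 * (s * \<phi> p + t * \<psi> p)) * gauss_curvature A (conformal g0 (w s t)) p > 0"
      by (simp add: laplacian_def conf)
    then show "gauss_curvature A (conformal g0 (w s t)) p > 0" by (simp add: zero_less_mult_iff)
  qed
  moreover have "smooth_on (\<lambda>(s, t, z). w s t (param c z)) ({-\<epsilon><..<\<epsilon>} \<times> {-\<epsilon><..<\<epsilon>} \<times> range_of c)" if "c \<in> A" for c
    using famD[OF fw that] by (simp add: lift_def case_prod_beta')
  moreover have "w 0 0 p = u p" "d_s w 0 0 p = \<phi> p" "d_t w 0 0 p = \<psi> p" for p
    unfolding w_def d_s_def d_t_def by (auto intro!: DERIV_imp_deriv derivative_eq_intros)
  ultimately have "family_through M A g0 u \<phi> \<psi> w"
    unfolding family_through_def using \<epsilon>(1) by blast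
  then show ?thesis by blast
qed

text \<open>The definite description in \<open>sectional_curvature\<close> is meaningful only if all
  families give one value, so this is made part of the claim.\<close>

theorem proposition2p4:
  fixes M :: "'p::t2_space set" and A :: "'p chart set" and g0 :: "'p metric"
    and u \<phi> \<psi> :: "'p \<Rightarrow> real"
  assumes "closed_surface M A"
    and "riemannian_metric A g0"
    and "\<And>p. p \<in> M \<Longrightarrow> gauss_curvature A g0 p > 0"
    and "u \<in> Gamma1_plus M A g0"
    and "\<phi> \<in> smooth_functions A" and "\<psi> \<in> smooth_functions A"
  defines "gu \<equiv> conformal g0 u"
  shows "(\<forall>w. family_through M A g0 u \<phi> \<psi> w \<longrightarrow>
            family_curvature M A g0 w = sectional_curvature M A g0 u \<phi> \<psi>) \<and>
         sectional_curvature M A g0 u \<phi> \<psi> =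
           (LINT p|area_measure M A gu. 1 / gauss_curvature A gu p *
              (- (grad_inner A gu \<phi> \<phi> p * grad_inner A gu \<psi> \<psi> p)
               + (grad_inner A gu \<phi> \<psi> p)\<^sup>2)) \<and>
         sectional_curvature M A g0 u \<phi> \<psi> =
           - (LINT p|area_measure M A gu. 1 / gauss_curvature A gu p * wedge_norm2 A gu \<phi> \<psi> p) \<and>
         sectional_curvature M A g0 u \<phi> \<psi> \<le> 0"
proof -
  have u: "u \<in> smooth_functions A" and Kpos: "\<And>p. p \<in> M \<Longrightarrow> gauss_curvature A gu p > 0"
    using assms(4) by (auto simp: Gamma1_plus_def gu_def)
  have "metric_surface M A g0" by unfold_locales (fact assms)+
  then interpret metric_surface M A gu
    unfolding gu_def by (rule metric_surface.conformal_metric_surface[OF _ u])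
  let ?k = "LINT p|area_measure M A gu. 1 / gauss_curvature A gu p *
              (- (grad_inner A gu \<phi> \<phi> p * grad_inner A gu \<psi> \<psi> p) + (grad_inner A gu \<phi> \<psi> p)\<^sup>2)"
  have k: "family_curvature M A g0 w = ?k" if w: "family_through M A g0 u \<phi> \<psi> w" for w
  proof -
    obtain \<epsilon> where \<epsilon>: "\<epsilon> > 0"
      "\<And>c. c \<in> A \<Longrightarrow> smooth_on (\<lambda>(s, t, z). w s t (param c z)) ({-\<epsilon><..<\<epsilon>} \<times> {-\<epsilon><..<\<epsilon>} \<times> range_of c)"
      "\<And>s t. s \<in> {-\<epsilon><..<\<epsilon>} \<Longrightarrow> t \<in> {-\<epsilon><..<\<epsilon>} \<Longrightarrow> w s t \<in> Gamma1_plus M A g0"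
      using w unfolding family_through_def by blast
    interpret param_surface M A gu \<epsilon> by unfold_locales (rule \<epsilon>(1))
    have "fam w" by (rule famI) (use \<epsilon>(2) in \<open>simp add: lift_def case_prod_beta'\<close>)
    then interpret conformal_family M A gu \<epsilon> g0 u w \<phi> \<psi>
      using \<epsilon>(3) w u assms(5,6) by unfold_locales (auto simp: gu_def family_through_def Gamma1_plus_def)
    show ?thesis by (rule family_curvature_eq)
  qed
  obtain w where "family_through M A g0 u \<phi> \<psi> w"
    using linear_family_exists[OF metric_surface_axioms gu_def[THEN meta_eq_to_obj_eq] assms(4-6)] by blast
  \<comment> \<open>\<open>k\<close> gives uniqueness of the described value, and the family just
    obtained gives existence.\<close>
  with k have sec: "sectional_curvature M A g0 u \<phi> \<psi> = ?k"
    unfolding sectional_curvature_def by (intro the_equality) blast+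
  have C1: "\<phi> \<in> C1_functions" "\<psi> \<in> C1_functions" using assms(5,6) smooth_C1 by blast+
  have "?k = (LINT p|area_measure M A gu. - (1 / gauss_curvature A gu p * wedge_norm2 A gu \<phi> \<psi> p))"
    by (rule Bochner_Integration.integral_cong[OF refl]) (simp add: wedge_norm2_eq(1)[OF _ C1] diff_divide_distrib)
  then have k_wedge: "?k = - (LINT p|area_measure M A gu. 1 / gauss_curvature A gu p * wedge_norm2 A gu \<phi> \<psi> p)"
    by simp
  have "0 \<le> (LINT p|area_measure M A gu. 1 / gauss_curvature A gu p * wedge_norm2 A gu \<phi> \<psi> p)"
    using Kpos wedge_norm2_eq(2)[OF _ C1] by (intro integral_nonneg_AE AE_I2) (simp add: less_imp_le)
  then show ?thesis using k sec k_wedge by simp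
qed

end
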